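(* Assume that $\varphi$ is non-contractive, let $(S,\iota)$ be a free analytic 1-submanifold of $M$ with $S\notin\mathcal F(S)$, assume that $S$ is positive, and let $\Sigma\in\mathcal M(S)$ be compact with $\Sigma\subset\mathrm{int}[S]$. 1) Let $S\cong U(1)$ with $\Sigma$-decomposition $\Sigma_0,\dots,\Sigma_n$, $[g_0],\dots,[g_n]$. Then for each $g\in[g_1]$ we have $[g_k]=[g^k]$ for all $k=0,\dots,n$; hence $[g^n]=[g^{-1}]$. 2) Let $S\cong D$ (an interval) with $\Sigma$-decomposition $(\{\Sigma_n\}_{n\in\mathfrak n},\{[g_n]\}_{n\in\mathfrak n})$. Then for each $g\in[g_1]$ we have $[g_n]=[g^n]$ for all $n\in\mathfrak n$.
   Context: Basic setting. Manifolds and Lie groups are finite-dimensional, Hausdorff, real analytic, without boundary unless stated otherwise, and not assumed second countable. $\varphi\colon G\times M\to M$, $(g,x)\mapsto g\cdot x$, is a left action of a Lie group $G$ on an analytic manifold $M$ such that $g\mapsto g\cdot x$ is continuous for each $x\in M$. $\varphi$ is analytic in $M$ if $x\mapsto g\cdot x$ is analytic for each $g\in G$; it is non-contractive if it is analytic in $M$ and for each $C\subseteq M$ with $|C|\ge 2$ and each $x\in M\setminus C$ there is a neighbourhood $U$ of $x$ with $g\cdot C\not\subseteq U$ for all $g\in G$. An analytic 1-submanifold $(S,\iota)$ of $M$ consists of a connected, Hausdorff, second countable 1-dimensional analytic manifold $S$ with (possibly empty) boundary and an injective analytic immersion $\iota\colon S\to M$. There is a homeomorphism $\upsilon\colon B\to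 S$ where either $B=U(1)$ (written $S\cong U(1)$) or $B=D\subseteq\mathbb R$ is a nondegenerate interval (written $S\cong D$). A segment is a connected subset of $S$ with more than one point; $\mathrm{Seg}(S)$ is the set of segments. For $\Sigma\in\mathrm{Seg}(S)$: $\mathrm{int}[\Sigma]:=\upsilon(\text{topological interior of }\upsilon^{-1}(\Sigma)\text{ in }U(1)\text{ resp. }\mathbb R)$ and $\partial_\Sigma:=\Sigma\setminus\mathrm{int}[\Sigma]$. A boundary segment of $\Sigma$ is a segment $\Sigma'\subseteq\Sigma$ with $\Sigma\setminus\Sigma'$ connected (possibly empty). The symbol $\subset$ means proper inclusion. $g\cdot\iota$ denotes $z\mapsto g\cdot\iota(z)$; $G_x$ is the stabilizer of $x\in M$, $G_z:=G_{\iota(z)}$ for $z\in S$, $G_S:=\bigcap_{z\in S}G_{\iota(z)}$, $\mathcal H(S):=G/G_S$ (left cosets), and $[g]\in\mathcal H(S)$ is the class of $g$. For $\Sigma,\Sigma'\in\mathrm{Seg}(S)$ and $g\in G$, write $g\cdot\iota|_\Sigma\sim_\circ\iota|_{\Sigma'}$ if $g\cdot\iota(O)=\iota(O')$ for open (in $S$) segments $O\subseteq\Sigma$, $O'\subseteq\Sigma'$ on which $\iota$ is an embedding. $\Sigma\in\mathrm{Seg}(S)$ is a free segment, $\Sigma\in\mathcal F(S)$, if for $g\in G$: $g\cdot\iota|_\Sigma\sim_\circ\iota|_\Sigma\Leftrightarrow g\in G_S$. $\mathcal M(S)$ is the set of inclusion-maximal elements of $\mathcal F(S)$. $(S,\iota)$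 is free if $\mathcal F(S)\neq\emptyset$. Positive. Let $\Sigma\in\mathcal M(S)$ be compact with $\Sigma\subset S$. For $z\in\partial_\Sigma\cap\mathrm{int}[S]$ (this set is non-empty) let $[g_z]\neq[e]$ be the unique class in $\mathcal H(S)$ for which there exist a compact segment $\Sigma_b\subseteq\Sigma$ with $b\in\partial_\Sigma\cap\partial_{\Sigma_b}$ and a compact $\Sigma_z\in\mathcal F(S)$ with $\Sigma\cap\Sigma_z=\partial_\Sigma\cap\partial_{\Sigma_z}=\{z\}$ such that $g_z\cdot\iota(\Sigma_b)=\iota(\Sigma_z)$ and $g_z\cdot\iota(b)=\iota(z)$. $\Sigma$ is positive if $g_z\notin G_z$ for every $z\in\partial_\Sigma\cap\mathrm{int}[S]$. $S$ is called positive if $S$ admits no $z$-decomposition and each compact $\Sigma\in\mathcal M(S)$ is positive. Here (only for $S\cong D$, $z\in\mathrm{int}[S]$) a $z$-decomposition is a class $[e]\neq[g]\in\mathcal H(S)$ with $g\in G_z$ such that there are compact segments $K_\pm\subseteq S$ with $g\cdot\iota(K_-)=\iota(K_+)$, $K_-\cap K_+=\{z\}$, and $\Sigma_\pm\in\mathcal F(S)$ for the unique boundary segments $\Sigma_\pm$ of $S$ with $S=\Sigma_-\cup\Sigma_+$, $\Sigma_-\cap\Sigma_+=\{z\}$, $K_\pm\subseteq\Sigma_\pm$. $\Sigma$-decomposition, $S\cong U(1)$. For $\Sigma\in\mathcal M(S)$, $\Sigma\subset S$: a $\Sigma$-decomposition consists of (compact) $\Sigma_0,\dots,\Sigma_n\in\mathcal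 M(S)$, $n\ge1$, and classes $[g_0],\dots,[g_n]\in\mathcal H(S)$ with $\Sigma_0=\Sigma$, $S=\bigcup_{k=0}^n\Sigma_k$, $g_k\cdot\iota(\Sigma_0)=\iota(\Sigma_k)$ for $0\le k\le n$; if $n=1$, $\Sigma_0\cap\Sigma_1=\partial_{\Sigma_0}\cap\partial_{\Sigma_1}$ consists of the two boundary points of $\Sigma_0$ and $\Sigma_1$; if $n\ge2$, $\Sigma_p\cap\Sigma_q=\partial_{\Sigma_p}\cap\partial_{\Sigma_q}$ is a singleton for $|p-q|\in\{1,n\}$ and empty for $2\le|p-q|\le n-1$. $\Sigma$-decomposition, $S\cong D$. For compact $\Sigma\in\mathcal M(S)$, $\Sigma\subset\mathrm{int}[S]$: a $\Sigma$-decomposition is a pair $(\{\Sigma_n\}_{n\in\mathfrak n},\{[g_n]\}_{n\in\mathfrak n})$ with $\mathfrak n=\{n\in\mathbb Z\mid\mathfrak n_-\le n\le\mathfrak n_+\}$, $\mathfrak n_\pm\in\mathbb Z_{\ne0}\cup\{-\infty,\infty\}$, $\mathfrak n_-<0<\mathfrak n_+$, $[g_n]\in\mathcal H(S)$, and segments $\Sigma_n$ on which $\iota$ is an embedding, such that: $\Sigma_0=\Sigma$, and $\Sigma_{\mathfrak n_\pm}$ is a boundary segment of $S$ if $\mathfrak n_\pm\ne\pm\infty$; $\Sigma_p\cap\Sigma_q=\partial_{\Sigma_p}\cap\partial_{\Sigma_q}$ is a singleton for $|p-q|=1$ and empty for $|p-q|\ge2$; $g_n\cdot\iota(\Sigma_0)=\iota(\Sigma_n)$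 for $\mathfrak n_-<n<\mathfrak n_+$, and $g_{\mathfrak n_\pm}\cdot\iota(\Sigma_\pm)=\iota(\Sigma_{\mathfrak n_\pm})$ if $\mathfrak n_\pm\neq\pm\infty$, for certain boundary segments $\Sigma_\pm$ of $\Sigma_0$. *)

theory Defs
  imports "HOL-Analysis.Analysis" "HOL-Algebra.Group_Action" "HOL-Library.Extended"
begin

subsection \<open>Real analytic manifolds\<close>

text \<open>
  Points of n-dimensional real space are the elements of \<^term>\<open>topspace (Euclidean_space n)\<close>,
  i.e. sequences vanishing from index n on; the case n = 0 is included, so that discrete groups
  are Lie groups.
\<close>

definition multi_indices :: "nat \<Rightarrow> (nat \<Rightarrow> nat) set" where
  "multi_indices n = {\<alpha>. \<forall>i\<ge>n. \<alpha> i = 0}"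

text \<open>
  The set A need not be open: near each of its points f has to agree on A with the sum of a power
  series which converges on a full polydisc of the ambient space. For open A this is
  real analyticity; for A open in a half-space it is analyticity up to the boundary.
\<close>

definition real_analytic_on :: "nat \<Rightarrow> (nat \<Rightarrow> real) set \<Rightarrow> ((nat \<Rightarrow> real) \<Rightarrow> real) \<Rightarrow> bool" where
  "real_analytic_on n A f \<longleftrightarrow>
     (\<forall>x\<in>A. \<exists>r>0. \<exists>c. \<forall>y\<in>topspace (Euclidean_space n). (\<forall>i<n. \<bar>y i - x i\<bar> < r) \<longrightarrow>
        (\<lambda>\<alpha>. c \<alpha> * (\<Prod>i<n. (y i - x i) ^ \<alpha> i)) summable_on multi_indices n \<and>
        (y \<in> A \<longrightarrow> f y = (\<Sum>\<^sub>\<infinity>\<alpha>\<in>multi_indices n. c \<alpha> * (\<Prod>i<n. (y i - x i) ^ \<alpha> i))))"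

type_synonym 'a chart = "'a set \<times> ('a \<Rightarrow> nat \<Rightarrow> real)"

definition half_space :: "nat \<Rightarrow> (nat \<Rightarrow> real) set" where
  "half_space n = {x \<in> topspace (Euclidean_space n). 0 \<le> x 0}"

definition is_chart_on :: "nat \<Rightarrow> (nat \<Rightarrow> real) set \<Rightarrow> 'a topology \<Rightarrow> 'a chart \<Rightarrow> bool" where
  "is_chart_on n H X = (\<lambda>(U, \<phi>).
     openin X U \<and>
     openin (subtopology (Euclidean_space n) H) (\<phi> ` U) \<and>
     homeomorphic_map (subtopology X U) (subtopology (Euclidean_space n) (\<phi> ` U)) \<phi>)"

definition local_rep :: "'a chart \<Rightarrow> 'b chart \<Rightarrow> ('a \<Rightarrow> 'b) \<Rightarrow> (nat \<Rightarrow> real) \<Rightarrow> nat \<Rightarrow> real" where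
  "local_rep = (\<lambda>(U, \<phi>) (V, \<psi>) f t. \<psi> (f (inv_into U \<phi> t)))"

definition local_dom :: "'a chart \<Rightarrow> 'b chart \<Rightarrow> ('a \<Rightarrow> 'b) \<Rightarrow> (nat \<Rightarrow> real) set" where
  "local_dom = (\<lambda>(U, \<phi>) (V, \<psi>) f. \<phi> ` {x \<in> U. f x \<in> V})"

definition analytic_in_charts ::
    "nat \<Rightarrow> 'a chart set \<Rightarrow> nat \<Rightarrow> 'b chart set \<Rightarrow> ('a \<Rightarrow> 'b) \<Rightarrow> bool" where
  "analytic_in_charts m A n B f \<longleftrightarrow>
     (\<forall>c\<in>A. \<forall>d\<in>B. \<forall>j<n. real_analytic_on m (local_dom c d f) (\<lambda>t. local_rep c d f t j))"

text \<open>Atlases are not required to be maximal.\<close>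

definition analytic_atlas :: "nat \<Rightarrow> 'a topology \<Rightarrow> 'a chart set \<Rightarrow> bool" where
  "analytic_atlas n X A \<longleftrightarrow>
     (\<Union>c\<in>A. fst c) = topspace X \<and> analytic_in_charts n A n A (\<lambda>x. x)"

definition analytic_manifold :: "nat \<Rightarrow> 'a topology \<Rightarrow> 'a chart set \<Rightarrow> bool" where
  "analytic_manifold n X A \<longleftrightarrow>
     Hausdorff_space X \<and> analytic_atlas n X A \<and>
     (\<forall>c\<in>A. is_chart_on n (topspace (Euclidean_space n)) X c)"

definition analytic_manifold_with_boundary :: "nat \<Rightarrow> 'a topology \<Rightarrow> 'a chart set \<Rightarrow> bool" where
  "analytic_manifold_with_boundary n X A \<longleftrightarrow>
     Hausdorff_space X \<and> analytic_atlas n X A \<and>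
     (\<forall>c\<in>A. is_chart_on n (topspace (Euclidean_space n)) X c \<or> is_chart_on n (half_space n) X c)"

definition analytic_map ::
    "nat \<Rightarrow> 'a topology \<Rightarrow> 'a chart set \<Rightarrow> nat \<Rightarrow> 'b topology \<Rightarrow> 'b chart set \<Rightarrow> ('a \<Rightarrow> 'b) \<Rightarrow> bool" where
  "analytic_map m X A n Y B f \<longleftrightarrow> continuous_map X Y f \<and> analytic_in_charts m A n B f"

definition prod_atlas :: "nat \<Rightarrow> 'a chart set \<Rightarrow> 'b chart set \<Rightarrow> ('a \<times> 'b) chart set" where
  "prod_atlas m A B =
     {(U \<times> V, \<lambda>(x, y) i. if i < m then \<phi> x i else \<psi> y (i - m)) | U \<phi> V \<psi>.
        (U, \<phi>) \<in> A \<and> (V, \<psi>) \<in> B}"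

definition lie_group :: "nat \<Rightarrow> ('g, 'r) monoid_scheme \<Rightarrow> 'g topology \<Rightarrow> 'g chart set \<Rightarrow> bool" where
  "lie_group n G X A \<longleftrightarrow>
     group G \<and> topspace X = carrier G \<and> analytic_manifold n X A \<and>
     analytic_map (n + n) (prod_topology X X) (prod_atlas n A A) n X A (\<lambda>(g, h). g \<otimes>\<^bsub>G\<^esub> h) \<and>
     analytic_map n X A n X A (\<lambda>g. inv\<^bsub>G\<^esub> g)"

subsection \<open>Analytic 1-submanifolds\<close>

definition line_point :: "real \<Rightarrow> nat \<Rightarrow> real" where
  "line_point s = (\<lambda>i. if i = 0 then s else 0)"

text \<open>
  An analytic map from a 1-manifold is an immersion iff, in charts, its (at boundary points:
  one-sided) derivative is everywhere non-zero, i.e. some component has a non-zero derivative.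
\<close>

definition analytic_immersion_1 ::
    "'s topology \<Rightarrow> 's chart set \<Rightarrow> nat \<Rightarrow> 'm topology \<Rightarrow> 'm chart set \<Rightarrow> ('s \<Rightarrow> 'm) \<Rightarrow> bool" where
  "analytic_immersion_1 S A m M B \<iota> \<longleftrightarrow>
     analytic_map 1 S A m M B \<iota> \<and>
     (\<forall>c\<in>A. \<forall>d\<in>B. \<forall>t\<in>local_dom c d \<iota>. \<exists>j<m. \<exists>D. D \<noteq> 0 \<and>
        ((\<lambda>s. local_rep c d \<iota> (line_point s) j) has_real_derivative D)
          (at (t 0) within {s. line_point s \<in> local_dom c d \<iota>}))"

definition analytic_1_submanifold ::
    "nat \<Rightarrow> 'm topology \<Rightarrow> 'm chart set \<Rightarrow> 's topology \<Rightarrow> 's chart set \<Rightarrow> ('s \<Rightarrow> 'm) \<Rightarrow> bool" where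
  "analytic_1_submanifold m M B S A \<iota> \<longleftrightarrow>
     connected_space S \<and> second_countable S \<and> analytic_manifold_with_boundary 1 S A \<and>
     inj_on \<iota> (topspace S) \<and> analytic_immersion_1 S A m M B \<iota>"

definition unit_circle :: "complex topology" where
  "unit_circle = top_of_set (sphere 0 1)"

definition nondegenerate_interval :: "real set \<Rightarrow> bool" where
  "nondegenerate_interval D \<longleftrightarrow> is_interval D \<and> (\<exists>x\<in>D. \<exists>y\<in>D. x \<noteq> y)"

definition circle_like :: "'s topology \<Rightarrow> bool" where
  "circle_like S \<longleftrightarrow> unit_circle homeomorphic_space S"

definition interval_like :: "'s topology \<Rightarrow> bool" where
  "interval_like S \<longleftrightarrow> (\<exists>D. nondegenerate_interval D \<and> top_of_set D homeomorphic_space S)"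

definition segment :: "'s topology \<Rightarrow> 's set \<Rightarrow> bool" where
  "segment S \<Sigma> \<longleftrightarrow> connectedin S \<Sigma> \<and> (\<exists>x\<in>\<Sigma>. \<exists>y\<in>\<Sigma>. x \<noteq> y)"

text \<open>
  A homeomorphism from the circle or from an interval onto S is fixed by Hilbert choice; the
  resulting set does not depend on it. For an interval D the interior is taken in the real line,
  not in D, so that end points of D never belong to it.
\<close>

definition seg_interior :: "'s topology \<Rightarrow> 's set \<Rightarrow> 's set" where
  "seg_interior S \<Sigma> =
     (if circle_like S then
        (let \<upsilon> = (SOME \<upsilon>. homeomorphic_map unit_circle S \<upsilon>)
         in \<upsilon> ` (unit_circle interior_of {b \<in> topspace unit_circle. \<upsilon> b \<in> \<Sigma>}))
      else
        (let (D, \<upsilon>) = (SOME (D, \<upsilon>). nondegenerate_interval D \<and> homeomorphic_map (top_of_set D) S \<upsilon>)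
         in \<upsilon> ` interior {b \<in> D. \<upsilon> b \<in> \<Sigma>}))"

definition seg_boundary :: "'s topology \<Rightarrow> 's set \<Rightarrow> 's set" where
  "seg_boundary S \<Sigma> = \<Sigma> - seg_interior S \<Sigma>"

definition boundary_segment :: "'s topology \<Rightarrow> 's set \<Rightarrow> 's set \<Rightarrow> bool" where
  "boundary_segment S \<Sigma> \<Sigma>' \<longleftrightarrow> segment S \<Sigma>' \<and> \<Sigma>' \<subseteq> \<Sigma> \<and> connectedin S (\<Sigma> - \<Sigma>')"

text \<open>
  Since \<open>\<iota>\<close> is an immersion, it is an embedding on a segment iff it is a topological one there.
\<close>

definition embedded_on :: "'m topology \<Rightarrow> 's topology \<Rightarrow> ('s \<Rightarrow> 'm) \<Rightarrow> 's set \<Rightarrow> bool" where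
  "embedded_on M S \<iota> \<Sigma> \<longleftrightarrow> embedding_map (subtopology S \<Sigma>) M \<iota>"

subsection \<open>Group actions and free segments\<close>

definition pointwise_continuous_action ::
    "('g, 'r) monoid_scheme \<Rightarrow> 'g topology \<Rightarrow> ('g \<Rightarrow> 'm \<Rightarrow> 'm) \<Rightarrow> 'm topology \<Rightarrow> bool" where
  "pointwise_continuous_action G T \<phi> M \<longleftrightarrow>
     group_action G (topspace M) \<phi> \<and> (\<forall>x\<in>topspace M. continuous_map T M (\<lambda>g. \<phi> g x))"

definition non_contractive ::
    "('g, 'r) monoid_scheme \<Rightarrow> ('g \<Rightarrow> 'm \<Rightarrow> 'm) \<Rightarrow> nat \<Rightarrow> 'm topology \<Rightarrow> 'm chart set \<Rightarrow> bool" where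
  "non_contractive G \<phi> m M B \<longleftrightarrow>
     (\<forall>g\<in>carrier G. analytic_map m M B m M B (\<phi> g)) \<and>
     (\<forall>C\<subseteq>topspace M. (\<exists>x\<in>C. \<exists>y\<in>C. x \<noteq> y) \<longrightarrow>
        (\<forall>x\<in>topspace M - C. \<exists>U. openin M U \<and> x \<in> U \<and> (\<forall>g\<in>carrier G. \<not> \<phi> g ` C \<subseteq> U)))"

definition submanifold_stabilizer ::
    "('g, 'r) monoid_scheme \<Rightarrow> ('g \<Rightarrow> 'm \<Rightarrow> 'm) \<Rightarrow> 's topology \<Rightarrow> ('s \<Rightarrow> 'm) \<Rightarrow> 'g set" where
  "submanifold_stabilizer G \<phi> S \<iota> = (\<Inter>z\<in>topspace S. stabilizer G \<phi> (\<iota> z))"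

definition coset_class ::
    "('g, 'r) monoid_scheme \<Rightarrow> ('g \<Rightarrow> 'm \<Rightarrow> 'm) \<Rightarrow> 's topology \<Rightarrow> ('s \<Rightarrow> 'm) \<Rightarrow> 'g \<Rightarrow> 'g set" where
  "coset_class G \<phi> S \<iota> g = g <#\<^bsub>G\<^esub> submanifold_stabilizer G \<phi> S \<iota>"

text \<open>\<open>overlaps \<phi> M S \<iota> g \<Sigma> \<Sigma>'\<close> is the relation \<open>g \<cdot> \<iota>|\<Sigma> \<sim>\<^sub>\<circ> \<iota>|\<Sigma>'\<close>.\<close>

definition overlaps ::
    "('g \<Rightarrow> 'm \<Rightarrow> 'm) \<Rightarrow> 'm topology \<Rightarrow> 's topology \<Rightarrow> ('s \<Rightarrow> 'm) \<Rightarrow> 'g \<Rightarrow> 's set \<Rightarrow> 's set \<Rightarrow> bool" where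
  "overlaps \<phi> M S \<iota> g \<Sigma> \<Sigma>' \<longleftrightarrow>
     (\<exists>U U'. segment S U \<and> openin S U \<and> U \<subseteq> \<Sigma> \<and> embedded_on M S \<iota> U \<and>
             segment S U' \<and> openin S U' \<and> U' \<subseteq> \<Sigma>' \<and> embedded_on M S \<iota> U' \<and>
             \<phi> g ` (\<iota> ` U) = \<iota> ` U')"

definition free_segments ::
    "('g, 'r) monoid_scheme \<Rightarrow> ('g \<Rightarrow> 'm \<Rightarrow> 'm) \<Rightarrow> 'm topology \<Rightarrow> 's topology \<Rightarrow> ('s \<Rightarrow> 'm) \<Rightarrow> 's set set" where
  "free_segments G \<phi> M S \<iota> =
     {\<Sigma>. segment S \<Sigma> \<and>
          (\<forall>g\<in>carrier G. overlaps \<phi> M S \<iota> g \<Sigma> \<Sigma> \<longleftrightarrow> g \<in> submanifold_stabilizer G \<phi> S \<iota>)}"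

definition maximal_free_segments ::
    "('g, 'r) monoid_scheme \<Rightarrow> ('g \<Rightarrow> 'm \<Rightarrow> 'm) \<Rightarrow> 'm topology \<Rightarrow> 's topology \<Rightarrow> ('s \<Rightarrow> 'm) \<Rightarrow> 's set set" where
  "maximal_free_segments G \<phi> M S \<iota> =
     {\<Sigma> \<in> free_segments G \<phi> M S \<iota>. \<forall>\<Sigma>'\<in>free_segments G \<phi> M S \<iota>. \<Sigma> \<subseteq> \<Sigma>' \<longrightarrow> \<Sigma>' = \<Sigma>}"

definition free_submanifold ::
    "('g, 'r) monoid_scheme \<Rightarrow> ('g \<Rightarrow> 'm \<Rightarrow> 'm) \<Rightarrow> 'm topology \<Rightarrow> 's topology \<Rightarrow> ('s \<Rightarrow> 'm) \<Rightarrow> bool" where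
  "free_submanifold G \<phi> M S \<iota> \<longleftrightarrow> free_segments G \<phi> M S \<iota> \<noteq> {}"

subsection \<open>Positivity\<close>

definition transition_at ::
    "('g, 'r) monoid_scheme \<Rightarrow> ('g \<Rightarrow> 'm \<Rightarrow> 'm) \<Rightarrow> 'm topology \<Rightarrow> 's topology \<Rightarrow> ('s \<Rightarrow> 'm) \<Rightarrow>
      's set \<Rightarrow> 's \<Rightarrow> 'g \<Rightarrow> bool" where
  "transition_at G \<phi> M S \<iota> \<Sigma> z g \<longleftrightarrow>
     (\<exists>\<Sigma>b b \<Sigma>z. segment S \<Sigma>b \<and> compactin S \<Sigma>b \<and> \<Sigma>b \<subseteq> \<Sigma> \<and>
        b \<in> seg_boundary S \<Sigma> \<inter> seg_boundary S \<Sigma>b \<and>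
        \<Sigma>z \<in> free_segments G \<phi> M S \<iota> \<and> compactin S \<Sigma>z \<and>
        \<Sigma> \<inter> \<Sigma>z = seg_boundary S \<Sigma> \<inter> seg_boundary S \<Sigma>z \<and> \<Sigma> \<inter> \<Sigma>z = {z} \<and>
        \<phi> g ` (\<iota> ` \<Sigma>b) = \<iota> ` \<Sigma>z \<and> \<phi> g (\<iota> b) = \<iota> z)"

definition transition_class ::
    "('g, 'r) monoid_scheme \<Rightarrow> ('g \<Rightarrow> 'm \<Rightarrow> 'm) \<Rightarrow> 'm topology \<Rightarrow> 's topology \<Rightarrow> ('s \<Rightarrow> 'm) \<Rightarrow>
      's set \<Rightarrow> 's \<Rightarrow> 'g set" where
  "transition_class G \<phi> M S \<iota> \<Sigma> z =
     (THE C. C \<noteq> coset_class G \<phi> S \<iota> \<one>\<^bsub>G\<^esub> \<and>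
        (\<exists>g\<in>carrier G. C = coset_class G \<phi> S \<iota> g \<and> transition_at G \<phi> M S \<iota> \<Sigma> z g))"

definition positive_segment ::
    "('g, 'r) monoid_scheme \<Rightarrow> ('g \<Rightarrow> 'm \<Rightarrow> 'm) \<Rightarrow> 'm topology \<Rightarrow> 's topology \<Rightarrow> ('s \<Rightarrow> 'm) \<Rightarrow>
      's set \<Rightarrow> bool" where
  "positive_segment G \<phi> M S \<iota> \<Sigma> \<longleftrightarrow>
     (\<forall>z\<in>seg_boundary S \<Sigma> \<inter> seg_interior S (topspace S).
        \<forall>g\<in>transition_class G \<phi> M S \<iota> \<Sigma> z. g \<notin> stabilizer G \<phi> (\<iota> z))"

definition z_decomposition ::
    "('g, 'r) monoid_scheme \<Rightarrow> ('g \<Rightarrow> 'm \<Rightarrow> 'm) \<Rightarrow> 'm topology \<Rightarrow> 's topology \<Rightarrow> ('s \<Rightarrow> 'm) \<Rightarrow>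
      's \<Rightarrow> 'g \<Rightarrow> bool" where
  "z_decomposition G \<phi> M S \<iota> z g \<longleftrightarrow>
     interval_like S \<and> z \<in> seg_interior S (topspace S) \<and>
     g \<in> carrier G \<and> coset_class G \<phi> S \<iota> g \<noteq> coset_class G \<phi> S \<iota> \<one>\<^bsub>G\<^esub> \<and>
     g \<in> stabilizer G \<phi> (\<iota> z) \<and>
     (\<exists>K K' \<Sigma> \<Sigma>'. segment S K \<and> compactin S K \<and> segment S K' \<and> compactin S K' \<and>
        \<phi> g ` (\<iota> ` K) = \<iota> ` K' \<and> K \<inter> K' = {z} \<and>
        boundary_segment S (topspace S) \<Sigma> \<and> boundary_segment S (topspace S) \<Sigma>' \<and>
        topspace S = \<Sigma> \<union> \<Sigma>' \<and> \<Sigma> \<inter> \<Sigma>' = {z} \<and> K \<subseteq> \<Sigma> \<and> K' \<subseteq> \<Sigma>' \<and>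
        \<Sigma> \<in> free_segments G \<phi> M S \<iota> \<and> \<Sigma>' \<in> free_segments G \<phi> M S \<iota>)"

definition positive_submanifold ::
    "('g, 'r) monoid_scheme \<Rightarrow> ('g \<Rightarrow> 'm \<Rightarrow> 'm) \<Rightarrow> 'm topology \<Rightarrow> 's topology \<Rightarrow> ('s \<Rightarrow> 'm) \<Rightarrow> bool" where
  "positive_submanifold G \<phi> M S \<iota> \<longleftrightarrow>
     \<not> (\<exists>z g. z_decomposition G \<phi> M S \<iota> z g) \<and>
     (\<forall>\<Sigma>\<in>maximal_free_segments G \<phi> M S \<iota>. compactin S \<Sigma> \<longrightarrow> positive_segment G \<phi> M S \<iota> \<Sigma>)"

subsection \<open>Decompositions\<close>

text \<open>The classes of a decomposition are given by representatives \<open>g k\<close>.\<close>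

definition circle_decomposition ::
    "('g, 'r) monoid_scheme \<Rightarrow> ('g \<Rightarrow> 'm \<Rightarrow> 'm) \<Rightarrow> 'm topology \<Rightarrow> 's topology \<Rightarrow> ('s \<Rightarrow> 'm) \<Rightarrow>
      's set \<Rightarrow> nat \<Rightarrow> (nat \<Rightarrow> 's set) \<Rightarrow> (nat \<Rightarrow> 'g) \<Rightarrow> bool" where
  "circle_decomposition G \<phi> M S \<iota> \<Sigma> n \<Sigma>s g \<longleftrightarrow>
     n \<ge> 1 \<and> \<Sigma>s 0 = \<Sigma> \<and> topspace S = (\<Union>k\<le>n. \<Sigma>s k) \<and>
     (\<forall>k\<le>n. \<Sigma>s k \<in> maximal_free_segments G \<phi> M S \<iota> \<and> compactin S (\<Sigma>s k) \<and>
        g k \<in> carrier G \<and> \<phi> (g k) ` (\<iota> ` \<Sigma>s 0) = \<iota> ` \<Sigma>s k) \<and>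
     (n = 1 \<longrightarrow>
        \<Sigma>s 0 \<inter> \<Sigma>s 1 = seg_boundary S (\<Sigma>s 0) \<inter> seg_boundary S (\<Sigma>s 1) \<and>
        seg_boundary S (\<Sigma>s 0) = seg_boundary S (\<Sigma>s 1) \<and> card (seg_boundary S (\<Sigma>s 0)) = 2) \<and>
     (n \<ge> 2 \<longrightarrow>
        (\<forall>p\<le>n. \<forall>q\<le>n.
           (\<bar>int p - int q\<bar> \<in> {1, int n} \<longrightarrow>
              \<Sigma>s p \<inter> \<Sigma>s q = seg_boundary S (\<Sigma>s p) \<inter> seg_boundary S (\<Sigma>s q) \<and>
              is_singleton (\<Sigma>s p \<inter> \<Sigma>s q)) \<and>
           (2 \<le> \<bar>int p - int q\<bar> \<and> \<bar>int p - int q\<bar> \<le> int n - 1 \<longrightarrow>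
              \<Sigma>s p \<inter> \<Sigma>s q = seg_boundary S (\<Sigma>s p) \<inter> seg_boundary S (\<Sigma>s q) \<and>
              \<Sigma>s p \<inter> \<Sigma>s q = {})))"

definition index_set :: "int extended \<Rightarrow> int extended \<Rightarrow> int set" where
  "index_set l u = {n. l \<le> Fin n \<and> Fin n \<le> u}"

definition interval_decomposition ::
    "('g, 'r) monoid_scheme \<Rightarrow> ('g \<Rightarrow> 'm \<Rightarrow> 'm) \<Rightarrow> 'm topology \<Rightarrow> 's topology \<Rightarrow> ('s \<Rightarrow> 'm) \<Rightarrow>
      's set \<Rightarrow> int extended \<Rightarrow> int extended \<Rightarrow> (int \<Rightarrow> 's set) \<Rightarrow> (int \<Rightarrow> 'g) \<Rightarrow> bool" where
  "interval_decomposition G \<phi> M S \<iota> \<Sigma> l u \<Sigma>s g \<longleftrightarrow>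
     l < Fin 0 \<and> Fin 0 < u \<and> \<Sigma>s 0 = \<Sigma> \<and>
     (\<forall>n\<in>index_set l u. segment S (\<Sigma>s n) \<and> embedded_on M S \<iota> (\<Sigma>s n) \<and> g n \<in> carrier G) \<and>
     (\<forall>p\<in>index_set l u. \<forall>q\<in>index_set l u.
        (\<bar>p - q\<bar> = 1 \<longrightarrow>
           \<Sigma>s p \<inter> \<Sigma>s q = seg_boundary S (\<Sigma>s p) \<inter> seg_boundary S (\<Sigma>s q) \<and>
           is_singleton (\<Sigma>s p \<inter> \<Sigma>s q)) \<and>
        (2 \<le> \<bar>p - q\<bar> \<longrightarrow>
           \<Sigma>s p \<inter> \<Sigma>s q = seg_boundary S (\<Sigma>s p) \<inter> seg_boundary S (\<Sigma>s q) \<and>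
           \<Sigma>s p \<inter> \<Sigma>s q = {})) \<and>
     (\<forall>n. l < Fin n \<and> Fin n < u \<longrightarrow> \<phi> (g n) ` (\<iota> ` \<Sigma>s 0) = \<iota> ` \<Sigma>s n) \<and>
     (\<forall>n. (l = Fin n \<or> u = Fin n) \<longrightarrow>
        boundary_segment S (topspace S) (\<Sigma>s n) \<and>
        (\<exists>\<Sigma>'. boundary_segment S (\<Sigma>s 0) \<Sigma>' \<and> \<phi> (g n) ` (\<iota> ` \<Sigma>') = \<iota> ` \<Sigma>s n))"

end

theory Submission
  imports Defs "HOL-Complex_Analysis.Complex_Analysis"
begin

text \<open>
  A group element carrying one side of \<open>\<iota>\<close> at a point into \<open>\<iota>\<close> carries a full neighbourhood of that
  point into \<open>\<iota>\<close>: in charts the curves \<open>g \<cdot> \<iota>\<close> and \<open>\<iota>\<close> extend holomorphically, a component of \<open>\<iota>\<close> is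
  locally invertible since \<open>\<iota>\<close> is an immersion, and the resulting parameter change is real on the real
  line by reflection. So if \<open>g\<^sub>k\<close> maps \<open>\<Sigma>\<^sub>0\<close> onto \<open>\<Sigma>\<^sub>k\<close> and the joint of \<open>\<Sigma>\<^sub>0\<close> and \<open>\<Sigma>\<^sub>1\<close> to the joint of
  \<open>\<Sigma>\<^sub>k\<close> and \<open>\<Sigma>\<^sub>k\<^sub>+\<^sub>1\<close>, then it maps part of \<open>\<Sigma>\<^sub>1\<close> into \<open>\<Sigma>\<^sub>k\<^sub>+\<^sub>1\<close>, and freeness of \<open>\<Sigma>\<^sub>0\<close> gives
  \<open>[g\<^sub>k\<^sub>+\<^sub>1] = [g\<^sub>k g\<^sub>1]\<close>. Positivity enters once: it says that \<open>g\<^sub>1\<close> moves the joint of \<open>\<Sigma>\<^sub>0\<close> and \<open>\<Sigma>\<^sub>1\<close>, so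
  that \<open>g\<^sub>1\<close> maps the other boundary point of \<open>\<Sigma>\<^sub>0\<close> to it and each \<open>g\<^sub>k\<close> respects the orientation.
\<close>

subsection \<open>Real analytic curves and holomorphic extension\<close>

text \<open>Two obstacles shape the proof. First, \<open>\<iota>\<close> is only an injective
  immersion and has no continuous inverse on its image, so every pull-back to \<open>S\<close> goes
  through a segment on which \<open>\<iota>\<close> is an embedding. Second, the common stabilizer
  \<open>H\<close> is not assumed normal, so classes in G/H cannot be multiplied and [g_{k+1}] =
  [g_k g_1] does not by itself propagate powers. What rescues the induction is that h in
  \<open>H\<close> implies g^-1 h g in \<open>H\<close>: the conjugate fixes a part of \<Sigma>
  pointwise, and freeness extends this to all of \<open>S\<close>. All local arguments take place at
  \<open>line_points\<close>, where \<open>S\<close> looks like an open interval and the curve has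
  two sides; the joint of two adjacent segments is always such a point. On the circle, [g^n] =
  [g^-1] comes from one further crossing, from the last segment back to \<Sigma>. On the interval,
  negative indices come from the same chain run with g^-1.\<close>

lemma islimpt_of_real:
  fixes Z :: "real set"
  assumes "s0 islimpt Z"
  shows "complex_of_real s0 islimpt complex_of_real ` Z"
proof -
  have "\<exists>x'\<in>complex_of_real ` Z. x' \<noteq> of_real s0 \<and> dist x' (of_real s0) < e" if "e > 0" for e
  proof -
    from assms that obtain z where "z \<in> Z" "z \<noteq> s0" "dist z s0 < e"
      by (auto simp: islimpt_approachable)
    then show ?thesis by (auto simp: dist_of_real)
  qed
  then show ?thesis by (auto simp: islimpt_approachable)
qed

lemma islimpt_Int_near:
  fixes Z :: "real set"
  assumes "s0 islimpt Z" "0 < e"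
  shows "s0 islimpt {s\<in>Z. \<bar>s - s0\<bar> < e}"
proof -
  have "\<exists>x'\<in>{s\<in>Z. \<bar>s - s0\<bar> < e}. x' \<noteq> s0 \<and> dist x' s0 < d" if "d > 0" for d
  proof -
    from assms that obtain z where "z \<in> Z" "z \<noteq> s0" "dist z s0 < min d e"
      by (metis islimpt_approachable min_less_iff_conj)
    then show ?thesis by (auto simp: dist_real_def)
  qed
  then show ?thesis by (auto simp: islimpt_approachable)
qed

lemma ball_cnj_image:
  "cnj ` ball (complex_of_real s) e = ball (of_real s) e"
proof -
  have d: "dist (complex_of_real s) (cnj w) = dist (of_real s) w" for w
  proof -
    have "norm (complex_of_real s - cnj w) = norm (cnj (complex_of_real s - w))" by simp
    then show ?thesis by (simp only: complex_mod_cnj dist_norm)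
  qed
  show ?thesis
  proof (intro equalityI subsetI)
    fix w assume "w \<in> ball (complex_of_real s) e"
    then have "cnj w \<in> ball (complex_of_real s) e" by (simp add: d)
    then show "w \<in> cnj ` ball (of_real s) e" by (metis complex_cnj_cnj image_eqI)
  qed (auto simp: d)
qed

text \<open>Schwarz reflection plus the identity theorem. \<open>Z\<close> may accumulate at
  \<open>s0\<close> from one side only, while the conclusion covers the whole interval around
  \<open>s0\<close>; here one-sided information becomes two-sided.\<close>

lemma holomorphic_real_on_reals:
  assumes hol: "f holomorphic_on ball (complex_of_real s0) e" and "0 < e"
    and lim: "s0 islimpt Z" and re: "\<And>s. s \<in> Z \<Longrightarrow> \<bar>s - s0\<bar> < e \<Longrightarrow> f (of_real s) \<in> \<real>"
    and "\<bar>s - s0\<bar> < e"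
  shows "f (of_real s) \<in> \<real>"
proof -
  let ?B = "ball (complex_of_real s0) e"
  \<comment> \<open>f agrees with its reflection on Z, hence everywhere\<close>
  have h2: "(cnj \<circ> f \<circ> cnj) holomorphic_on ?B"
    by (rule holomorphic_on_compose_cnj_cnj) (auto simp: ball_cnj_image hol)
  have mem: "complex_of_real x \<in> ?B \<longleftrightarrow> \<bar>x - s0\<bar> < e" for x
    by (simp add: dist_of_real dist_real_def abs_minus_commute)
  have "(\<lambda>z. (cnj \<circ> f \<circ> cnj) z - f z) (of_real s) = 0"
  proof (rule analytic_continuation[where f = "\<lambda>z. (cnj \<circ> f \<circ> cnj) z - f z" and S = ?B and \<xi> = "of_real s0"
        and U = "of_real ` {s\<in>Z. \<bar>s - s0\<bar> < e}"])
    show "(\<lambda>z. (cnj \<circ> f \<circ> cnj) z - f z) holomorphic_on ?B"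
      using h2 hol by (intro holomorphic_intros)
    show "of_real s0 islimpt (of_real ` {s\<in>Z. \<bar>s - s0\<bar> < e} :: complex set)"
      by (intro islimpt_of_real islimpt_Int_near lim \<open>0 < e\<close>)
    show "(cnj \<circ> f \<circ> cnj) z - f z = 0" if "z \<in> of_real ` {s\<in>Z. \<bar>s - s0\<bar> < e}" for z
    proof -
      from that obtain s where "s \<in> Z" "\<bar>s - s0\<bar> < e" "z = of_real s" by auto
      with re[of s] show ?thesis by (simp add: Reals_cnj_iff)
    qed
  qed (use assms mem in auto)
  then show ?thesis by (simp add: Reals_cnj_iff)
qed

text \<open>The parameter change \<open>t\<close> is given only on \<open>Z\<close>. Its holomorphic
  extension \<open>U\<close> is built from the single component \<open>i\<close>; the identity
  theorem, applied along \<open>Z\<close>, then forces all other components to agree along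
  \<open>U\<close> as well.\<close>

lemma analytic_curve_continuation:
  fixes \<alpha> \<beta> :: "nat \<Rightarrow> complex \<Rightarrow> complex" and t :: "real \<Rightarrow> real"
  assumes "0 < e" and \<alpha>: "\<And>j. j < m \<Longrightarrow> \<alpha> j holomorphic_on ball (of_real s0) e"
    and \<beta>: "\<And>j. j < m \<Longrightarrow> \<beta> j holomorphic_on ball (of_real t0) e"
    and i: "i < m" "deriv (\<beta> i) (of_real t0) \<noteq> 0"
    and lim: "s0 islimpt Z" and s0: "s0 \<in> Z" "t s0 = t0" and t: "(t \<longlongrightarrow> t0) (at s0 within Z)"
    and eq: "\<And>s j. s \<in> Z \<Longrightarrow> \<bar>s - s0\<bar> < e \<Longrightarrow> j < m \<Longrightarrow> \<alpha> j (of_real s) = \<beta> j (of_real (t s))"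
  obtains T where "continuous (at s0) T" "T s0 = t0"
    "\<forall>\<^sub>F s in at s0. \<forall>j<m. \<alpha> j (of_real s) = \<beta> j (of_real (T s))"
proof -
  let ?B = "ball (complex_of_real s0)" and ?C = "ball (complex_of_real t0)"
  obtain r where r: "r > 0" "?C r \<subseteq> ?C e" "open (\<beta> i ` ?C r)" "inj_on (\<beta> i) (?C r)"
    using has_complex_derivative_locally_invertible[OF \<beta>[OF i(1)] _ _ i(2)] \<open>0 < e\<close> by auto
  obtain H where H: "H holomorphic_on \<beta> i ` ?C r"
    "\<And>z. z \<in> ?C r \<Longrightarrow> H (\<beta> i z) = z"
    using holomorphic_has_inverse[of "\<beta> i" "?C r"] r \<beta>[OF i(1)] holomorphic_on_subset
    by (metis open_ball)
  have cont: "continuous_on (?B e) (\<alpha> i)"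
    using \<alpha> i holomorphic_on_imp_continuous_on by blast
  have "open (?B e \<inter> \<alpha> i -` (\<beta> i ` ?C r))"
    using cont r(3) by (simp add: continuous_on_open_vimage Int_commute)
  moreover have "of_real s0 \<in> ?B e \<inter> \<alpha> i -` (\<beta> i ` ?C r)"
    using \<open>0 < e\<close> eq[of s0 i] s0 i(1) r(1) by auto
  ultimately obtain d where d: "d > 0" "?B d \<subseteq> ?B e \<inter> \<alpha> i -` (\<beta> i ` ?C r)"
    using open_contains_ball by blast
  have "\<forall>\<^sub>F s in at s0 within Z. t s \<in> {t0 - r<..<t0 + r}"
    using t r(1) by (intro topological_tendstoD) auto
  then obtain d' where d': "d' > 0" "\<And>s. s \<in> Z \<Longrightarrow> s \<noteq> s0 \<Longrightarrow> dist s s0 < d' \<Longrightarrow> t s \<in> {t0 - r<..<t0 + r}"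
    unfolding eventually_at by blast
  \<comment> \<open>Three constraints: \<open>e\<close> for the assumed agreement on
    \<open>Z\<close>, \<open>d\<close> so that \<open>\<alpha> i\<close> stays in the domain of
    \<open>H\<close>, and \<open>d'\<close> so that \<open>t s\<close> stays in the disc on which
    \<open>H\<close> inverts \<open>\<beta> i\<close>. The last one makes \<open>U\<close> equal to
    \<open>t\<close> on \<open>Z\<close>.\<close>
  define \<delta> where "\<delta> = min e (min d d')"
  have \<delta>: "\<delta> > 0" using \<open>0 < e\<close> d d' by (simp add: \<delta>_def)
  have mem: "complex_of_real x \<in> ?B \<delta> \<longleftrightarrow> \<bar>x - s0\<bar> < \<delta>" for x
    by (simp add: dist_of_real dist_real_def abs_minus_commute)
  have memC: "complex_of_real x \<in> ?C q \<longleftrightarrow> \<bar>x - t0\<bar> < q" for x q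
    by (simp add: dist_real_def abs_minus_commute)
  define U where "U = H \<circ> \<alpha> i"
  have sub: "?B \<delta> \<subseteq> ?B e" "\<alpha> i ` ?B \<delta> \<subseteq> \<beta> i ` ?C r"
    using d by (auto simp: \<delta>_def)
  have Uhol: "U holomorphic_on ?B \<delta>"
    unfolding U_def using H(1) \<alpha>[OF i(1)] sub by (meson holomorphic_on_compose_gen holomorphic_on_subset)
  have UC: "U z \<in> ?C r" if "z \<in> ?B \<delta>" for z
    using sub(2) that H(2) unfolding U_def by fastforce
  have Ut: "U (of_real s) = of_real (t s)" if "s \<in> Z" "\<bar>s - s0\<bar> < \<delta>" for s
  proof -
    have "t s \<in> {t0 - r<..<t0 + r}"
      using d'(2)[of s] that s0 r(1) by (cases "s = s0") (auto simp: dist_real_def \<delta>_def)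
    then have "of_real (t s) \<in> ?C r" unfolding memC by (simp add: abs_if)
    moreover have "\<alpha> i (of_real s) = \<beta> i (of_real (t s))"
      using eq that i by (simp add: \<delta>_def)
    ultimately show ?thesis by (simp add: U_def H(2))
  qed
  have Ureal: "U (of_real s) \<in> \<real>" if "\<bar>s - s0\<bar> < \<delta>" for s
    by (rule holomorphic_real_on_reals[OF Uhol \<delta> lim _ that]) (simp add: Ut)
  define T where "T = (\<lambda>s. Re (U (of_real s)))"
  have UT: "U (of_real s) = of_real (T s)" if "\<bar>s - s0\<bar> < \<delta>" for s
    using Ureal[OF that] by (simp add: T_def)
  have eqT: "\<alpha> j (of_real s) = \<beta> j (of_real (T s))" if "j < m" "\<bar>s - s0\<bar> < \<delta>" for s j
  proof -
    have "(\<lambda>z. \<alpha> j z - \<beta> j (U z)) (of_real s) = 0"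
    proof (rule analytic_continuation[where f = "\<lambda>z. \<alpha> j z - \<beta> j (U z)" and S = "?B \<delta>" and \<xi> = "of_real s0"
          and U = "of_real ` {s\<in>Z. \<bar>s - s0\<bar> < \<delta>}"])
      have "(\<beta> j \<circ> U) holomorphic_on ?B \<delta>"
        by (rule holomorphic_on_compose_gen[OF Uhol \<beta>[OF that(1)]]) (use UC r(2) in blast)
      then show "(\<lambda>z. \<alpha> j z - \<beta> j (U z)) holomorphic_on ?B \<delta>"
        using \<alpha>[OF that(1)] sub(1) unfolding o_def
        by (intro holomorphic_intros) (auto intro: holomorphic_on_subset)
      show "of_real s0 islimpt (of_real ` {s\<in>Z. \<bar>s - s0\<bar> < \<delta>} :: complex set)"
        by (intro islimpt_of_real islimpt_Int_near lim \<delta>)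
      show "\<alpha> j z - \<beta> j (U z) = 0" if "z \<in> of_real ` {s\<in>Z. \<bar>s - s0\<bar> < \<delta>}" for z
        using that eq \<open>j < m\<close> Ut by (auto simp: \<delta>_def)
      show "complex_of_real s0 \<in> ?B \<delta>" using \<delta> by simp
    qed (use that mem in auto)
    then show ?thesis using UT[OF that(2)] by simp
  qed
  show thesis
  proof
    have "isCont U (of_real s0)"
      using holomorphic_on_imp_continuous_on[OF Uhol] \<delta> by (simp add: continuous_on_eq_continuous_at)
    then show "continuous (at s0) T"
      unfolding T_def by (intro isCont_Re isCont_o2[OF isCont_of_real[OF continuous_ident]])
    show "T s0 = t0" using Ut[of s0] s0 \<delta> by (simp add: T_def)
    show "\<forall>\<^sub>F s in at s0. \<forall>j<m. \<alpha> j (of_real s) = \<beta> j (of_real (T s))"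
      unfolding eventually_at using \<delta> eqT by (auto simp: dist_real_def)
  qed
qed

text \<open>The real power series of \<open>f\<close> is evaluated at the complex points with
  coordinates \<open>Y i z\<close>. The series at one real point serves as a majorant, and the
  Weierstrass M-test makes the limit holomorphic.\<close>

lemma real_analytic_compose_holomorphic:
  fixes f :: "(nat \<Rightarrow> real) \<Rightarrow> real" and y :: "real \<Rightarrow> nat \<Rightarrow> real" and Y :: "nat \<Rightarrow> complex \<Rightarrow> complex"
  assumes f: "real_analytic_on n A f" and e: "0 < e"
    and Y: "\<And>i. i < n \<Longrightarrow> Y i holomorphic_on ball (of_real s0) e"
    and yA: "\<And>s. \<bar>s - s0\<bar> < e \<Longrightarrow> y s \<in> A"
    and ytop: "\<And>s. \<bar>s - s0\<bar> < e \<Longrightarrow> y s \<in> topspace (Euclidean_space n)"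
    and Yy: "\<And>s i. \<bar>s - s0\<bar> < e \<Longrightarrow> i < n \<Longrightarrow> Y i (of_real s) = of_real (y s i)"
  obtains e' F where "0 < e'" "e' \<le> e" "F holomorphic_on ball (of_real s0) e'"
    "\<And>s. \<bar>s - s0\<bar> < e' \<Longrightarrow> F (of_real s) = of_real (f (y s))"
proof -
  let ?B = "ball (complex_of_real s0)"
  define x where "x = y s0"
  have "x \<in> A" using yA[of s0] e by (simp add: x_def)
  with f have "\<exists>r>0. \<exists>c. \<forall>y\<in>topspace (Euclidean_space n). (\<forall>i<n. \<bar>y i - x i\<bar> < r) \<longrightarrow>
        (\<lambda>\<alpha>. c \<alpha> * (\<Prod>i<n. (y i - x i) ^ \<alpha> i)) summable_on multi_indices n \<and>
        (y \<in> A \<longrightarrow> f y = (\<Sum>\<^sub>\<infinity>\<alpha>\<in>multi_indices n. c \<alpha> * (\<Prod>i<n. (y i - x i) ^ \<alpha> i)))"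
    unfolding real_analytic_on_def by (rule bspec)
  then obtain r c where r: "r > 0" and rc: "\<forall>y\<in>topspace (Euclidean_space n). (\<forall>i<n. \<bar>y i - x i\<bar> < r) \<longrightarrow>
        (\<lambda>\<alpha>. c \<alpha> * (\<Prod>i<n. (y i - x i) ^ \<alpha> i)) summable_on multi_indices n \<and>
        (y \<in> A \<longrightarrow> f y = (\<Sum>\<^sub>\<infinity>\<alpha>\<in>multi_indices n. c \<alpha> * (\<Prod>i<n. (y i - x i) ^ \<alpha> i)))"
    by (elim exE conjE)
  note rc = rc[rule_format]
  define q where "q = r / 2"
  have q: "0 < q" "q < r" using r by (auto simp: q_def)
  \<comment> \<open>The corner of the polydisc of radius \<open>q\<close>. It need not lie in
    \<open>A\<close>: \<open>real_analytic_on\<close> asks for summability on the ambient polydisc.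
    Summability of reals is absolute, so the terms at \<open>w\<close> dominate those at all complex
    points whose coordinates are within \<open>q\<close> of \<open>x\<close>.\<close>
  define w where "w = (\<lambda>i. if i < n then x i + q else 0)"
  have "(\<lambda>\<alpha>. c \<alpha> * (\<Prod>i<n. (w i - x i) ^ \<alpha> i)) summable_on multi_indices n"
    using rc[of w] q by (auto simp: w_def topspace_Euclidean_space)
  then have "(\<lambda>\<alpha>. c \<alpha> * (\<Prod>i<n. q ^ \<alpha> i)) summable_on multi_indices n"
    by (simp add: w_def)
  from iffD1[OF summable_on_iff_abs_summable_on_real this]
  have M: "(\<lambda>\<alpha>. \<bar>c \<alpha> * (\<Prod>i<n. q ^ \<alpha> i)\<bar>) summable_on multi_indices n"
    by (simp only: real_norm_def)
  have "\<exists>d>0. d \<le> e \<and> (\<forall>z\<in>?B d. \<forall>i<n. norm (Y i z - of_real (x i)) < q)"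
  proof -
    have "\<forall>\<^sub>F z in nhds (of_real s0). \<forall>i\<in>{..<n}. norm (Y i z - of_real (x i)) < q"
    proof (intro eventually_ball_finite ballI finite_lessThan)
      fix i assume i: "i \<in> {..<n}"
      have "isCont (Y i) (of_real s0)"
        using holomorphic_on_imp_continuous_on[OF Y[of i]] i e by (simp add: continuous_on_eq_continuous_at)
      then have "(Y i \<longlongrightarrow> of_real (x i)) (nhds (of_real s0))"
        using Yy[of s0 i] i e by (simp add: tendsto_at_iff_tendsto_nhds isCont_def x_def)
      then show "\<forall>\<^sub>F z in nhds (of_real s0). norm (Y i z - of_real (x i)) < q"
        using q by (auto simp: tendsto_iff dist_norm)
    qed
    then obtain d where "d > 0" "\<forall>z. dist z (of_real s0) < d \<longrightarrow> (\<forall>i\<in>{..<n}. norm (Y i z - of_real (x i)) < q)"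
      unfolding eventually_nhds_metric by blast
    then show ?thesis using e by (intro exI[of _ "min d e"]) (auto simp: dist_commute)
  qed
  then obtain d where d: "0 < d" "d \<le> e" "\<And>z i. z \<in> ?B d \<Longrightarrow> i < n \<Longrightarrow> norm (Y i z - of_real (x i)) < q"
    by blast
  define P where "P = (\<lambda>\<alpha> z. of_real (c \<alpha>) * (\<Prod>i<n. (Y i z - of_real (x i)) ^ \<alpha> i))"
  define F where "F = (\<lambda>z. \<Sum>\<^sub>\<infinity>\<alpha>\<in>multi_indices n. P \<alpha> z)"
  have Ple: "norm (P \<alpha> z) \<le> \<bar>c \<alpha> * (\<Prod>i<n. q ^ \<alpha> i)\<bar>" if "z \<in> ?B d" for \<alpha> z
  proof -
    have "(\<Prod>i<n. norm (Y i z - of_real (x i)) ^ \<alpha> i) \<le> (\<Prod>i<n. q ^ \<alpha> i)"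
      using d(3)[OF that] by (intro prod_mono conjI power_mono) (auto simp: less_imp_le)
    then show ?thesis
      using q by (simp add: P_def norm_mult abs_mult norm_power prod_norm[symmetric] abs_prod power_abs mult_left_mono)
  qed
  have ul: "uniform_limit (?B d) (\<lambda>X z. \<Sum>\<alpha>\<in>X. P \<alpha> z) F (finite_subsets_at_top (multi_indices n))"
    unfolding F_def by (rule Weierstrass_m_test_general[OF Ple M])
  have Phol: "P \<alpha> holomorphic_on ?B d" for \<alpha>
    unfolding P_def using d(2) by (intro holomorphic_intros holomorphic_on_subset[OF Y] subset_ball) auto
  \<comment> \<open>\<open>holomorphic_uniform_limit\<close> wants uniform convergence on a closed
    disc, hence the halved radius.\<close>
  have sub: "cball (complex_of_real s0) (d/2) \<subseteq> ?B d" using d(1) by auto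
  obtain "F holomorphic_on ?B (d/2)"
  proof (rule holomorphic_uniform_limit)
    show "\<forall>\<^sub>F X in finite_subsets_at_top (multi_indices n).
        continuous_on (cball (of_real s0) (d/2)) (\<lambda>z. \<Sum>\<alpha>\<in>X. P \<alpha> z) \<and>
        (\<lambda>z. \<Sum>\<alpha>\<in>X. P \<alpha> z) holomorphic_on ?B (d/2)"
    proof (intro always_eventually allI conjI)
      fix X
      have "(\<lambda>z. \<Sum>\<alpha>\<in>X. P \<alpha> z) holomorphic_on ?B d"
        using Phol by (intro holomorphic_intros)
      then show "continuous_on (cball (of_real s0) (d/2)) (\<lambda>z. \<Sum>\<alpha>\<in>X. P \<alpha> z)"
        "(\<lambda>z. \<Sum>\<alpha>\<in>X. P \<alpha> z) holomorphic_on ?B (d/2)"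
        using sub d(1) by (auto intro!: holomorphic_on_imp_continuous_on elim!: holomorphic_on_subset)
    qed
    show "uniform_limit (cball (of_real s0) (d/2)) (\<lambda>X z. \<Sum>\<alpha>\<in>X. P \<alpha> z) F (finite_subsets_at_top (multi_indices n))"
      by (rule uniform_limit_on_subset[OF ul sub])
  qed auto
  show thesis
  proof
    show "0 < d/2" "d/2 \<le> e" "F holomorphic_on ?B (d/2)" using d \<open>F holomorphic_on ?B (d/2)\<close> by simp_all
    fix s assume s: "\<bar>s - s0\<bar> < d/2"
    then have sd: "of_real s \<in> ?B d" and se: "\<bar>s - s0\<bar> < e"
      using d by (auto simp: dist_of_real dist_real_def abs_minus_commute)
    have "\<bar>y s i - x i\<bar> < r" if "i < n" for i
    proof -
      have "norm (complex_of_real (y s i - x i)) < q"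
        using d(3)[OF sd that] Yy[OF se that] by simp
      then show ?thesis using q by (simp only: norm_of_real)
    qed
    then have near: "\<forall>i<n. \<bar>y s i - x i\<bar> < r" by blast
    let ?p = "\<lambda>\<alpha>. c \<alpha> * (\<Prod>i<n. (y s i - x i) ^ \<alpha> i)"
    have "(?p has_sum f (y s)) (multi_indices n)"
      using rc[OF ytop[OF se]] near yA[OF se] by (simp only: has_sum_infsum simp_thms)
    then have "((\<lambda>\<alpha>. complex_of_real (?p \<alpha>)) has_sum of_real (f (y s))) (multi_indices n)"
      by (rule has_sum_of_real)
    moreover have "complex_of_real (?p \<alpha>) = P \<alpha> (of_real s)" for \<alpha>
      using Yy[OF se] by (simp add: P_def)
    ultimately show "F (of_real s) = of_real (f (y s))"
      by (simp only: F_def infsumI)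
  qed
qed

subsection \<open>Line charts and segments\<close>

text \<open>A parametrization, pointing from the line into \<open>S\<close>, so that facts about
  real intervals apply directly. Openness of \<open>J\<close> in the whole line keeps boundary
  points of \<open>S\<close> out.\<close>

definition line_chart :: "'s topology \<Rightarrow> real set \<Rightarrow> (real \<Rightarrow> 's) \<Rightarrow> bool" where
  "line_chart S J k \<longleftrightarrow> open J \<and> is_interval J \<and> openin S (k ` J) \<and>
     homeomorphic_map (top_of_set J) (subtopology S (k ` J)) k"

text \<open>A topological stand-in for the interior of \<open>S\<close>: the points at which the
  curve has two sides.\<close>

definition line_points :: "'s topology \<Rightarrow> 's set" where
  "line_points S = \<Union> {k ` J | J k. line_chart S J k}"

lemma line_pointsE:
  assumes "x \<in> line_points S"
  obtains J k s where "line_chart S J k" "s \<in> J" "k s = x"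
  using assms unfolding line_points_def by blast

lemma line_chart_inj: "line_chart S J k \<Longrightarrow> inj_on k J"
  unfolding line_chart_def by (auto simp: homeomorphic_imp_injective_map dest!: homeomorphic_imp_injective_map)

lemma line_chart_subset: "line_chart S J k \<Longrightarrow> k ` J \<subseteq> topspace S"
  unfolding line_chart_def by (simp add: openin_subset)

lemma line_chart_line_points: "line_chart S J k \<Longrightarrow> k ` J \<subseteq> line_points S"
  unfolding line_points_def by blast

lemma line_points_subset: "line_points S \<subseteq> topspace S"
  unfolding line_points_def using line_chart_subset by blast

lemma line_chart_continuous: "line_chart S J k \<Longrightarrow> continuous_map (top_of_set J) S k"
  unfolding line_chart_def
  by (meson continuous_map_in_subtopology homeomorphic_imp_continuous_map)

lemma line_chart_image_open:
  assumes k: "line_chart S J k" and "X \<subseteq> J" "open X"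
  shows "openin S (k ` X)"
proof -
  have "open_map (top_of_set J) (subtopology S (k ` J)) k"
    using k homeomorphic_imp_open_map by (auto simp: line_chart_def)
  moreover have "openin (top_of_set J) X"
    using assms by (simp add: openin_open) blast
  ultimately have "openin (subtopology S (k ` J)) (k ` X)"
    by (simp add: open_map_def)
  then show ?thesis
    using k by (meson line_chart_def openin_trans_full)
qed

lemma line_chart_restrict:
  assumes k: "line_chart S J k" and "J' \<subseteq> J" "open J'" "is_interval J'"
  shows "line_chart S J' k"
proof -
  have "homeomorphic_map (subtopology (top_of_set J) J') (subtopology (subtopology S (k ` J)) (k ` J')) k"
    by (rule homeomorphic_map_subtopologies)
      (use k assms(2) line_chart_subset[OF k] in \<open>auto simp: line_chart_def\<close>)
  then have "homeomorphic_map (top_of_set J') (subtopology S (k ` J')) k"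
    using assms(2) by (simp add: subtopology_subtopology inf.absorb2 image_mono)
  with line_chart_image_open[OF k assms(2,3)] assms(3,4) show ?thesis by (simp add: line_chart_def)
qed

lemma line_chart_vimage_open:
  assumes k: "line_chart S J k" and W: "openin S W"
  shows "open {s\<in>J. k s \<in> W}"
proof -
  have "openin (top_of_set J) {s\<in>J. k s \<in> W}"
    using openin_continuous_map_preimage[OF line_chart_continuous[OF k] W] by simp
  then show ?thesis
    using k openin_open_trans unfolding line_chart_def by blast
qed

lemma line_chart_inverse_continuous:
  assumes k: "line_chart S J k" and f: "continuous_map X S f" "f ` topspace X \<subseteq> k ` J"
  shows "continuous_map X (top_of_set J) (\<lambda>x. inv_into J k (f x))"
proof -
  have hom: "homeomorphic_map (top_of_set J) (subtopology S (k ` J)) k"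
    using k by (simp add: line_chart_def)
  then obtain h where h: "homeomorphic_maps (top_of_set J) (subtopology S (k ` J)) k h"
    unfolding homeomorphic_map_maps by blast
  have "continuous_map X (subtopology S (k ` J)) f"
    using f by (auto simp: continuous_map_in_subtopology)
  then have "continuous_map X (top_of_set J) (h \<circ> f)"
    using h continuous_map_compose unfolding homeomorphic_maps_def by blast
  then show ?thesis
  proof (rule continuous_map_eq)
    fix x assume "x \<in> topspace X"
    then obtain s where s: "s \<in> J" "f x = k s" using f(2) by blast
    then have "h (k s) = s" using h by (simp add: homeomorphic_maps_def)
    then show "(h \<circ> f) x = inv_into J k (f x)"
      using s line_chart_inj[OF k] by (simp add: inv_into_f_f)
  qed
qed

text \<open>Invariance of domain, applied to \<open>v\<close> read in a chart near each point. It
  supplies openness where only continuity and injectivity are known, as for pieces of the curve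
  moved by the group and pulled back to a segment.\<close>

lemma openin_image_line_points:
  fixes J :: "real set"
  assumes J: "open J" and v: "continuous_map (top_of_set J) S v" "inj_on v J" "v ` J \<subseteq> line_points S"
  shows "openin S (v ` J)"
proof (subst openin_subopen, intro ballI)
  fix x assume "x \<in> v ` J"
  then obtain s where s: "s \<in> J" "x = v s" by blast
  obtain J' k s' where k: "line_chart S J' k" "s' \<in> J'" "k s' = v s"
    using v(3) s by (metis image_subset_iff line_pointsE)
  define X where "X = {s\<in>J. v s \<in> k ` J'}"
  have opk: "openin S (k ` J')" using k by (simp add: line_chart_def)
  have "openin (top_of_set J) X"
    using openin_continuous_map_preimage[OF v(1) opk] by (simp add: X_def)
  then have X: "open X" using J openin_open_trans by blast
  have "continuous_map (top_of_set X) S v"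
    using continuous_map_from_subtopology[OF v(1), of X]
    by (simp add: subtopology_subtopology X_def Int_absorb1 Collect_subset)
  then have "continuous_map (top_of_set X) (top_of_set J') (\<lambda>s. inv_into J' k (v s))"
    by (rule line_chart_inverse_continuous[OF k(1)]) (auto simp: X_def)
  then have "continuous_on X (\<lambda>s. inv_into J' k (v s))"
    by (simp add: continuous_map_in_subtopology)
  moreover have "inj_on (\<lambda>s. inv_into J' k (v s)) X"
  proof (rule inj_onI)
    fix a b assume ab: "a \<in> X" "b \<in> X" "inv_into J' k (v a) = inv_into J' k (v b)"
    then have "v a = v b" by (auto simp: X_def f_inv_into_f dest: arg_cong[of _ _ k])
    then show "a = b" using ab v(2) by (auto simp: X_def inj_on_def)
  qed
  ultimately have "open ((\<lambda>s. inv_into J' k (v s)) ` X)"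
    using X by (intro invariance_of_domain)
  then have "openin S (k ` (\<lambda>s. inv_into J' k (v s)) ` X)"
    by (intro line_chart_image_open[OF k(1)]) (auto simp: X_def inv_into_into)
  also have "k ` (\<lambda>s. inv_into J' k (v s)) ` X = v ` X"
    by (force simp: X_def image_image f_inv_into_f)
  finally have "openin S (v ` X)" .
  moreover have "s \<in> X" using s(1) k(2,3) by (auto simp: X_def image_iff intro: bexI[of _ s'])
  then have "x \<in> v ` X" "v ` X \<subseteq> v ` J"
    using s(2) by (auto simp: X_def)
  ultimately show "\<exists>T. openin S T \<and> x \<in> T \<and> T \<subseteq> v ` J" by blast
qed

section \<open>Segments near a point with two sides\<close>

lemma segment_subset: "segment S A \<Longrightarrow> A \<subseteq> topspace S"
  by (simp add: segment_def connectedin_subset_topspace)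

text \<open>If \<open>B\<close> missed points arbitrarily close to \<open>k s0\<close> on both
  sides, two such parameters \<open>s1 < s0 < s2\<close> would cut \<open>B\<close> into an open
  piece around \<open>k s0\<close> and an open rest containing a second point \<open>y\<close>,
  against connectedness.\<close>

lemma segment_side:
  assumes S: "Hausdorff_space S" and k: "line_chart S J k" "s0 \<in> J" and B: "segment S B" "k s0 \<in> B"
  obtains e where "e > 0" "{s0 - e..s0 + e} \<subseteq> J" "k ` {s0..s0 + e} \<subseteq> B \<or> k ` {s0 - e..s0} \<subseteq> B"
proof (rule ccontr)
  assume "\<not> thesis"
  with that have contr: "\<not> (k ` {s0..s0 + e} \<subseteq> B \<or> k ` {s0 - e..s0} \<subseteq> B)"
    if "e > 0" "{s0 - e..s0 + e} \<subseteq> J" for e using that by blast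
  have inj: "inj_on k J" using line_chart_inj[OF k(1)] .
  obtain e0 where e0: "e0 > 0" "{s0 - e0..s0 + e0} \<subseteq> J"
    using k unfolding line_chart_def by (metis cball_eq_atLeastAtMost open_contains_cball_eq)
  obtain y where y: "y \<in> B" "y \<noteq> k s0"
    using B by (metis segment_def)
  \<comment> \<open>Shrinking \<open>e\<close> keeps \<open>y\<close> off the short arc, so that the
    complement of the arc still meets \<open>B\<close>.\<close>
  have "\<exists>e>0. e \<le> e0 \<and> y \<notin> k ` {s0 - e..s0 + e}"
  proof (cases "y \<in> k ` J")
    case True
    then obtain t where t: "t \<in> J" "y = k t" by blast
    have "y \<notin> k ` {s0 - e..s0 + e}" if "e = min e0 (\<bar>t - s0\<bar> / 2)" for e
    proof
      assume "y \<in> k ` {s0 - e..s0 + e}"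
      then obtain t' where t': "t' \<in> {s0 - e..s0 + e}" "y = k t'" by blast
      have "{s0 - e..s0 + e} \<subseteq> {s0 - e0..s0 + e0}" using that by auto
      then have "t' \<in> J" using e0(2) t'(1) by blast
      then have "t' = t" using t t' inj by (auto simp: inj_on_def)
      then have "\<bar>t - s0\<bar> \<le> e" using t' by (auto simp: abs_le_iff)
      then show False using that t y(2) by (cases "t = s0") auto
    qed
    moreover have "\<bar>t - s0\<bar> > 0" using t y by auto
    ultimately show ?thesis using e0(1) by (intro exI[of _ "min e0 (\<bar>t - s0\<bar> / 2)"]) auto
  next
    case False
    then show ?thesis using e0 by (intro exI[of _ e0]) auto
  qed
  then obtain e where e: "e > 0" "e \<le> e0" "y \<notin> k ` {s0 - e..s0 + e}" by blast
  have "{s0 - e..s0 + e} \<subseteq> {s0 - e0..s0 + e0}" using e(2) by auto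
  with e0(2) have sub: "{s0 - e..s0 + e} \<subseteq> J" by (rule subset_trans[rotated])
  obtain s2 where s2: "s2 \<in> {s0..s0 + e}" "k s2 \<notin> B" using contr[OF e(1) sub] by blast
  obtain s1 where s1: "s1 \<in> {s0 - e..s0}" "k s1 \<notin> B" using contr[OF e(1) sub] by blast
  have s12: "s1 < s0" "s0 < s2" using s1 s2 B(2) by (auto simp: less_le)
  have sub2: "{s1..s2} \<subseteq> {s0 - e..s0 + e}" using s1 s2 by auto
  have op: "openin S (k ` {s1<..<s2})"
    by (rule line_chart_image_open[OF k(1)]) (use sub sub2 in auto)
  have "compactin (top_of_set J) {s1..s2}"
    using order_trans[OF sub2 sub] by (simp add: compactin_subtopology)
  then have "compactin S (k ` {s1..s2})"
    using image_compactin line_chart_continuous[OF k(1)] by blast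
  then have "openin S (topspace S - k ` {s1..s2})"
    using S compactin_imp_closedin by (metis openin_diff openin_topspace)
  moreover have "B \<subseteq> k ` {s1<..<s2} \<union> (topspace S - k ` {s1..s2})"
  proof
    fix u assume u: "u \<in> B"
    then have "u \<in> topspace S" using segment_subset[OF B(1)] by blast
    moreover have "u \<in> k ` {s1<..<s2}" if "u \<in> k ` {s1..s2}"
    proof -
      from that obtain t where t: "t \<in> {s1..s2}" "u = k t" by blast
      then have "t \<noteq> s1" "t \<noteq> s2" using s1 s2 u by auto
      then show ?thesis using t by auto
    qed
    ultimately show "u \<in> k ` {s1<..<s2} \<union> (topspace S - k ` {s1..s2})" by blast
  qed
  moreover have "k ` {s1<..<s2} \<inter> (topspace S - k ` {s1..s2}) \<inter> B = {}" by auto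
  moreover have "s0 \<in> {s1<..<s2}" using s12 by simp
  then have "k ` {s1<..<s2} \<inter> B \<noteq> {}" using B(2) by blast
  moreover have "(topspace S - k ` {s1..s2}) \<inter> B \<noteq> {}"
    using y(1) e(3) image_mono[OF sub2, of k] segment_subset[OF B(1)] by blast
  ultimately show False
    using B(1) op unfolding segment_def connectedin by metis
qed

lemma line_chart_reflect:
  assumes "line_chart S J k"
  shows "line_chart S (uminus ` J) (\<lambda>s. k (- s))"
proof -
  have im: "(\<lambda>s. k (- s)) ` uminus ` J = k ` J" by (simp add: image_image)
  have "homeomorphic_map (top_of_set (uminus ` J)) (top_of_set J) uminus"
    unfolding homeomorphic_map_maps homeomorphic_maps_def
    by (intro exI[of _ uminus]) (auto simp: continuous_map_in_subtopology intro!: continuous_intros)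
  then have "homeomorphic_map (top_of_set (uminus ` J)) (subtopology S (k ` J)) (k \<circ> uminus)"
    using assms homeomorphic_map_compose unfolding line_chart_def by blast
  with assms im show ?thesis
    unfolding line_chart_def by (simp add: o_def open_negations is_interval_neg_translationI)
qed

text \<open>Orienting the chart suitably, the segment may be taken to lie on its positive side.\<close>

lemma segment_right:
  assumes S: "Hausdorff_space S" and x: "x \<in> line_points S" and B: "segment S B" "x \<in> B"
  obtains J k s0 e where "line_chart S J k" "k s0 = x" "e > 0" "{s0 - e..s0 + e} \<subseteq> J" "k ` {s0..s0 + e} \<subseteq> B"
proof -
  obtain J k s0 where k: "line_chart S J k" "s0 \<in> J" "k s0 = x"
    using x by (rule line_pointsE)
  then obtain e where e: "e > 0" "{s0 - e..s0 + e} \<subseteq> J" "k ` {s0..s0 + e} \<subseteq> B \<or> k ` {s0 - e..s0} \<subseteq> B"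
    using segment_side[OF S k(1,2) B(1)] B(2) by metis
  from e(3) show thesis
  proof
    assume "k ` {s0..s0 + e} \<subseteq> B"
    then show thesis using k e that by blast
  next
    assume side: "k ` {s0 - e..s0} \<subseteq> B"
    show thesis
    proof (rule that[OF line_chart_reflect[OF k(1)], of "- s0"])
      show "{- s0 - e..- s0 + e} \<subseteq> uminus ` J"
        using e(2) by (force simp: image_iff intro: bexI[of _ "- _"])
      show "(\<lambda>s. k (- s)) ` {- s0..- s0 + e} \<subseteq> B"
        using side by auto
    qed (use k e in auto)
  qed
qed

lemma infinite_chart_image:
  assumes "line_chart S J k" "{a..b} \<subseteq> J" "a < b"
  shows "infinite (k ` {a..b::real})"
proof
  assume "finite (k ` {a..b})"
  then have "finite {a..b}"
    by (rule finite_imageD) (rule inj_on_subset[OF line_chart_inj[OF assms(1)] assms(2)])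
  then show False using infinite_Icc[OF assms(3)] by simp
qed

text \<open>\<open>A\<close> fills one side of \<open>x\<close>. If \<open>B\<close> filled the same
  side, the two would share infinitely many points; so \<open>B\<close> fills the opposite
  side.\<close>

lemma segments_nbhd:
  assumes S: "Hausdorff_space S" and x: "x \<in> line_points S" and A: "segment S A" "x \<in> A"
    and B: "segment S B" "x \<in> B" and fin: "finite (A \<inter> B)"
  shows "x \<in> S interior_of (A \<union> B)"
proof -
  obtain J k s0 e where k: "line_chart S J k" "k s0 = x" and e: "e > 0" "{s0 - e..s0 + e} \<subseteq> J" "k ` {s0..s0 + e} \<subseteq> A"
    using segment_right[OF S x A] .
  then have "s0 \<in> J" by auto
  then obtain d where d: "d > 0" "{s0 - d..s0 + d} \<subseteq> J" "k ` {s0..s0 + d} \<subseteq> B \<or> k ` {s0 - d..s0} \<subseteq> B"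
    using segment_side[OF S k(1) _ B(1)] B(2) k(2) by metis
  define r where "r = min d e"
  have r: "r > 0" using d e by (simp add: r_def)
  have "\<not> k ` {s0..s0 + d} \<subseteq> B"
  proof
    assume "k ` {s0..s0 + d} \<subseteq> B"
    moreover have "{s0..s0 + r} \<subseteq> {s0..s0 + d}" "{s0..s0 + r} \<subseteq> {s0..s0 + e}" by (auto simp: r_def)
    ultimately have "k ` {s0..s0 + r} \<subseteq> A \<inter> B" using e(3) by blast
    moreover have "infinite (k ` {s0..s0 + r})"
    proof (rule infinite_chart_image[OF k(1)])
      have "{s0..s0 + r} \<subseteq> {s0 - e..s0 + e}" using e(1) by (auto simp: r_def)
      then show "{s0..s0 + r} \<subseteq> J" using e(2) by blast
    qed (use r in simp)
    ultimately show False using fin finite_subset by blast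
  qed
  then have left: "k ` {s0 - d..s0} \<subseteq> B" using d(3) by blast
  have "k ` {s0 - r<..<s0 + r} \<subseteq> A \<union> B"
  proof
    fix y assume "y \<in> k ` {s0 - r<..<s0 + r}"
    then obtain s where s: "s \<in> {s0 - r<..<s0 + r}" "y = k s" by blast
    then have "s \<in> {s0..s0 + e} \<or> s \<in> {s0 - d..s0}" by (auto simp: r_def)
    then show "y \<in> A \<union> B" using e(3) left s(2) by blast
  qed
  moreover have "openin S (k ` {s0 - r<..<s0 + r})"
  proof (rule line_chart_image_open[OF k(1)])
    have "{s0 - r<..<s0 + r} \<subseteq> {s0 - e..s0 + e}" by (auto simp: r_def)
    then show "{s0 - r<..<s0 + r} \<subseteq> J" using e(2) by blast
  qed simp
  moreover have "x \<in> k ` {s0 - r<..<s0 + r}" using k(2) r by auto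
  ultimately show ?thesis unfolding interior_of_def by blast
qed

text \<open>A one-sided substitute for shrinking a neighbourhood, with finitely many points avoided.
  \<open>x\<close> itself may belong to \<open>F\<close>, whence the half-open interval in the last
  conclusion; a typical \<open>F\<close> is the intersection of two adjacent segments.\<close>

lemma segment_piece:
  assumes S: "Hausdorff_space S" and x: "x \<in> line_points S" and B: "segment S B" "x \<in> B"
    and W: "openin S W" "x \<in> W" and F: "finite F"
  obtains J k s0 e where "line_chart S J k" "k s0 = x" "e > 0" "{s0..s0 + e} \<subseteq> J"
    "k ` {s0..s0 + e} \<subseteq> B \<inter> W" "k ` {s0<..s0 + e} \<inter> F = {}"
proof -
  obtain J k s0 e where k: "line_chart S J k" "k s0 = x" and e: "e > 0" "{s0 - e..s0 + e} \<subseteq> J" "k ` {s0..s0 + e} \<subseteq> B"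
    using segment_right[OF S x B] .
  have s0J: "s0 \<in> J" using e by auto
  define F' where "F' = {s\<in>J. k s \<in> F} - {s0}"
  have "finite F'"
    using finite_vimage_IntI[OF F line_chart_inj[OF k(1)]]
    by (rule rev_finite_subset) (auto simp: F'_def)
  then have "open ({s\<in>J. k s \<in> W} - F')"
    using line_chart_vimage_open[OF k(1) W(1)] finite_imp_closed by blast
  moreover have "s0 \<in> {s\<in>J. k s \<in> W} - F'" using W(2) k(2) s0J by (auto simp: F'_def)
  ultimately obtain d where d: "d > 0" "{s0 - d..s0 + d} \<subseteq> {s\<in>J. k s \<in> W} - F'"
    by (metis cball_eq_atLeastAtMost open_contains_cball_eq)
  show thesis
  proof (rule that[OF k, of "min d e"])
    have F': "k s \<in> W \<and> (k s \<in> F \<longrightarrow> s = s0)" if "s \<in> {s0..s0 + min d e}" for s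
    proof -
      have "s \<in> {s0 - d..s0 + d}" using that d(1) by auto
      then show ?thesis using d(2) by (auto simp: F'_def)
    qed
    have sub: "{s0..s0 + min d e} \<subseteq> {s0..s0 + e}" by auto
    then have "k ` {s0..s0 + min d e} \<subseteq> B" using e(3) by blast
    then show "k ` {s0..s0 + min d e} \<subseteq> B \<inter> W" using F' by blast
    have "{s0..s0 + e} \<subseteq> {s0 - e..s0 + e}" using e(1) by auto
    with sub show "{s0..s0 + min d e} \<subseteq> J" using e(2) by blast
    have "k s \<notin> F" if "s \<in> {s0<..s0 + min d e}" for s
    proof -
      have "s \<in> {s0..s0 + min d e}" "s \<noteq> s0" using that by simp_all
      then show ?thesis using F' by metis
    qed
    then show "k ` {s0<..s0 + min d e} \<inter> F = {}" by blast
    show "min d e > 0" using d(1) e(1) by simp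
  qed
qed

lemma line_chart_segment:
  assumes k: "line_chart S J k" and "{a..b} \<subseteq> J" "a < b"
  shows "segment S (k ` {a..b})" "compactin S (k ` {a..b})"
proof -
  have "connectedin (top_of_set J) {a..b}" "compactin (top_of_set J) {a..b}"
    using assms by (simp_all add: connectedin_subtopology compactin_subtopology)
  then have "connectedin S (k ` {a..b})" and c: "compactin S (k ` {a..b})"
    using line_chart_continuous[OF k] connectedin_continuous_map_image image_compactin by blast+
  moreover have "k a \<noteq> k b" "k a \<in> k ` {a..b}" "k b \<in> k ` {a..b}"
    using assms line_chart_inj[OF k] by (auto simp: inj_on_eq_iff subset_iff)
  ultimately show "segment S (k ` {a..b})" "compactin S (k ` {a..b})"
    unfolding segment_def by blast+
qed

lemma line_chart_open_segment:
  assumes k: "line_chart S J k" and "{a<..<b} \<subseteq> J" "a < b"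
  shows "segment S (k ` {a<..<b})" "openin S (k ` {a<..<b})" "line_chart S {a<..<b} k"
proof -
  show 1: "line_chart S {a<..<b} k"
    by (rule line_chart_restrict[OF k assms(2)]) (auto simp: is_interval_oo)
  then have "connectedin S (k ` {a<..<b})"
    by (intro connectedin_continuous_map_image[OF line_chart_continuous[OF 1]])
      (auto simp: connectedin_subtopology)
  moreover obtain p q where pq: "a < p" "p < q" "q < b"
    using dense assms(3) by metis
  then have "k p \<noteq> k q" "k p \<in> k ` {a<..<b}" "k q \<in> k ` {a<..<b}"
    using line_chart_inj[OF 1] by (auto simp: inj_on_eq_iff)
  ultimately show "segment S (k ` {a<..<b})" unfolding segment_def by blast
  show "openin S (k ` {a<..<b})" using 1 by (simp add: line_chart_def)
qed

text \<open>A point of a line has only two sides. \<open>A\<close> and \<open>B\<close> already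
  cover a neighbourhood of \<open>x\<close>, so the points of \<open>C\<close> close to
  \<open>x\<close> lie in \<open>A\<close> or \<open>B\<close>, and there are infinitely many of
  them.\<close>

lemma segments_at_point:
  assumes S: "Hausdorff_space S" and x: "x \<in> line_points S"
    and A: "segment S A" "x \<in> A" and B: "segment S B" "x \<in> B" and C: "segment S C" "x \<in> C"
    and fin: "finite (A \<inter> B)" "finite (A \<inter> C)" "finite (B \<inter> C)"
  shows False
proof -
  have "x \<in> S interior_of (A \<union> B)" by (rule segments_nbhd) fact+
  then obtain W where W: "openin S W" "x \<in> W" "W \<subseteq> A \<union> B" by (auto simp: interior_of_def)
  have "finite ((A \<inter> C) \<union> (B \<inter> C))" using fin by simp
  then obtain J k s0 e where k: "line_chart S J k" "e > 0" "{s0..s0 + e} \<subseteq> J"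
    "k ` {s0..s0 + e} \<subseteq> C \<inter> W" "k ` {s0<..s0 + e} \<inter> ((A \<inter> C) \<union> (B \<inter> C)) = {}"
    using segment_piece[OF S x C W(1,2)] by metis
  then have "s0 + e \<in> {s0..s0 + e}" "s0 + e \<in> {s0<..s0 + e}" by auto
  then show False using k(4,5) W(3) by blast
qed

text \<open>Pulled back along \<open>k\<close>, the segment is a compact connected set of reals,
  hence a closed interval. This is the source of the bound of two on the number of boundary points
  of \<Sigma>.\<close>

lemma compact_segment_in_chart:
  assumes k: "line_chart S J k" and A: "segment S A" "compactin S A" "A \<subseteq> k ` J"
  obtains a b where "a < b" "{a..b} \<subseteq> J" "A = k ` {a..b}" "A - S interior_of A \<subseteq> {k a, k b}"
proof -
  define X where "X = {s\<in>J. k s \<in> A}"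
  have AX: "A = k ` X" using A(3) by (auto simp: X_def)
  have hom: "homeomorphic_map (top_of_set J) (subtopology S (k ` J)) k"
    using k by (simp add: line_chart_def)
  have "connectedin (subtopology S (k ` J)) A" "compactin (subtopology S (k ` J)) A"
    using A by (auto simp: connectedin_subtopology compactin_subtopology segment_def)
  then have "connectedin (top_of_set J) X" "compactin (top_of_set J) X"
    using homeomorphic_map_connectedness_eq[OF hom, of X] homeomorphic_map_compactness_eq[OF hom, of X]
    by (auto simp: AX[symmetric]) (auto simp: X_def)
  then have "connected X" "compact X"
    by (auto simp: connectedin_subtopology compactin_subtopology)
  then obtain a b where ab: "X = {a..b}"
    using connected_compact_interval_1 by blast
  obtain x y where "x \<in> A" "y \<in> A" "x \<noteq> y" using A(1) by (auto simp: segment_def)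
  then obtain p q where "p \<in> {a..b}" "q \<in> {a..b}" "p \<noteq> q" unfolding AX ab by blast
  then have "a < b" by auto
  moreover have sub: "{a..b} \<subseteq> J" using ab by (auto simp: X_def)
  moreover have "k ` {a<..<b} \<subseteq> S interior_of A"
  proof (intro interior_of_maximal line_chart_image_open[OF k])
    show "{a<..<b} \<subseteq> J" using sub by (rule order_trans[rotated]) auto
  qed (auto simp: AX ab)
  moreover have "A \<subseteq> k ` {a<..<b} \<union> {k a, k b}"
  proof -
    have "{a..b} \<subseteq> {a<..<b} \<union> {a, b}" by auto
    then show ?thesis unfolding AX ab by blast
  qed
  ultimately show thesis using that[of a b] AX ab by blast
qed

section \<open>Interiors in the circle and interval models\<close>

lemma image_preimage_restrict:
  assumes "f ` X = Y" "A \<subseteq> Y"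
  shows "f ` {b\<in>X. f b \<in> A} = A"
proof
  show "A \<subseteq> f ` {b\<in>X. f b \<in> A}"
  proof
    fix a assume "a \<in> A"
    moreover from this assms obtain b where "b \<in> X" "a = f b" by blast
    ultimately show "a \<in> f ` {b\<in>X. f b \<in> A}" by simp
  qed
qed auto

lemma segment_other_point:
  assumes "segment S C"
  shows "\<exists>y\<in>C. y \<noteq> x"
proof -
  obtain u v where "u \<in> C" "v \<in> C" "u \<noteq> v" using assms unfolding segment_def by (elim conjE bexE)
  then show ?thesis by (cases "u = x") auto
qed

lemma homeomorphic_line_chart:
  assumes hom: "homeomorphic_map X S \<upsilon>" and k: "homeomorphic_map (top_of_set J) (subtopology X (k ` J)) k"
    and J: "open J" "is_interval J" and X: "openin X (k ` J)"
  shows "line_chart S J (\<lambda>s. \<upsilon> (k s))"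
proof -
  have kX: "k ` J \<subseteq> topspace X" using X by (rule openin_subset)
  have im: "(\<lambda>s. \<upsilon> (k s)) ` J = \<upsilon> ` k ` J" by (simp add: image_image)
  have "homeomorphic_map (subtopology X (k ` J)) (subtopology S (\<upsilon> ` k ` J)) \<upsilon>"
    by (rule homeomorphic_map_subtopologies[OF hom])
      (use kX homeomorphic_imp_surjective_map[OF hom] in auto)
  then have "homeomorphic_map (top_of_set J) (subtopology S (\<upsilon> ` k ` J)) (\<upsilon> \<circ> k)"
    by (rule homeomorphic_map_compose[OF k])
  moreover have "openin S (\<upsilon> ` k ` J)"
    using homeomorphic_imp_open_map[OF hom] X by (simp add: open_map_def)
  ultimately show ?thesis using J by (simp add: line_chart_def im o_def)
qed

lemma circle_punctured_chart:
  assumes hom: "homeomorphic_map unit_circle S \<upsilon>" and p: "p \<in> topspace S"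
  obtains J k where "line_chart S J k" "k ` J = topspace S - {p}"
proof -
  have sur: "\<upsilon> ` sphere 0 1 = topspace S" and inj: "inj_on \<upsilon> (sphere 0 1)"
    using homeomorphic_imp_surjective_map[OF hom] homeomorphic_imp_injective_map[OF hom]
    by (simp_all add: unit_circle_def)
  then obtain b where b: "b \<in> sphere 0 1" "p = \<upsilon> b" using p by blast
  have "(sphere 0 1 - {b}) homeomorphic (UNIV :: real set)"
    by (rule homeomorphic_punctured_sphere_affine) (use b in auto)
  then obtain k h where kh: "homeomorphism (UNIV :: real set) (sphere 0 1 - {b}) k h"
    using homeomorphic_sym unfolding homeomorphic_def by blast
  have kU: "range k = sphere 0 1 - {b}" using kh by (simp add: homeomorphism_def)
  have *: "subtopology unit_circle (range k) = top_of_set (sphere 0 1 - {b})"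
    unfolding kU unit_circle_def subtopology_subtopology by (rule arg_cong[where f = top_of_set]) blast
  have "line_chart S UNIV (\<lambda>s. \<upsilon> (k s))"
  proof (rule homeomorphic_line_chart[OF hom])
    show "homeomorphic_map (top_of_set UNIV) (subtopology unit_circle (range k)) k"
      unfolding * homeomorphic_map_maps homeomorphic_maps_def
      using kh by (intro exI[of _ h]) (auto simp: homeomorphism_def continuous_map_in_subtopology)
    show "openin unit_circle (range k)"
      unfolding kU unit_circle_def by (simp add: openin_delete)
  qed auto
  moreover have "(\<lambda>s. \<upsilon> (k s)) ` UNIV = topspace S - {p}"
  proof -
    have "(\<lambda>s. \<upsilon> (k s)) ` UNIV = \<upsilon> ` (sphere 0 1 - {b})" by (simp add: image_image[symmetric] kU)
    also have "\<dots> = \<upsilon> ` sphere 0 1 - {p}"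
      using inj b by (auto simp: inj_on_def)
    finally show ?thesis by (simp add: sur)
  qed
  ultimately show thesis using that by blast
qed

lemma interior_nondegenerate_interval:
  assumes "nondegenerate_interval D"
  shows "is_interval (interior D)"
  using assms by (simp add: nondegenerate_interval_def is_interval_convex_1)

text \<open>Homeomorphisms preserve interiors, so the map fixed by Hilbert choice in
  \<open>seg_interior\<close> drops out.\<close>

lemma circle_interior:
  assumes S: "circle_like S" and A: "A \<subseteq> topspace S"
  shows "seg_interior S A = S interior_of A"
proof -
  define \<upsilon> where "\<upsilon> = (SOME \<upsilon>. homeomorphic_map unit_circle S \<upsilon>)"
  have hom: "homeomorphic_map unit_circle S \<upsilon>"
    using S unfolding \<upsilon>_def circle_like_def homeomorphic_space by (rule someI_ex)
  let ?B = "{b \<in> topspace unit_circle. \<upsilon> b \<in> A}"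
  have "\<upsilon> ` ?B = A" using image_preimage_restrict[OF homeomorphic_imp_surjective_map[OF hom] A] .
  then have "S interior_of A = \<upsilon> ` (unit_circle interior_of ?B)"
    using homeomorphic_map_interior_of[OF hom, of ?B] by auto
  then show ?thesis using S by (simp add: seg_interior_def \<upsilon>_def[symmetric] Let_def)
qed

lemma interval_interiorE:
  assumes S: "interval_like S" "\<not> circle_like S"
  obtains D \<upsilon> where "nondegenerate_interval D" "homeomorphic_map (top_of_set D) S \<upsilon>"
    "\<And>A. seg_interior S A = \<upsilon> ` interior {b \<in> D. \<upsilon> b \<in> A}"
proof -
  let ?P = "\<lambda>p. case p of (D, \<upsilon>) \<Rightarrow> nondegenerate_interval D \<and> homeomorphic_map (top_of_set D) S \<upsilon>"
  obtain D \<upsilon> where p: "(SOME p. ?P p) = (D, \<upsilon>)" by (cases "SOME p. ?P p")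
  have "\<exists>p. ?P p" using S(1) by (auto simp: interval_like_def homeomorphic_space)
  then have "?P (SOME p. ?P p)" by (rule someI_ex)
  then have "nondegenerate_interval D \<and> homeomorphic_map (top_of_set D) S \<upsilon>" by (simp add: p)
  moreover have "seg_interior S A = \<upsilon> ` interior {b \<in> D. \<upsilon> b \<in> A}" for A
    using S(2) p by (simp add: seg_interior_def)
  ultimately show thesis using that by blast
qed

lemma interval_interior_chart:
  assumes "nondegenerate_interval D" and hom: "homeomorphic_map (top_of_set D) S \<upsilon>"
  shows "line_chart S (interior D) \<upsilon>"
proof -
  have "line_chart S (interior D) (\<lambda>s. \<upsilon> ((\<lambda>s. s) s))"
  proof (rule homeomorphic_line_chart[OF hom])
    have "subtopology (top_of_set D) (interior D) = top_of_set (interior D)"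
      by (simp add: subtopology_subtopology inf.absorb2 interior_subset)
    then show "homeomorphic_map (top_of_set (interior D)) (subtopology (top_of_set D) ((\<lambda>s. s) ` interior D)) (\<lambda>s. s)"
      unfolding homeomorphic_map_maps homeomorphic_maps_def by (intro exI[of _ "\<lambda>s. s"]) simp
    show "openin (top_of_set D) ((\<lambda>s. s) ` interior D)"
      using interior_subset[of D] by (auto simp: openin_open)
  qed (use assms interior_nondegenerate_interval in auto)
  then show ?thesis by simp
qed

text \<open>Removes the Hilbert choice for intervals too. \<open>seg_interior\<close> is taken in
  the real line and \<open>S interior_of A\<close> in \<open>S\<close>; they can differ only at end
  points of \<open>S\<close>, which the second factor discards.\<close>

lemma seg_interior_eq:
  assumes S: "circle_like S \<or> interval_like S" and A: "A \<subseteq> topspace S"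
  shows "seg_interior S A = S interior_of A \<inter> seg_interior S (topspace S)"
proof (cases "circle_like S")
  case True
  then show ?thesis using A by (simp add: circle_interior) (use interior_of_subset in fastforce)
next
  case False
  then obtain D \<upsilon> where D: "nondegenerate_interval D" "homeomorphic_map (top_of_set D) S \<upsilon>"
    and int: "\<And>A. seg_interior S A = \<upsilon> ` interior {b \<in> D. \<upsilon> b \<in> A}"
    using S interval_interiorE by metis
  note k = interval_interior_chart[OF D]
  have sur: "\<upsilon> ` D = topspace S" using homeomorphic_imp_surjective_map[OF D(2)] by simp
  then have top: "{b \<in> D. \<upsilon> b \<in> topspace S} = D" by blast
  let ?B = "{b \<in> D. \<upsilon> b \<in> A}"
  have "interior ?B \<subseteq> interior D" by (rule interior_mono) auto
  then have "\<upsilon> ` interior ?B \<subseteq> S interior_of A"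
    using interior_subset[of ?B] by (intro interior_of_maximal line_chart_image_open[OF k]) auto
  moreover have "\<upsilon> ` interior ?B \<subseteq> \<upsilon> ` interior D" using \<open>interior ?B \<subseteq> interior D\<close> by blast
  moreover have "\<upsilon> s \<in> \<upsilon> ` interior ?B" if s: "s \<in> interior D" "\<upsilon> s \<in> S interior_of A" for s
  proof -
    have "open {s \<in> interior D. \<upsilon> s \<in> S interior_of A}"
      by (rule line_chart_vimage_open[OF k]) simp
    moreover have "{s \<in> interior D. \<upsilon> s \<in> S interior_of A} \<subseteq> ?B"
      using interior_subset[of D] interior_of_subset[of S A] by blast
    ultimately have "{s \<in> interior D. \<upsilon> s \<in> S interior_of A} \<subseteq> interior ?B"
      by (rule interior_maximal[rotated])
    then show ?thesis using s by blast
  qed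
  ultimately show ?thesis unfolding int top by blast
qed

lemma seg_interior_line_points:
  assumes S: "circle_like S \<or> interval_like S"
  shows "seg_interior S (topspace S) \<subseteq> line_points S"
proof (cases "circle_like S")
  case True
  then obtain \<upsilon> where hom: "homeomorphic_map unit_circle S \<upsilon>"
    by (auto simp: circle_like_def homeomorphic_space)
  show ?thesis
  proof
    fix x assume "x \<in> seg_interior S (topspace S)"
    then have x: "x \<in> topspace S" using True by (simp add: circle_interior)
    have ab: "\<upsilon> 1 \<in> topspace S" "\<upsilon> (-1) \<in> topspace S" "\<upsilon> 1 \<noteq> \<upsilon> (-1)"
      using homeomorphic_imp_surjective_map[OF hom]
        inj_on_eq_iff[OF homeomorphic_imp_injective_map[OF hom], of 1 "-1"]
      by (auto simp: unit_circle_def)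
    then obtain p where "p \<in> topspace S" "p \<noteq> x" by metis
    with circle_punctured_chart[OF hom this(1)] x show "x \<in> line_points S"
      by (metis DiffI line_chart_line_points singletonD subsetD)
  qed
next
  case False
  then obtain D \<upsilon> where D: "nondegenerate_interval D" "homeomorphic_map (top_of_set D) S \<upsilon>"
    and int: "\<And>A. seg_interior S A = \<upsilon> ` interior {b \<in> D. \<upsilon> b \<in> A}"
    using S interval_interiorE by metis
  have "\<upsilon> ` D = topspace S" using homeomorphic_imp_surjective_map[OF D(2)] by simp
  then have top: "{b \<in> D. \<upsilon> b \<in> topspace S} = D" by blast
  show ?thesis
    unfolding int top by (rule line_chart_line_points[OF interval_interior_chart[OF D]])
qed

text \<open>On the circle, properness provides a point at which to puncture, and a punctured circle
  is a line. On an interval the interior is itself a single chart.\<close>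

lemma proper_subset_in_chart:
  assumes S: "circle_like S \<or> interval_like S" and A: "A \<subset> seg_interior S (topspace S)"
  obtains J k where "line_chart S J k" "A \<subseteq> k ` J"
proof (cases "circle_like S")
  case True
  then obtain \<upsilon> where hom: "homeomorphic_map unit_circle S \<upsilon>"
    by (auto simp: circle_like_def homeomorphic_space)
  from A True obtain p where "p \<in> topspace S" "p \<notin> A" "A \<subseteq> topspace S"
    by (auto simp: circle_interior)
  then show thesis using circle_punctured_chart[OF hom] that by (metis subset_Diff_insert Diff_empty)
next
  case False
  then obtain D \<upsilon> where D: "nondegenerate_interval D" "homeomorphic_map (top_of_set D) S \<upsilon>"
    and int: "\<And>A. seg_interior S A = \<upsilon> ` interior {b \<in> D. \<upsilon> b \<in> A}"
    using S interval_interiorE by metis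
  have "\<upsilon> ` D = topspace S" using homeomorphic_imp_surjective_map[OF D(2)] by simp
  then have top: "{b \<in> D. \<upsilon> b \<in> topspace S} = D" by blast
  show thesis
    using that[OF interval_interior_chart[OF D]] A unfolding int top by blast
qed

text \<open>In the interval model both preimages are intervals through \<open>s\<close> with no
  other common point. They therefore extend to opposite sides of \<open>s\<close>, which puts
  \<open>s\<close> strictly between two points of \<open>D\<close>.\<close>

lemma joint_interior:
  assumes S: "circle_like S \<or> interval_like S" and A: "segment S A" and B: "segment S B"
    and AB: "A \<inter> B = {x}"
  shows "x \<in> seg_interior S (topspace S)"
proof (cases "circle_like S")
  case True
  then show ?thesis using AB segment_subset[OF A] by (simp add: circle_interior) blast
next
  case False
  then obtain D \<upsilon> where D: "nondegenerate_interval D" "homeomorphic_map (top_of_set D) S \<upsilon>"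
    and int: "\<And>A. seg_interior S A = \<upsilon> ` interior {b \<in> D. \<upsilon> b \<in> A}"
    using S interval_interiorE by metis
  have sur: "\<upsilon> ` D = topspace S" using homeomorphic_imp_surjective_map[OF D(2)] by simp
  then have top: "{b \<in> D. \<upsilon> b \<in> topspace S} = D" by blast
  have pre: "is_interval {b \<in> D. \<upsilon> b \<in> C} \<and> \<upsilon> ` {b \<in> D. \<upsilon> b \<in> C} = C" if "segment S C" for C
  proof -
    have im: "\<upsilon> ` {b \<in> D. \<upsilon> b \<in> C} = C"
      using image_preimage_restrict[OF sur segment_subset[OF that]] .
    then have "connectedin (top_of_set D) {b \<in> D. \<upsilon> b \<in> C}"
      using homeomorphic_map_connectedness_eq[OF D(2), of "{b \<in> D. \<upsilon> b \<in> C}"] that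
      by (auto simp: segment_def)
    then show ?thesis using im by (simp add: connectedin_subtopology is_interval_connected_1)
  qed
  define P where "P = {b \<in> D. \<upsilon> b \<in> A}"
  define Q where "Q = {b \<in> D. \<upsilon> b \<in> B}"
  have P: "is_interval P" "\<upsilon> ` P = A" and Q: "is_interval Q" "\<upsilon> ` Q = B"
    using pre[OF A] pre[OF B] by (auto simp: P_def Q_def)
  have xAB: "x \<in> A" "x \<in> B" using AB by auto
  then have "x \<in> \<upsilon> ` D" unfolding sur using segment_subset[OF A] by blast
  then obtain s where s: "s \<in> D" "\<upsilon> s = x" by blast
  have sPQ: "P \<inter> Q = {s}"
  proof (intro equalityI subsetI)
    fix t assume t: "t \<in> P \<inter> Q"
    then have "\<upsilon> t \<in> A \<inter> B" "t \<in> D" by (auto simp: P_def Q_def)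
    then have "\<upsilon> t = \<upsilon> s" using AB s(2) by simp
    then show "t \<in> {s}"
      using inj_onD[OF homeomorphic_imp_injective_map[OF D(2)]] \<open>t \<in> D\<close> s(1) by simp
  qed (use s xAB in \<open>auto simp: P_def Q_def\<close>)
  have other: "\<exists>b\<in>{b \<in> D. \<upsilon> b \<in> C}. b \<noteq> s" if C: "segment S C" for C
  proof -
    obtain y where y: "y \<in> C" "y \<noteq> x" using segment_other_point[OF C, of x] by (rule bexE)
    then have "y \<in> \<upsilon> ` D"
      using subsetD[OF segment_subset[OF C]] by (simp only: sur)
    then obtain b where "b \<in> D" "y = \<upsilon> b" by (rule imageE)
    then show ?thesis using s(2) y by (intro bexI[of _ b]) auto
  qed
  obtain a where a: "a \<in> P" "a \<noteq> s" using other[OF A] by (auto simp: P_def)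
  obtain c where c: "c \<in> Q" "c \<noteq> s" using other[OF B] by (auto simp: Q_def)
  have sP: "s \<in> P" "s \<in> Q" using sPQ by auto
  have PD: "P \<subseteq> D" "Q \<subseteq> D" by (auto simp: P_def Q_def)
  have iD: "is_interval D" using D(1) by (simp add: nondegenerate_interval_def)
  \<comment> \<open>If \<open>a\<close> and \<open>c\<close> lay on the same side of
    \<open>s\<close>, the one closer to \<open>s\<close> would belong to both intervals.\<close>
  have no1: "\<not> (s < a \<and> s < c)"
  proof
    assume h: "s < a \<and> s < c"
    have "min a c \<in> P" by (rule mem_is_interval_1_I[OF P(1) sP(1) a(1)]) (use h in auto)
    moreover have "min a c \<in> Q" by (rule mem_is_interval_1_I[OF Q(1) sP(2) c(1)]) (use h in auto)
    ultimately show False using sPQ h by (auto simp: min_def split: if_splits)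
  qed
  have no2: "\<not> (a < s \<and> c < s)"
  proof
    assume h: "a < s \<and> c < s"
    have "max a c \<in> P" by (rule mem_is_interval_1_I[OF P(1) a(1) sP(1)]) (use h in auto)
    moreover have "max a c \<in> Q" by (rule mem_is_interval_1_I[OF Q(1) c(1) sP(2)]) (use h in auto)
    ultimately show False using sPQ h by (auto simp: max_def split: if_splits)
  qed
  have "s \<in> {min a c<..<max a c}" using no1 no2 a(2) c(2) by auto
  moreover have "{min a c<..<max a c} \<subseteq> D"
  proof
    fix t assume t: "t \<in> {min a c<..<max a c}"
    have "min a c \<in> D" "max a c \<in> D" using a(1) c(1) PD by (auto simp: min_def max_def)
    then show "t \<in> D" by (rule mem_is_interval_1_I[OF iD]) (use t in auto)
  qed
  ultimately have "s \<in> interior D" using interior_maximal[of "{min a c<..<max a c}" D] by auto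
  then show ?thesis unfolding int top using s by blast
qed

lemma real_analytic_compose_holomorphic_family:
  fixes f :: "nat \<Rightarrow> (nat \<Rightarrow> real) \<Rightarrow> real" and y :: "real \<Rightarrow> nat \<Rightarrow> real"
  assumes f: "\<And>j. j < m \<Longrightarrow> real_analytic_on n A (f j)" and e: "0 < e"
    and Y: "\<And>i. i < n \<Longrightarrow> Y i holomorphic_on ball (of_real s0) e"
    and yA: "\<And>s. \<bar>s - s0\<bar> < e \<Longrightarrow> y s \<in> A"
    and ytop: "\<And>s. \<bar>s - s0\<bar> < e \<Longrightarrow> y s \<in> topspace (Euclidean_space n)"
    and Yy: "\<And>s i. \<bar>s - s0\<bar> < e \<Longrightarrow> i < n \<Longrightarrow> Y i (of_real s) = of_real (y s i)"
  obtains e' F where "0 < e'" "e' \<le> e" "\<And>j. j < m \<Longrightarrow> F j holomorphic_on ball (of_real s0) e'"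
    "\<And>j s. j < m \<Longrightarrow> \<bar>s - s0\<bar> < e' \<Longrightarrow> F j (of_real s) = of_real (f j (y s))"
proof -
  have "\<exists>p. 0 < fst p \<and> snd p holomorphic_on ball (complex_of_real s0) (fst p) \<and>
      (\<forall>s. \<bar>s - s0\<bar> < fst p \<longrightarrow> snd p (of_real s) = of_real (f j (y s)))" if "j < m" for j
  proof -
    have fj: "real_analytic_on n A (f j)" by (rule f[OF that])
    obtain e' F where "0 < e'" "e' \<le> e" "F holomorphic_on ball (of_real s0) e'"
      "\<And>s. \<bar>s - s0\<bar> < e' \<Longrightarrow> F (of_real s) = of_real (f j (y s))"
      using real_analytic_compose_holomorphic[OF fj e Y yA ytop Yy] by blast
    then show ?thesis by (intro exI[of _ "(e', F)"]) auto
  qed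
  then obtain p where p: "\<And>j. j < m \<Longrightarrow> 0 < fst (p j)"
    "\<And>j. j < m \<Longrightarrow> snd (p j) holomorphic_on ball (complex_of_real s0) (fst (p j))"
    "\<And>j s. j < m \<Longrightarrow> \<bar>s - s0\<bar> < fst (p j) \<Longrightarrow> snd (p j) (of_real s) = of_real (f j (y s))"
    by metis
  \<comment> \<open>Inserting \<open>e\<close> bounds the radius by \<open>e\<close> and keeps the
    set non-empty when \<open>m = 0\<close>.\<close>
  define d where "d = Min (insert e ((\<lambda>j. fst (p j)) ` {..<m}))"
  have d: "d \<le> fst (p j)" if "j < m" for j
    unfolding d_def using that by (intro Min_le) auto
  show thesis
  proof
    show "0 < d" unfolding d_def using e p(1) by (subst Min_gr_iff) auto
    show "d \<le> e" unfolding d_def by (intro Min_le) auto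
    show "snd (p j) holomorphic_on ball (of_real s0) d" if "j < m" for j
      by (rule holomorphic_on_subset[OF p(2)[OF that] subset_ball[OF d[OF that]]])
    show "snd (p j) (of_real s) = of_real (f j (y s))" if "j < m" "\<bar>s - s0\<bar> < d" for j s
      using p(3)[OF that(1)] that(2) d[OF that(1)] by simp
  qed
qed

section \<open>Two-sided charts from the analytic atlas\<close>

lemma line_chartI:
  assumes J: "open J" "is_interval J" and k: "continuous_map (top_of_set J) S k" "inj_on k J"
    and lp: "k ` J \<subseteq> line_points S"
  shows "line_chart S J k"
proof -
  have op: "openin S (k ` X)" if "open X" "X \<subseteq> J" for X
  proof (rule openin_image_line_points[OF that(1)])
    have "continuous_map (subtopology (top_of_set J) X) S k"
      by (rule continuous_map_from_subtopology[OF k(1)])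
    then show "continuous_map (top_of_set X) S k"
      using that(2) by (simp add: subtopology_subtopology inf.absorb2)
    show "inj_on k X" by (rule inj_on_subset[OF k(2) that(2)])
    show "k ` X \<subseteq> line_points S" using lp that(2) by blast
  qed
  have "open_map (top_of_set J) (subtopology S (k ` J)) k"
    unfolding open_map_def
  proof (intro allI impI)
    fix X assume X: "openin (top_of_set J) X"
    then have "open X" "X \<subseteq> J" using J(1) openin_open_trans openin_imp_subset by blast+
    then show "openin (subtopology S (k ` J)) (k ` X)"
      using op by (metis image_mono openin_subset_topspace_eq openin_subtopology_Int2 inf.absorb_iff2)
  qed
  moreover have "continuous_map (top_of_set J) (subtopology S (k ` J)) k"
    using k(1) by (simp add: continuous_map_in_subtopology)
  moreover have "k ` J \<subseteq> topspace S" using order_trans[OF lp line_points_subset] .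
  ultimately have "homeomorphic_map (top_of_set J) (subtopology S (k ` J)) k"
    using k(2) by (intro bijective_open_imp_homeomorphic_map) auto
  then show ?thesis using J op[OF J(1)] by (simp add: line_chart_def)
qed

lemma continuous_map_coordinate:
  "continuous_map (Euclidean_space n) euclideanreal (\<lambda>v. v i)"
  unfolding Euclidean_space_def
  by (intro continuous_map_from_subtopology continuous_map_product_projection) simp

lemma line_point_in_Euclidean_space: "line_point s \<in> topspace (Euclidean_space 1)"
  by (simp add: line_point_def topspace_Euclidean_space)

lemma line_point_coordinate: "v \<in> topspace (Euclidean_space 1) \<Longrightarrow> line_point (v 0) = v"
  by (auto simp: line_point_def topspace_Euclidean_space)

lemma continuous_map_line_point: "continuous_map euclideanreal (Euclidean_space 1) line_point"
proof -
  have "continuous_map euclideanreal euclideanreal (\<lambda>s. line_point s i)" for i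
    by (cases "i = 0") (simp_all add: line_point_def)
  then have "continuous_map euclideanreal (powertop_real UNIV) line_point"
    by (simp add: continuous_map_componentwise_UNIV)
  then show ?thesis
    unfolding Euclidean_space_def
    by (auto simp: continuous_map_in_subtopology line_point_def)
qed

text \<open>The atlas may offer only half-space charts at \<open>x\<close>. The coordinate change
  from a line chart to \<open>h\<close> is injective and continuous on an open set of reals, so by
  invariance of domain \<open>h\<close> covers a full interval around \<open>s0\<close>, and the
  analytic data at \<open>x\<close> are two-sided.\<close>

lemma analytic_chart_at:
  assumes S: "analytic_manifold_with_boundary 1 S AS" and x: "x \<in> line_points S"
  obtains U h s0 e where "(U, h) \<in> AS" "e > 0" "line_chart S {s0 - e<..<s0 + e} (\<lambda>s. inv_into U h (line_point s))"
    "inv_into U h (line_point s0) = x" "\<And>s. \<bar>s - s0\<bar> < e \<Longrightarrow> line_point s \<in> h ` U"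
proof -
  obtain J k r0 where k: "line_chart S J k" "r0 \<in> J" "k r0 = x" using x by (rule line_pointsE)
  have "x \<in> topspace S" by (rule subsetD[OF line_points_subset x])
  then obtain c where c: "c \<in> AS" "x \<in> fst c"
    using S unfolding analytic_manifold_with_boundary_def analytic_atlas_def by blast
  obtain U h where Uh: "c = (U, h)" by (cases c)
  then have "is_chart_on 1 (topspace (Euclidean_space 1)) S (U, h) \<or> is_chart_on 1 (half_space 1) S (U, h)"
    using S c(1) unfolding analytic_manifold_with_boundary_def by blast
  then obtain H where "is_chart_on 1 H S (U, h)" by blast
  then have U: "openin S U" and H: "openin (subtopology (Euclidean_space 1) H) (h ` U)" and
    hom: "homeomorphic_map (subtopology S U) (subtopology (Euclidean_space 1) (h ` U)) h"
    unfolding is_chart_on_def by simp_all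
  have hU: "h ` U \<subseteq> topspace (Euclidean_space 1)"
    using openin_subset[OF H] by (simp only: topspace_subtopology le_inf_iff)
  have Utop: "U \<subseteq> topspace S" using U by (rule openin_subset)
  have injh: "inj_on h U"
    using homeomorphic_imp_injective_map[OF hom] Utop by (simp add: inf.absorb2)
  obtain hi where "homeomorphic_maps (subtopology S U) (subtopology (Euclidean_space 1) (h ` U)) h hi"
    using hom unfolding homeomorphic_map_maps by blast
  then have hi: "continuous_map (subtopology (Euclidean_space 1) (h ` U)) (subtopology S U) hi"
    and hih: "\<And>u. u \<in> U \<Longrightarrow> hi (h u) = u"
    using Utop by (auto simp: homeomorphic_maps_def)
  have conth: "continuous_map (subtopology S U) (Euclidean_space 1) h"
    using homeomorphic_imp_continuous_map[OF hom] by (simp add: continuous_map_in_subtopology)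
  define X where "X = {s\<in>J. k s \<in> U}"
  have X: "open X" unfolding X_def by (rule line_chart_vimage_open[OF k(1) U])
  have kX: "continuous_map (top_of_set X) (subtopology S U) k"
  proof -
    have "continuous_map (subtopology (top_of_set J) X) S k"
      by (rule continuous_map_from_subtopology[OF line_chart_continuous[OF k(1)]])
    moreover have "X \<subseteq> J" by (auto simp: X_def)
    ultimately show ?thesis
      by (auto simp: continuous_map_in_subtopology subtopology_subtopology inf.absorb2 X_def)
  qed
  let ?f = "\<lambda>s. h (k s) 0"
  have "continuous_map (top_of_set X) euclideanreal ((\<lambda>v. v 0) \<circ> (h \<circ> k))"
    by (rule continuous_map_compose[OF continuous_map_compose[OF kX conth] continuous_map_coordinate])
  then have "continuous_on X ?f" by (simp add: o_def)
  moreover have "inj_on ?f X"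
  proof (rule inj_onI)
    fix a b assume ab: "a \<in> X" "b \<in> X" "?f a = ?f b"
    then have "h (k a) \<in> topspace (Euclidean_space 1)" "h (k b) \<in> topspace (Euclidean_space 1)"
      using hU by (auto simp: X_def)
    then have "h (k a) = h (k b)" using ab(3) line_point_coordinate by metis
    then have "k a = k b" using injh ab by (auto simp: X_def dest: inj_onD)
    then show "a = b" using line_chart_inj[OF k(1)] ab by (auto simp: X_def dest: inj_onD)
  qed
  ultimately have "open (?f ` X)" using X by (intro invariance_of_domain)
  moreover have "r0 \<in> X" using k c Uh by (simp add: X_def)
  ultimately obtain e where e: "e > 0" "ball (?f r0) e \<subseteq> ?f ` X"
    using open_contains_ball by blast
  define s0 where "s0 = ?f r0"
  define q where "q = (\<lambda>s. inv_into U h (line_point s))"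
  define I where "I = {s0 - e<..<s0 + e}"
  have I: "I = ball (?f r0) e" by (simp add: I_def s0_def ball_eq_greaterThanLessThan)
  have pt: "\<exists>t\<in>X. s = ?f t \<and> line_point s = h (k t) \<and> q s = k t" if "s \<in> I" for s
  proof -
    have "s \<in> ?f ` X" using that unfolding I by (rule subsetD[OF e(2)])
    then obtain t where t: "t \<in> X" "s = ?f t" by blast
    then have kt: "k t \<in> U" by (simp add: X_def)
    then have "line_point s = h (k t)" using t(2) line_point_coordinate[of "h (k t)"] hU by auto
    then show ?thesis using t kt injh by (auto simp: q_def inv_into_f_f)
  qed
  have memI: "s \<in> I \<longleftrightarrow> \<bar>s - s0\<bar> < e" for s by (auto simp: I_def abs_if)
  show thesis
  proof
    show "(U, h) \<in> AS" using c Uh by simp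
    show "e > 0" by fact
    show "inv_into U h (line_point s0) = x"
    proof -
      have "s0 \<in> I" using e(1) by (simp add: I_def)
      then have "line_point s0 = h (k r0)"
        using line_point_coordinate[of "h (k r0)"] hU \<open>r0 \<in> X\<close> by (auto simp: s0_def X_def)
      then show ?thesis using injh \<open>r0 \<in> X\<close> k(3) by (simp add: X_def inv_into_f_f)
    qed
    show "line_point s \<in> h ` U" if "\<bar>s - s0\<bar> < e" for s
      using pt[of s] that by (auto simp: memI X_def)
    have "line_chart S I q"
    proof (rule line_chartI)
      show "open I" "is_interval I" by (auto simp: I_def is_interval_oo)
      show "q ` I \<subseteq> line_points S"
        using pt line_chart_line_points[OF k(1)] by (force simp: X_def)
      show "inj_on q I"
      proof (rule inj_onI)
        fix a b assume ab: "a \<in> I" "b \<in> I" "q a = q b"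
        obtain t where t: "t \<in> X" "a = ?f t" "q a = k t" using pt[OF ab(1)] by blast
        obtain u where u: "u \<in> X" "b = ?f u" "q b = k u" using pt[OF ab(2)] by blast
        show "a = b" using t u ab(3) by simp
      qed
      have "line_point ` I \<subseteq> h ` U"
        using pt by (force simp: X_def)
      moreover have "continuous_map (top_of_set I) (Euclidean_space 1) line_point"
        by (rule continuous_map_from_subtopology[OF continuous_map_line_point])
      ultimately have "continuous_map (top_of_set I) (subtopology (Euclidean_space 1) (h ` U)) line_point"
        by (auto simp: continuous_map_in_subtopology)
      then have "continuous_map (top_of_set I) (subtopology S U) (hi \<circ> line_point)"
        using hi by (rule continuous_map_compose)
      then have "continuous_map (top_of_set I) S (hi \<circ> line_point)"
        by (simp add: continuous_map_in_subtopology)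
      then show "continuous_map (top_of_set I) S q"
      proof (rule continuous_map_eq)
        fix s assume "s \<in> topspace (top_of_set I)"
        then obtain t where "t \<in> X" "line_point s = h (k t)" "q s = k t" using pt[of s] by auto
        then show "(hi \<circ> line_point) s = q s" using hih[of "k t"] by (simp add: X_def)
      qed
    qed
    then show "line_chart S {s0 - e<..<s0 + e} (\<lambda>s. inv_into U h (line_point s))"
      by (simp add: I_def q_def)
  qed
qed

subsection \<open>Analytic continuation of the action along the curve\<close>

text \<open>Carries the non-zero derivative in the definition of an immersion over to the
  holomorphic extension, where local invertibility is applied.\<close>

lemma has_real_derivative_imp_deriv:
  fixes g :: "real \<Rightarrow> real"
  assumes g: "(g has_real_derivative D) (at s0)" and F: "F holomorphic_on ball (of_real s0) e" and "e > 0"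
    and eq: "\<And>s. \<bar>s - s0\<bar> < e \<Longrightarrow> F (of_real s) = of_real (g s)"
  shows "deriv F (of_real s0) = of_real D"
proof -
  have "(F has_field_derivative deriv F (of_real s0)) (at (of_real s0))"
    using F \<open>e > 0\<close> by (intro holomorphic_derivI[where S = "ball (of_real s0) e"]) auto
  then have 1: "((\<lambda>s. F (of_real s)) has_vector_derivative deriv F (of_real s0)) (at s0)"
    by (rule has_vector_derivative_real_field)
  have "((\<lambda>s. complex_of_real (g s)) has_vector_derivative of_real D) (at s0)"
    using g by (intro has_vector_derivative_of_real) (simp add: has_real_derivative_iff_has_vector_derivative)
  moreover have "\<forall>\<^sub>F s in nhds s0. F (of_real s) = complex_of_real (g s)"
    unfolding eventually_nhds_metric using eq \<open>e > 0\<close> by (auto simp: dist_real_def)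
  ultimately have "((\<lambda>s. F (of_real s)) has_vector_derivative of_real D) (at s0)"
    using eq[of s0] \<open>e > 0\<close>
    by (subst has_vector_derivative_cong_ev[where g = "\<lambda>s. complex_of_real (g s)"])
      (auto elim: eventually_mono)
  then show ?thesis using 1 vector_derivative_unique_at by metis
qed

locale analytic_action = group_action G "topspace M" \<phi>
  for G :: "('g, 'r) monoid_scheme" and M :: "'m topology" and \<phi> :: "'g \<Rightarrow> 'm \<Rightarrow> 'm" +
  fixes m :: nat and AM :: "'m chart set" and S :: "'s topology" and AS :: "'s chart set" and \<iota> :: "'s \<Rightarrow> 'm"
  assumes M: "analytic_manifold m M AM"
    and \<phi>_analytic: "\<And>g. g \<in> carrier G \<Longrightarrow> analytic_map m M AM m M AM (\<phi> g)"
    and S: "analytic_1_submanifold m M AM S AS \<iota>"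
begin

lemma S_manifold: "analytic_manifold_with_boundary 1 S AS"
  using S by (simp add: analytic_1_submanifold_def)

lemma S_Hausdorff: "Hausdorff_space S"
  using S_manifold by (simp add: analytic_manifold_with_boundary_def)

lemma M_Hausdorff: "Hausdorff_space M"
  using M by (simp add: analytic_manifold_def)

lemma \<iota>_inj: "inj_on \<iota> (topspace S)"
  using S by (simp add: analytic_1_submanifold_def)

lemma \<iota>_continuous: "continuous_map S M \<iota>"
  using S by (simp add: analytic_1_submanifold_def analytic_immersion_1_def analytic_map_def)

lemma \<phi>_continuous: "g \<in> carrier G \<Longrightarrow> continuous_map M M (\<phi> g)"
  using \<phi>_analytic by (simp add: analytic_map_def)

lemma \<iota>_closed: "x \<in> topspace S \<Longrightarrow> \<iota> x \<in> topspace M"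
  using \<iota>_continuous by (simp add: continuous_map_def Pi_iff)

lemma M_chart:
  assumes "p \<in> topspace M"
  obtains V \<psi> where "(V, \<psi>) \<in> AM" "p \<in> V"
proof -
  have "p \<in> (\<Union>c\<in>AM. fst c)"
    using M assms unfolding analytic_manifold_def analytic_atlas_def by simp
  then obtain c where "c \<in> AM" "p \<in> fst c" by blast
  then show thesis using that[of "fst c" "snd c"] by simp
qed

lemma M_chart_props:
  assumes "(V, \<psi>) \<in> AM"
  shows "openin M V" "inj_on \<psi> V" "\<psi> ` V \<subseteq> topspace (Euclidean_space m)"
proof -
  have "is_chart_on m (topspace (Euclidean_space m)) M (V, \<psi>)"
    using M assms by (simp add: analytic_manifold_def)
  then have V: "openin M V"
    and H: "openin (subtopology (Euclidean_space m) (topspace (Euclidean_space m))) (\<psi> ` V)"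
    and hom: "homeomorphic_map (subtopology M V) (subtopology (Euclidean_space m) (\<psi> ` V)) \<psi>"
    unfolding is_chart_on_def by simp_all
  show "openin M V" by (rule V)
  show "\<psi> ` V \<subseteq> topspace (Euclidean_space m)"
    using openin_subset[OF H] by (simp only: topspace_subtopology le_inf_iff)
  show "inj_on \<psi> V"
    using homeomorphic_imp_injective_map[OF hom] openin_subset[OF V] by (simp add: inf.absorb2)
qed

text \<open>An arbitrary \<open>line_chart\<close> is only continuous. Analyticity and immersion of
  \<open>\<iota>\<close> are stated through the charts in \<open>AS\<close>, so the parametrization
  has to be the inverse of one of them.\<close>

definition analytic_parameter :: "(real \<Rightarrow> 's) \<Rightarrow> real \<Rightarrow> real \<Rightarrow> bool" where
  "analytic_parameter k s0 e \<longleftrightarrow> e > 0 \<and> line_chart S {s0 - e<..<s0 + e} k \<and>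
     (\<exists>U h. (U, h) \<in> AS \<and> k = (\<lambda>s. inv_into U h (line_point s)) \<and>
        (\<forall>s. \<bar>s - s0\<bar> < e \<longrightarrow> line_point s \<in> h ` U))"

lemma analytic_parameter_at:
  assumes "x \<in> line_points S"
  obtains k s0 e where "analytic_parameter k s0 e" "k s0 = x"
proof -
  show thesis
  proof (rule analytic_chart_at[OF S_manifold assms])
    fix U h s0 e
    assume *: "(U, h) \<in> AS" "0 < e"
      "line_chart S {s0 - e<..<s0 + e} (\<lambda>s. inv_into U h (line_point s))"
      "inv_into U h (line_point s0) = x" "\<And>s. \<bar>s - s0\<bar> < e \<Longrightarrow> line_point s \<in> h ` U"
    have "analytic_parameter (\<lambda>s. inv_into U h (line_point s)) s0 e"
      unfolding analytic_parameter_def using *(1,2,3,5) by blast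
    then show thesis using *(4) by (rule that)
  qed
qed

lemma chart_preimage_ball:
  assumes k: "analytic_parameter k s0 e" and f: "continuous_map S M f" and V: "openin M V" "f (k s0) \<in> V"
  obtains d where "0 < d" "d \<le> e" "\<And>s. \<bar>s - s0\<bar> < d \<Longrightarrow> f (k s) \<in> V"
proof -
  have e: "e > 0" and c: "line_chart S {s0 - e<..<s0 + e} k"
    using k by (auto simp: analytic_parameter_def)
  have "openin S {x \<in> topspace S. f x \<in> V}"
    using openin_continuous_map_preimage[OF f V(1)] .
  then have op: "open {s \<in> {s0 - e<..<s0 + e}. k s \<in> {x \<in> topspace S. f x \<in> V}}" (is "open ?X")
    by (rule line_chart_vimage_open[OF c])
  have s0: "s0 \<in> {s0 - e<..<s0 + e}" using e by simp
  have "k s0 \<in> topspace S" by (rule subsetD[OF line_chart_subset[OF c] imageI[OF s0]])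
  with s0 have "s0 \<in> ?X" using V(2) by blast
  then obtain d where d: "d > 0" "ball s0 d \<subseteq> ?X"
    using op open_contains_ball by blast
  show thesis
  proof (rule that[of "min d e"])
    show "f (k s) \<in> V" if s: "\<bar>s - s0\<bar> < min d e" for s
    proof -
      have "s \<in> ball s0 d" using s by (simp add: dist_real_def abs_minus_commute)
      then show ?thesis using d(2) by blast
    qed
  qed (use d e in auto)
qed

lemma analytic_curve:
  assumes k: "analytic_parameter k s0 e" and V: "(V, \<psi>) \<in> AM" "\<iota> (k s0) \<in> V"
  obtains d F where "0 < d" "d \<le> e" "\<And>j. j < m \<Longrightarrow> F j holomorphic_on ball (of_real s0) d"
    "\<And>s. \<bar>s - s0\<bar> < d \<Longrightarrow> \<iota> (k s) \<in> V"
    "\<And>j s. j < m \<Longrightarrow> \<bar>s - s0\<bar> < d \<Longrightarrow> F j (of_real s) = of_real (\<psi> (\<iota> (k s)) j)"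
    "\<exists>j<m. deriv (F j) (of_real s0) \<noteq> 0"
proof -
  obtain U h where Uh: "(U, h) \<in> AS" and kdef: "k = (\<lambda>s. inv_into U h (line_point s))"
    and lp: "\<And>s. \<bar>s - s0\<bar> < e \<Longrightarrow> line_point s \<in> h ` U"
    using k by (auto simp: analytic_parameter_def)
  obtain d0 where d0: "0 < d0" "d0 \<le> e" "\<And>s. \<bar>s - s0\<bar> < d0 \<Longrightarrow> \<iota> (k s) \<in> V"
    using chart_preimage_ball[OF k \<iota>_continuous M_chart_props(1)[OF V(1)] V(2)] by blast
  let ?D = "local_dom (U, h) (V, \<psi>) \<iota>" and ?r = "\<lambda>j t. local_rep (U, h) (V, \<psi>) \<iota> t j"
  have rep: "?r j (line_point s) = \<psi> (\<iota> (k s)) j" for j s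
    by (simp add: local_rep_def kdef)
  have dom: "line_point s \<in> ?D" if "\<bar>s - s0\<bar> < d0" for s
  proof -
    have "line_point s \<in> h ` U" using lp that d0(2) by simp
    then have "k s \<in> U" "h (k s) = line_point s" by (simp_all add: kdef inv_into_into f_inv_into_f)
    then have "k s \<in> {x \<in> U. \<iota> x \<in> V}" using d0(3)[OF that] by simp
    then have "h (k s) \<in> h ` {x \<in> U. \<iota> x \<in> V}" by (rule imageI)
    then show ?thesis using \<open>h (k s) = line_point s\<close> by (simp add: local_dom_def)
  qed
  have an: "real_analytic_on 1 ?D (?r j)" if "j < m" for j
    using S Uh V(1) that
    unfolding analytic_1_submanifold_def analytic_immersion_1_def analytic_map_def analytic_in_charts_def by blast
  obtain d F where d: "0 < d" "d \<le> d0" and F: "\<And>j. j < m \<Longrightarrow> F j holomorphic_on ball (of_real s0) d"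
    and Fr: "\<And>j s. j < m \<Longrightarrow> \<bar>s - s0\<bar> < d \<Longrightarrow> F j (of_real s) = of_real (?r j (line_point s))"
  proof (rule real_analytic_compose_holomorphic_family[where m = m and n = 1 and A = ?D and f = ?r
        and y = line_point and e = d0 and Y = "\<lambda>i z. z" and ?s0.0 = s0])
    show "line_point s \<in> topspace (Euclidean_space 1)" for s
      by (rule line_point_in_Euclidean_space)
  qed (use an d0(1) dom in \<open>auto simp: line_point_def\<close>)
  have "\<exists>j<m. deriv (F j) (of_real s0) \<noteq> 0"
  proof -
    have "\<exists>j<m. \<exists>D. D \<noteq> 0 \<and> ((\<lambda>s. ?r j (line_point s)) has_real_derivative D)
          (at (line_point s0 0) within {s. line_point s \<in> ?D})"
      using S Uh V(1) dom[of s0] d0(1)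
      unfolding analytic_1_submanifold_def analytic_immersion_1_def by auto
    then obtain j D where j: "j < m" "D \<noteq> 0" and der: "((\<lambda>s. ?r j (line_point s)) has_real_derivative D)
          (at (line_point s0 0) within {s. line_point s \<in> ?D})" by blast
    \<comment> \<open>The derivative in the definition of an immersion is taken within the domain of
      the local representative; \<open>s0\<close> is interior to that domain, so it is an ordinary
      derivative.\<close>
    have "{s0 - d0<..<s0 + d0} \<subseteq> {s. line_point s \<in> ?D}" using dom by (auto simp: abs_if)
    moreover have "s0 \<in> {s0 - d0<..<s0 + d0}" using d0(1) by simp
    ultimately have "s0 \<in> interior {s. line_point s \<in> ?D}"
      by (meson interiorI open_greaterThanLessThan)
    then have "at s0 within {s. line_point s \<in> ?D} = at s0" by (rule at_within_interior)
    then have "((\<lambda>s. ?r j (line_point s)) has_real_derivative D) (at s0)"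
      using der by (simp add: line_point_def)
    then have "deriv (F j) (of_real s0) = of_real D"
      by (rule has_real_derivative_imp_deriv[OF _ F[OF j(1)] d(1) Fr[OF j(1)]])
    then show ?thesis using j by auto
  qed
  then show thesis using that[of d F] d d0 F Fr by (simp add: rep)
qed

text \<open>The curve is first read in a chart \<open>V'\<close> around
  \<open>\<iota> (k s0)\<close>, where its coordinates \<open>Y\<close> extend holomorphically; the
  power series of \<open>\<phi> g\<close> between \<open>V'\<close> and \<open>V\<close> is then
  composed with \<open>Y\<close>.\<close>

lemma analytic_translated_curve:
  assumes g: "g \<in> carrier G" and k: "analytic_parameter k s0 e" and V: "(V, \<psi>) \<in> AM" "\<phi> g (\<iota> (k s0)) \<in> V"
  obtains d F where "0 < d" "d \<le> e" "\<And>j. j < m \<Longrightarrow> F j holomorphic_on ball (of_real s0) d"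
    "\<And>s. \<bar>s - s0\<bar> < d \<Longrightarrow> \<phi> g (\<iota> (k s)) \<in> V"
    "\<And>j s. j < m \<Longrightarrow> \<bar>s - s0\<bar> < d \<Longrightarrow> F j (of_real s) = of_real (\<psi> (\<phi> g (\<iota> (k s))) j)"
proof -
  have e: "e > 0" and c: "line_chart S {s0 - e<..<s0 + e} k"
    using k by (auto simp: analytic_parameter_def)
  have "s0 \<in> {s0 - e<..<s0 + e}" using e by simp
  then have ks: "k s0 \<in> topspace S" by (rule subsetD[OF line_chart_subset[OF c] imageI])
  obtain V' \<psi>' where V': "(V', \<psi>') \<in> AM" "\<iota> (k s0) \<in> V'"
    using M_chart[OF \<iota>_closed[OF ks]] .
  obtain d1 Y where d1: "0 < d1" "d1 \<le> e" and Y: "\<And>j. j < m \<Longrightarrow> Y j holomorphic_on ball (of_real s0) d1"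
    and inV': "\<And>s. \<bar>s - s0\<bar> < d1 \<Longrightarrow> \<iota> (k s) \<in> V'"
    and Yr: "\<And>j s. j < m \<Longrightarrow> \<bar>s - s0\<bar> < d1 \<Longrightarrow> Y j (of_real s) = of_real (\<psi>' (\<iota> (k s)) j)"
    using analytic_curve[OF k V'] by metis
  have "continuous_map S M (\<phi> g \<circ> \<iota>)"
    by (rule continuous_map_compose[OF \<iota>_continuous \<phi>_continuous[OF g]])
  moreover have "(\<phi> g \<circ> \<iota>) (k s0) \<in> V" using V(2) by simp
  ultimately obtain d2 where d2: "0 < d2" "d2 \<le> e" "\<And>s. \<bar>s - s0\<bar> < d2 \<Longrightarrow> (\<phi> g \<circ> \<iota>) (k s) \<in> V"
    using chart_preimage_ball[OF k _ M_chart_props(1)[OF V(1)]] by metis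
  let ?d = "min d1 d2"
  let ?D = "local_dom (V', \<psi>') (V, \<psi>) (\<phi> g)" and ?r = "\<lambda>j t. local_rep (V', \<psi>') (V, \<psi>) (\<phi> g) t j"
  have an: "real_analytic_on m ?D (?r j)" if "j < m" for j
    using \<phi>_analytic[OF g] V(1) V'(1) that
    unfolding analytic_map_def analytic_in_charts_def by blast
  have rep: "?r j (\<psi>' (\<iota> (k s))) = \<psi> (\<phi> g (\<iota> (k s))) j" if "\<bar>s - s0\<bar> < d1" for j s
    using inv_into_f_f[OF M_chart_props(2)[OF V'(1)] inV'[OF that]] by (simp add: local_rep_def)
  obtain d F where d: "0 < d" "d \<le> ?d" and F: "\<And>j. j < m \<Longrightarrow> F j holomorphic_on ball (of_real s0) d"
    and Fr: "\<And>j s. j < m \<Longrightarrow> \<bar>s - s0\<bar> < d \<Longrightarrow> F j (of_real s) = of_real (?r j (\<psi>' (\<iota> (k s))))"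
  proof (rule real_analytic_compose_holomorphic_family[where m = m and n = m and A = ?D and f = ?r
        and y = "\<lambda>s. \<psi>' (\<iota> (k s))" and e = ?d and Y = Y and ?s0.0 = s0])
    show "0 < ?d" using d1 d2 by simp
    show "Y i holomorphic_on ball (of_real s0) ?d" if "i < m" for i
      by (rule holomorphic_on_subset[OF Y[OF that] subset_ball]) simp
    show "\<psi>' (\<iota> (k s)) \<in> topspace (Euclidean_space m)" if "\<bar>s - s0\<bar> < ?d" for s
      using inV'[of s] that M_chart_props(3)[OF V'(1)] by auto
    show "\<psi>' (\<iota> (k s)) \<in> ?D" if "\<bar>s - s0\<bar> < ?d" for s
      using inV'[of s] d2(3)[of s] that by (simp add: local_dom_def)
    show "Y i (of_real s) = of_real (\<psi>' (\<iota> (k s)) i)" if "\<bar>s - s0\<bar> < ?d" "i < m" for s i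
      using Yr that by simp
  qed (use an in auto)
  show thesis
  proof (rule that[of d F])
    show "\<phi> g (\<iota> (k s)) \<in> V" if "\<bar>s - s0\<bar> < d" for s using d2(3)[of s] that d by simp
    show "F j (of_real s) = of_real (\<psi> (\<phi> g (\<iota> (k s))) j)" if "j < m" "\<bar>s - s0\<bar> < d" for j s
      using Fr[OF that] rep[of s j] that(2) d by simp
  qed (use d d1 F in auto)
qed

end

section \<open>Embedded segments under the group action\<close>

lemma embedded_on_subset:
  assumes "embedded_on M S \<iota> A" "B \<subseteq> A" "A \<subseteq> topspace S"
  shows "embedded_on M S \<iota> B"
proof -
  have hom: "homeomorphic_map (subtopology S A) (subtopology M (\<iota> ` A)) \<iota>"
    using assms(1,3) by (simp add: embedded_on_def embedding_map_def inf.absorb2)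
  have surj: "\<iota> ` A = topspace M \<inter> \<iota> ` A"
  proof -
    have "\<iota> ` (topspace S \<inter> A) = topspace M \<inter> \<iota> ` A"
      using homeomorphic_imp_surjective_map[OF hom] by (simp only: topspace_subtopology)
    then show ?thesis using assms(3) by (simp only: inf.absorb2)
  qed
  have "homeomorphic_map (subtopology (subtopology S A) B) (subtopology (subtopology M (\<iota> ` A)) (\<iota> ` B)) \<iota>"
  proof (rule homeomorphic_map_subtopologies[OF hom])
    have "topspace (subtopology S A) \<inter> B = B" using assms(2,3) by auto
    moreover have "topspace (subtopology M (\<iota> ` A)) \<inter> \<iota> ` B = \<iota> ` B"
      using image_mono[OF assms(2), of \<iota>] unfolding topspace_subtopology surj[symmetric] by blast
    ultimately show "\<iota> ` (topspace (subtopology S A) \<inter> B) = topspace (subtopology M (\<iota> ` A)) \<inter> \<iota> ` B"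
      by (simp only:)
  qed
  moreover have "subtopology (subtopology S A) B = subtopology S B"
    "subtopology (subtopology M (\<iota> ` A)) (\<iota> ` B) = subtopology M (\<iota> ` B)"
    using assms(2) by (simp_all add: subtopology_subtopology inf.absorb2 image_mono)
  moreover have "topspace S \<inter> B = B" using assms by blast
  ultimately show ?thesis by (simp add: embedded_on_def embedding_map_def)
qed

text \<open>An injective immersion need not have a continuous inverse, but its restriction to an
  embedded segment does. This turns translates of the curve back into curves in
  \<open>S\<close>.\<close>

lemma embedded_on_inverse_continuous:
  assumes emb: "embedded_on M S \<iota> A" and A: "A \<subseteq> topspace S"
    and f: "continuous_map X M f" "\<And>x. x \<in> topspace X \<Longrightarrow> f x \<in> \<iota> ` A"
  shows "continuous_map X S (\<lambda>x. inv_into A \<iota> (f x))"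
proof -
  have hom: "homeomorphic_map (subtopology S A) (subtopology M (\<iota> ` A)) \<iota>"
    using emb A by (simp add: embedded_on_def embedding_map_def inf.absorb2)
  then have inj: "inj_on \<iota> A"
    using homeomorphic_imp_injective_map A by (fastforce simp: inf.absorb2)
  from hom obtain h where h: "homeomorphic_maps (subtopology S A) (subtopology M (\<iota> ` A)) \<iota> h"
    unfolding homeomorphic_map_maps by blast
  have "continuous_map X (subtopology M (\<iota> ` A)) f"
    using f by (auto simp: continuous_map_in_subtopology)
  then have "continuous_map X (subtopology S A) (h \<circ> f)"
    using h continuous_map_compose unfolding homeomorphic_maps_def by blast
  then have "continuous_map X S (h \<circ> f)" by (simp add: continuous_map_in_subtopology)
  then show ?thesis
  proof (rule continuous_map_eq)
    fix x assume "x \<in> topspace X"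
    then have "f x \<in> \<iota> ` A" by (rule f(2))
    then obtain s where s: "f x = \<iota> s" "s \<in> A" by (rule imageE)
    then have "h (\<iota> s) = s" using h A by (auto simp: homeomorphic_maps_def)
    then show "(h \<circ> f) x = inv_into A \<iota> (f x)"
      using s inj by (simp add: inv_into_f_f)
  qed
qed

lemma coset_class_memD:
  assumes G: "group G" and "H = submanifold_stabilizer G \<phi> S \<iota>" "H \<subseteq> carrier G"
    and a: "a \<in> carrier G" and x: "x \<in> coset_class G \<phi> S \<iota> a"
  shows "x \<in> carrier G" "inv\<^bsub>G\<^esub> a \<otimes>\<^bsub>G\<^esub> x \<in> H"
proof -
  interpret group G by (rule G)
  obtain h where h: "h \<in> H" "x = a \<otimes>\<^bsub>G\<^esub> h"
    using x assms(2) unfolding coset_class_def l_coset_def by blast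
  then show "x \<in> carrier G" "inv\<^bsub>G\<^esub> a \<otimes>\<^bsub>G\<^esub> x \<in> H"
    using a assms(3) by (auto simp: m_assoc[symmetric] subset_iff)
qed

context analytic_action
begin

sublocale group G
  using group_hom by (simp add: group_hom_def)

lemma \<phi>_closed: "g \<in> carrier G \<Longrightarrow> p \<in> topspace M \<Longrightarrow> \<phi> g p \<in> topspace M"
  using element_image by blast

lemma \<phi>_inv: "g \<in> carrier G \<Longrightarrow> p \<in> topspace M \<Longrightarrow> \<phi> (inv\<^bsub>G\<^esub> g) (\<phi> g p) = p"
  using orbit_sym_aux by blast

lemma \<phi>_inv': "g \<in> carrier G \<Longrightarrow> p \<in> topspace M \<Longrightarrow> \<phi> g (\<phi> (inv\<^bsub>G\<^esub> g) p) = p"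
  using \<phi>_inv[of "inv\<^bsub>G\<^esub> g" p] by simp

lemma \<phi>_one: "p \<in> topspace M \<Longrightarrow> \<phi> \<one>\<^bsub>G\<^esub> p = p"
  using id_eq_one by (metis restrict_apply')

lemma \<phi>_cancel: "g \<in> carrier G \<Longrightarrow> p \<in> topspace M \<Longrightarrow> q \<in> topspace M \<Longrightarrow> \<phi> g p = \<phi> g q \<longleftrightarrow> p = q"
  using \<phi>_inv by metis

lemma \<phi>_image_inv:
  assumes "g \<in> carrier G" "A \<subseteq> topspace S" "A' \<subseteq> topspace S" "\<phi> g ` \<iota> ` A = \<iota> ` A'"
  shows "\<phi> (inv\<^bsub>G\<^esub> g) ` \<iota> ` A' = \<iota> ` A"
proof -
  have "\<phi> (inv\<^bsub>G\<^esub> g) ` \<phi> g ` \<iota> ` A = \<iota> ` A"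
    using \<phi>_inv[OF assms(1) \<iota>_closed] assms(2) by (force simp: image_image image_iff)
  then show ?thesis by (simp add: assms(4))
qed

lemma compact_embedded:
  assumes "compactin S A"
  shows "embedded_on M S \<iota> A"
  unfolding embedded_on_def
proof (rule continuous_imp_embedding_map)
  show "continuous_map (subtopology S A) M \<iota>"
    by (rule continuous_map_from_subtopology[OF \<iota>_continuous])
  show "compact_space (subtopology S A)" using assms by (simp add: compact_space_subtopology)
  show "inj_on \<iota> (topspace (subtopology S A))" using \<iota>_inj by (auto simp: inj_on_def)
qed (rule M_Hausdorff)

lemma line_chart_translate_continuous:
  assumes "line_chart S J k" "X \<subseteq> J" "g \<in> carrier G"
  shows "continuous_map (top_of_set X) M (\<lambda>s. \<phi> g (\<iota> (k s)))"
proof -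
  have "continuous_map (top_of_set J) M (\<phi> g \<circ> (\<iota> \<circ> k))"
    using assms line_chart_continuous \<iota>_continuous \<phi>_continuous
    by (intro continuous_map_compose[OF continuous_map_compose]) auto
  then have "continuous_map (subtopology (top_of_set J) X) M (\<lambda>s. \<phi> g (\<iota> (k s)))"
    unfolding o_def by (rule continuous_map_from_subtopology)
  then show ?thesis using assms(2) by (simp add: subtopology_subtopology inf.absorb2)
qed

text \<open>Near \<open>x\<close> the map \<open>g\<close> sends one side of the curve \<open>\<iota>\<close> into \<open>\<iota>\<close>; by analyticity it sends a
  full neighbourhood of \<open>x\<close> into \<open>\<iota>\<close>.\<close>

lemma continuation:
  assumes g: "g \<in> carrier G" and x: "x \<in> line_points S" and y: "y \<in> line_points S"
    and A: "segment S A" "x \<in> A" and A': "A' \<subseteq> topspace S" "embedded_on M S \<iota> A'" "y \<in> A'"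
    and gA: "\<phi> g ` \<iota> ` A \<subseteq> \<iota> ` A'" and gx: "\<phi> g (\<iota> x) = \<iota> y"
    and N: "openin S N" "y \<in> N"
  obtains W where "openin S W" "x \<in> W" "\<phi> g ` \<iota> ` W \<subseteq> \<iota> ` N"
proof -
  obtain k s0 e1 where k: "analytic_parameter k s0 e1" "k s0 = x"
    using x by (rule analytic_parameter_at)
  obtain k' t0 e2 where k': "analytic_parameter k' t0 e2" "k' t0 = y"
    using y by (rule analytic_parameter_at)
  have ytop: "y \<in> topspace S" by (rule subsetD[OF line_points_subset y])
  obtain V \<psi> where V: "(V, \<psi>) \<in> AM" "\<iota> y \<in> V"
    using M_chart[OF \<iota>_closed[OF ytop]] .
  note Vp = M_chart_props[OF V(1)]
  obtain d1 \<alpha> where d1: "0 < d1" "d1 \<le> e1" and \<alpha>: "\<And>j. j < m \<Longrightarrow> \<alpha> j holomorphic_on ball (of_real s0) d1"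
    and \<alpha>V: "\<And>s. \<bar>s - s0\<bar> < d1 \<Longrightarrow> \<phi> g (\<iota> (k s)) \<in> V"
    and \<alpha>r: "\<And>j s. j < m \<Longrightarrow> \<bar>s - s0\<bar> < d1 \<Longrightarrow> \<alpha> j (of_real s) = of_real (\<psi> (\<phi> g (\<iota> (k s))) j)"
    using analytic_translated_curve[OF g k(1) V(1)] gx V(2) k(2) by metis
  obtain d2 \<beta> where d2: "0 < d2" "d2 \<le> e2" and \<beta>: "\<And>j. j < m \<Longrightarrow> \<beta> j holomorphic_on ball (of_real t0) d2"
    and \<beta>V: "\<And>t. \<bar>t - t0\<bar> < d2 \<Longrightarrow> \<iota> (k' t) \<in> V"
    and \<beta>r: "\<And>j t. j < m \<Longrightarrow> \<bar>t - t0\<bar> < d2 \<Longrightarrow> \<beta> j (of_real t) = of_real (\<psi> (\<iota> (k' t)) j)"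
    and imm: "\<exists>j<m. deriv (\<beta> j) (of_real t0) \<noteq> 0"
    using analytic_curve[OF k'(1) V(1)] V(2) k'(2) by metis
  obtain i where i: "i < m" "deriv (\<beta> i) (of_real t0) \<noteq> 0" using imm by blast
  define e where "e = min d1 d2"
  have e: "0 < e" "e \<le> d1" "e \<le> d2" using d1 d2 by (auto simp: e_def)
  define I where "I = {s0 - e<..<s0 + e}"
  define J where "J = {t0 - e<..<t0 + e}"
  have memI: "s \<in> I \<longleftrightarrow> \<bar>s - s0\<bar> < e" for s by (auto simp: I_def abs_if)
  have memJ: "t \<in> J \<longleftrightarrow> \<bar>t - t0\<bar> < e" for t by (auto simp: J_def abs_if)
  have cI: "line_chart S I k"
    by (rule line_chart_restrict[where J = "{s0 - e1<..<s0 + e1}"])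
      (use k d1 e in \<open>auto simp: analytic_parameter_def I_def is_interval_oo\<close>)
  have cJ: "line_chart S J k'"
    by (rule line_chart_restrict[where J = "{t0 - e2<..<t0 + e2}"])
      (use k' d2 e in \<open>auto simp: analytic_parameter_def J_def is_interval_oo\<close>)
  have s0I: "s0 \<in> I" and t0J: "t0 \<in> J" using e by (auto simp: memI memJ)
  define Z0 where "Z0 = {s\<in>I. k s \<in> A}"
  \<comment> \<open>\<open>u s\<close> is the point of \<open>A'\<close> that \<open>g\<close>
    reaches from \<open>k s\<close>. Its continuity rests on \<open>A'\<close> being
    embedded.\<close>
  define u where "u = (\<lambda>s. inv_into A' \<iota> (\<phi> g (\<iota> (k s))))"
  have inA': "\<phi> g (\<iota> (k s)) \<in> \<iota> ` A'" if "s \<in> Z0" for s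
    using gA that by (auto simp: Z0_def)
  have \<iota>u: "\<iota> (u s) = \<phi> g (\<iota> (k s))" if "s \<in> Z0" for s
    unfolding u_def by (rule f_inv_into_f[OF inA'[OF that]])
  have us0: "u s0 = y"
    using inv_into_f_f[OF inj_on_subset[OF \<iota>_inj A'(1)] A'(3)] by (simp add: u_def k gx)
  have ucont: "continuous_map (top_of_set Z0) S u"
    unfolding u_def
    by (intro embedded_on_inverse_continuous[OF A'(2,1)] line_chart_translate_continuous[OF cI _ g])
      (use inA' in \<open>auto simp: Z0_def\<close>)
  have opJ: "openin S (k' ` J)" using cJ by (simp add: line_chart_def)
  have "openin (top_of_set Z0) {s \<in> Z0. u s \<in> k' ` J}"
    using openin_continuous_map_preimage[OF ucont opJ] by simp
  then obtain O1 where O1: "open O1" "{s \<in> Z0. u s \<in> k' ` J} = Z0 \<inter> O1"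
    by (auto simp: openin_open)
  \<comment> \<open>\<open>Z\<close> keeps the parameters for which \<open>u s\<close> lies in the
    chart around \<open>y\<close>, so that \<open>t\<close> can be defined. This is an open
    condition satisfied at \<open>s0\<close>, hence \<open>s0\<close> remains an accumulation
    point.\<close>
  define Z where "Z = Z0 \<inter> O1"
  have Z: "s \<in> Z \<longleftrightarrow> s \<in> Z0 \<and> u s \<in> k' ` J" for s
    unfolding Z_def O1(2)[symmetric] by blast
  have s0Z: "s0 \<in> Z"
  proof -
    have "u s0 \<in> k' ` J" using imageI[OF t0J, of k'] by (simp only: us0 k'(2))
    moreover have "s0 \<in> Z0" using s0I A(2) k(2) by (simp add: Z0_def)
    ultimately show ?thesis by (simp only: Z simp_thms)
  qed
  \<comment> \<open>Only one side of \<open>s0\<close> is known to belong to \<open>Z0\<close>; for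
    an accumulation point that is enough.\<close>
  have "s0 islimpt Z0"
  proof -
    obtain r where r: "r > 0" "{s0 - r..s0 + r} \<subseteq> I" "k ` {s0..s0 + r} \<subseteq> A \<or> k ` {s0 - r..s0} \<subseteq> A"
      by (rule segment_side[OF S_Hausdorff cI s0I A(1)]) (simp add: k(2) A(2))
    from r(3) have "{s0..s0 + r} \<subseteq> Z0 \<or> {s0 - r..s0} \<subseteq> Z0"
    proof
      assume "k ` {s0..s0 + r} \<subseteq> A"
      moreover have "{s0..s0 + r} \<subseteq> {s0 - r..s0 + r}" using r(1) by auto
      ultimately show ?thesis using r(2) unfolding Z0_def by blast
    next
      assume "k ` {s0 - r..s0} \<subseteq> A"
      moreover have "{s0 - r..s0} \<subseteq> {s0 - r..s0 + r}" using r(1) by auto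
      ultimately show ?thesis using r(2) unfolding Z0_def by blast
    qed
    moreover have "s0 islimpt {s0..s0 + r}" "s0 islimpt {s0 - r..s0}"
      using r(1) by (simp_all add: islimpt_Icc)
    ultimately show ?thesis by (meson islimpt_subset)
  qed
  then have lim: "s0 islimpt Z"
    unfolding islimpt_def
  proof (intro allI impI)
    fix X assume "s0 \<in> X" "open X"
    then have "s0 \<in> X \<inter> O1" "open (X \<inter> O1)" using s0Z O1(1) by (auto simp: Z_def)
    then have "\<exists>y\<in>Z0. y \<in> X \<inter> O1 \<and> y \<noteq> s0"
      using \<open>s0 islimpt Z0\<close> unfolding islimpt_def by blast
    then show "\<exists>y\<in>Z. y \<in> X \<and> y \<noteq> s0" unfolding Z_def by blast
  qed
  define t where "t = (\<lambda>s. inv_into J k' (u s))"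
  have ts0: "t s0 = t0"
    using inv_into_f_f[OF line_chart_inj[OF cJ] t0J] by (simp add: t_def us0 k'(2))
  have kt: "t s \<in> J" "k' (t s) = u s" if "s \<in> Z" for s
    using that unfolding t_def Z by (auto intro: inv_into_into f_inv_into_f)
  have "continuous_map (subtopology (top_of_set Z0) Z) S u"
    by (rule continuous_map_from_subtopology[OF ucont])
  then have "continuous_map (top_of_set Z) S u"
    by (simp add: subtopology_subtopology Z_def inf.absorb2)
  then have "continuous_map (top_of_set Z) (top_of_set J) t"
    unfolding t_def by (rule line_chart_inverse_continuous[OF cJ]) (auto simp: Z)
  then have "continuous_on Z t" by (simp add: continuous_map_in_subtopology)
  then have tt: "(t \<longlongrightarrow> t0) (at s0 within Z)"
    using s0Z ts0 by (auto simp: continuous_on_def)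
  obtain T where T: "continuous (at s0) T" "T s0 = t0"
    "\<forall>\<^sub>F s in at s0. \<forall>j<m. \<alpha> j (of_real s) = \<beta> j (of_real (T s))"
  proof (rule analytic_curve_continuation[where m = m and \<alpha> = \<alpha> and \<beta> = \<beta> and t = t and i = i and e = e and Z = Z and ?s0.0 = s0 and ?t0.0 = t0])
    show "\<alpha> j holomorphic_on ball (of_real s0) e" if "j < m" for j
      by (rule holomorphic_on_subset[OF \<alpha>[OF that] subset_ball[OF e(2)]])
    show "\<beta> j holomorphic_on ball (of_real t0) e" if "j < m" for j
      by (rule holomorphic_on_subset[OF \<beta>[OF that] subset_ball[OF e(3)]])
    show "\<alpha> j (of_real s) = \<beta> j (of_real (t s))" if "s \<in> Z" "\<bar>s - s0\<bar> < e" "j < m" for s j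
    proof -
      have "\<bar>t s - t0\<bar> < d2" using kt(1)[OF that(1)] e(3) by (simp add: memJ)
      then show ?thesis
        using \<alpha>r[OF that(3)] \<beta>r[OF that(3)] that(2) e(2) \<iota>u[of s] kt(2)[OF that(1)] that(1) by (simp add: Z)
    qed
  qed (use e i lim s0Z ts0 tt in auto)
  have "open {t\<in>J. k' t \<in> N}" by (rule line_chart_vimage_open[OF cJ N(1)])
  moreover have "T s0 \<in> {t\<in>J. k' t \<in> N}" using t0J N(2) k'(2) T(2) by simp
  ultimately have "\<forall>\<^sub>F s in at s0. T s \<in> {t\<in>J. k' t \<in> N}"
    using T(1) unfolding continuous_at by (rule topological_tendstoD[rotated])
  with T(3) have "\<forall>\<^sub>F s in at s0. (\<forall>j<m. \<alpha> j (of_real s) = \<beta> j (of_real (T s))) \<and> T s \<in> J \<and> k' (T s) \<in> N"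
    by (auto elim: eventually_elim2)
  then obtain d where d: "d > 0" "\<And>s. s \<noteq> s0 \<Longrightarrow> dist s s0 < d \<Longrightarrow>
      (\<forall>j<m. \<alpha> j (of_real s) = \<beta> j (of_real (T s))) \<and> T s \<in> J \<and> k' (T s) \<in> N"
    unfolding eventually_at by blast
  have main: "\<phi> g (\<iota> (k s)) \<in> \<iota> ` N" if s: "\<bar>s - s0\<bar> < min d e" for s
  proof (cases "s = s0")
    case True
    then show ?thesis using N(2) gx k(2) by auto
  next
    case False
    then have h: "\<And>j. j < m \<Longrightarrow> \<alpha> j (of_real s) = \<beta> j (of_real (T s))" "T s \<in> J" "k' (T s) \<in> N"
      using d(2)[of s] s by (auto simp: dist_real_def)
    have sd: "\<bar>s - s0\<bar> < d1" "\<bar>T s - t0\<bar> < d2" using s e h(2) by (auto simp: memJ)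
    \<comment> \<open>Injectivity of \<open>\<psi>\<close> needs equality of whole sequences;
      coordinates from \<open>m\<close> on vanish in \<open>Euclidean_space m\<close>.\<close>
    have "\<psi> (\<phi> g (\<iota> (k s))) j = \<psi> (\<iota> (k' (T s))) j" for j
    proof (cases "j < m")
      case True
      have "complex_of_real (\<psi> (\<phi> g (\<iota> (k s))) j) = of_real (\<psi> (\<iota> (k' (T s))) j)"
        using h(1)[OF True] \<alpha>r[OF True sd(1)] \<beta>r[OF True sd(2)] by simp
      then show ?thesis by simp
    next
      case False
      have "\<psi> (\<phi> g (\<iota> (k s))) \<in> topspace (Euclidean_space m)" "\<psi> (\<iota> (k' (T s))) \<in> topspace (Euclidean_space m)"
        using Vp(3) \<alpha>V[OF sd(1)] \<beta>V[OF sd(2)] by blast+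
      then show ?thesis using False by (simp add: topspace_Euclidean_space)
    qed
    then have "\<psi> (\<phi> g (\<iota> (k s))) = \<psi> (\<iota> (k' (T s)))" by (rule ext)
    then have "\<phi> g (\<iota> (k s)) = \<iota> (k' (T s))"
      by (rule inj_onD[OF Vp(2) _ \<alpha>V[OF sd(1)] \<beta>V[OF sd(2)]])
    then show ?thesis using h(3) by blast
  qed
  define r where "r = min d e"
  have r: "r > 0" "{s0 - r<..<s0 + r} \<subseteq> I" using d e by (auto simp: r_def I_def)
  show thesis
  proof
    show "openin S (k ` {s0 - r<..<s0 + r})"
      by (rule line_chart_image_open[OF cI r(2)]) simp
    show "x \<in> k ` {s0 - r<..<s0 + r}" using k(2) r(1) by auto
    show "\<phi> g ` \<iota> ` k ` {s0 - r<..<s0 + r} \<subseteq> \<iota> ` N"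
    proof clarify
      fix s assume "s \<in> {s0 - r<..<s0 + r}"
      then have "\<bar>s - s0\<bar> < r" by (auto simp: abs_less_iff)
      then have "\<bar>s - s0\<bar> < min d e" by (simp only: r_def)
      then show "\<phi> g (\<iota> (k s)) \<in> \<iota> ` N" by (rule main)
    qed
  qed
qed

end

subsection \<open>The stabilizer of a free segment\<close>

locale free_segment_action = analytic_action G M \<phi> m AM S AS \<iota>
  for G :: "('g, 'r) monoid_scheme" and M :: "'m topology" and \<phi> m AM
    and S :: "'s topology" and AS \<iota> +
  fixes \<Sigma> :: "'s set"
  assumes free: "\<Sigma> \<in> free_segments G \<phi> M S \<iota>"
    and compact: "compactin S \<Sigma>"
    and line: "\<Sigma> \<subseteq> line_points S"
begin

abbreviation H :: "'g set" where "H \<equiv> submanifold_stabilizer G \<phi> S \<iota>"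

lemma \<Sigma>_segment: "segment S \<Sigma>"
  using free by (simp add: free_segments_def)

lemma \<Sigma>_subset: "\<Sigma> \<subseteq> topspace S"
  by (rule segment_subset[OF \<Sigma>_segment])

lemma \<Sigma>_embedded: "embedded_on M S \<iota> \<Sigma>"
  by (rule compact_embedded[OF compact])

lemma topspace_nonempty: "topspace S \<noteq> {}"
  using \<Sigma>_segment \<Sigma>_subset by (auto simp: segment_def)

lemma H_iff: "h \<in> H \<longleftrightarrow> h \<in> carrier G \<and> (\<forall>z\<in>topspace S. \<phi> h (\<iota> z) = \<iota> z)"
proof -
  obtain z where "z \<in> topspace S" using topspace_nonempty by (metis ex_in_conv)
  then show ?thesis unfolding submanifold_stabilizer_def stabilizer_def by blast
qed

lemma H_carrier: "H \<subseteq> carrier G"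
  using H_iff by blast

lemma H_fixes: "h \<in> H \<Longrightarrow> z \<in> topspace S \<Longrightarrow> \<phi> h (\<iota> z) = \<iota> z"
  using H_iff by blast

lemma H_one: "\<one>\<^bsub>G\<^esub> \<in> H"
  by (simp add: H_iff \<phi>_one \<iota>_closed)

lemma H_mult: "a \<in> H \<Longrightarrow> b \<in> H \<Longrightarrow> a \<otimes>\<^bsub>G\<^esub> b \<in> H"
  by (simp add: H_iff composition_rule \<iota>_closed)

lemma H_inv: "a \<in> H \<Longrightarrow> inv\<^bsub>G\<^esub> a \<in> H"
  unfolding H_iff using \<phi>_inv[OF _ \<iota>_closed, of a] by fastforce

lemma coset_class_eqI:
  assumes "a \<in> carrier G" "b \<in> carrier G" "inv\<^bsub>G\<^esub> a \<otimes>\<^bsub>G\<^esub> b \<in> H"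
  shows "coset_class G \<phi> S \<iota> a = coset_class G \<phi> S \<iota> b"
proof -
  have sub: "subgroup H G"
    by (rule subgroupI) (use H_carrier H_one H_inv H_mult in auto)
  have "b \<in> a <#\<^bsub>G\<^esub> H"
  proof -
    have "a \<otimes>\<^bsub>G\<^esub> (inv\<^bsub>G\<^esub> a \<otimes>\<^bsub>G\<^esub> b) = b" using assms by (simp add: m_assoc[symmetric])
    then show ?thesis using assms(3) unfolding l_coset_def by force
  qed
  then show ?thesis unfolding coset_class_def by (rule l_repr_independence[OF _ assms(1) sub])
qed

lemma coset_class_self: "a \<in> carrier G \<Longrightarrow> a \<in> coset_class G \<phi> S \<iota> a"
  unfolding coset_class_def l_coset_def using H_one by force

lemmas coset_classD = coset_class_memD[OF is_group refl H_carrier]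

lemma \<Sigma>_inverse:
  assumes "p \<in> \<iota> ` \<Sigma>"
  shows "inv_into \<Sigma> \<iota> p \<in> \<Sigma>" "\<iota> (inv_into \<Sigma> \<iota> p) = p"
  using assms by (rule inv_into_into, rule f_inv_into_f)

text \<open>The charted piece may lie anywhere on the curve; \<open>a\<close> moves it into
  \<Sigma>. Since \<Sigma> consists of line points, invariance of domain makes the pulled-back piece
  open in \<open>S\<close>, as \<open>overlaps\<close> demands.\<close>

lemma \<Sigma>_translate_open:
  assumes k: "line_chart S J k" "J \<noteq> {}" and a: "a \<in> carrier G"
    and sub: "\<And>s. s \<in> J \<Longrightarrow> \<phi> a (\<iota> (k s)) \<in> \<iota> ` \<Sigma>"
  defines "U \<equiv> (\<lambda>s. inv_into \<Sigma> \<iota> (\<phi> a (\<iota> (k s)))) ` J"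
  shows "segment S U" "openin S U" "U \<subseteq> \<Sigma>" "embedded_on M S \<iota> U"
    "\<iota> ` U = (\<lambda>s. \<phi> a (\<iota> (k s))) ` J"
proof -
  let ?v = "\<lambda>s. inv_into \<Sigma> \<iota> (\<phi> a (\<iota> (k s)))"
  have J: "open J" "is_interval J" using k(1) by (auto simp: line_chart_def)
  have cont: "continuous_map (top_of_set J) S ?v"
    by (intro embedded_on_inverse_continuous[OF \<Sigma>_embedded \<Sigma>_subset]
        line_chart_translate_continuous[OF k(1) order_refl a]) (simp add: sub)
  show U: "U \<subseteq> \<Sigma>" using \<Sigma>_inverse(1)[OF sub] by (auto simp: U_def)
  show "\<iota> ` U = (\<lambda>s. \<phi> a (\<iota> (k s))) ` J"
    unfolding U_def image_image by (rule image_cong[OF refl]) (rule \<Sigma>_inverse(2)[OF sub])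
  have inj: "inj_on ?v J"
  proof (rule inj_onI)
    fix s t assume st: "s \<in> J" "t \<in> J" "?v s = ?v t"
    have kst: "k s \<in> topspace S" "k t \<in> topspace S"
      using line_chart_subset[OF k(1)] st by auto
    have "\<phi> a (\<iota> (k s)) = \<iota> (?v s)" by (rule \<Sigma>_inverse(2)[OF sub[OF st(1)], symmetric])
    also have "\<dots> = \<iota> (?v t)" by (rule arg_cong[OF st(3)])
    also have "\<dots> = \<phi> a (\<iota> (k t))" by (rule \<Sigma>_inverse(2)[OF sub[OF st(2)]])
    finally have "\<phi> a (\<iota> (k s)) = \<phi> a (\<iota> (k t))" .
    then have "\<iota> (k s) = \<iota> (k t)" using \<phi>_cancel[OF a \<iota>_closed[OF kst(1)] \<iota>_closed[OF kst(2)]] by simp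
    then have "k s = k t" using \<iota>_inj kst by (auto dest: inj_onD)
    then show "s = t" using line_chart_inj[OF k(1)] st by (auto dest: inj_onD)
  qed
  show "openin S U"
    unfolding U_def by (rule openin_image_line_points[OF J(1) cont inj]) (use U line in \<open>auto simp: U_def\<close>)
  show "embedded_on M S \<iota> U" by (rule embedded_on_subset[OF \<Sigma>_embedded U \<Sigma>_subset])
  show "segment S U"
    unfolding segment_def
  proof
    have "connectedin (top_of_set J) J" using J(2) by (simp add: connectedin_subtopology is_interval_connected)
    then show "connectedin S U" unfolding U_def by (rule connectedin_continuous_map_image[OF cont])
    obtain s where s: "s \<in> J" using k(2) by blast
    then obtain e where "e > 0" "ball s e \<subseteq> J" using J(1) open_contains_ball by blast
    moreover from this(1) have "s + e/2 \<in> ball s e" by (simp add: dist_real_def)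
    ultimately have t: "s + e/2 \<in> J" "s + e/2 \<noteq> s" by auto
    then have "?v s \<noteq> ?v (s + e/2)" using inj_onD[OF inj _ s t(1)] by auto
    then show "\<exists>x\<in>U. \<exists>y\<in>U. x \<noteq> y" unfolding U_def using s t(1) by blast
  qed
qed

text \<open>Freeness in the form used throughout: going back along \<open>a\<close> and forth along
  \<open>b\<close> carries one open segment of \<Sigma> onto another, which is an overlap of
  \<Sigma> with itself.\<close>

lemma stabilizer_of_chart:
  assumes k: "line_chart S J k" "J \<noteq> {}" and a: "a \<in> carrier G" and b: "b \<in> carrier G"
    and suba: "\<And>s. s \<in> J \<Longrightarrow> \<phi> a (\<iota> (k s)) \<in> \<iota> ` \<Sigma>"
    and subb: "\<And>s. s \<in> J \<Longrightarrow> \<phi> b (\<iota> (k s)) \<in> \<iota> ` \<Sigma>"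
  shows "b \<otimes>\<^bsub>G\<^esub> inv\<^bsub>G\<^esub> a \<in> H"
proof -
  define U where "U = (\<lambda>s. inv_into \<Sigma> \<iota> (\<phi> a (\<iota> (k s)))) ` J"
  define V where "V = (\<lambda>s. inv_into \<Sigma> \<iota> (\<phi> b (\<iota> (k s)))) ` J"
  note U = \<Sigma>_translate_open[OF k a suba, folded U_def]
  note V = \<Sigma>_translate_open[OF k b subb, folded V_def]
  let ?c = "b \<otimes>\<^bsub>G\<^esub> inv\<^bsub>G\<^esub> a"
  have c: "?c \<in> carrier G" using a b by simp
  have cs: "\<phi> ?c (\<phi> a (\<iota> (k s))) = \<phi> b (\<iota> (k s))" if "s \<in> J" for s
  proof -
    have "k s \<in> topspace S" using line_chart_subset[OF k(1)] that by blast
    then have p: "\<iota> (k s) \<in> topspace M" by (rule \<iota>_closed)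
    then show ?thesis using a b \<phi>_closed[OF a p] by (simp add: composition_rule \<phi>_inv)
  qed
  have "\<phi> ?c ` \<iota> ` U = \<phi> ?c ` (\<lambda>s. \<phi> a (\<iota> (k s))) ` J" by (simp only: U(5))
  also have "\<dots> = (\<lambda>s. \<phi> b (\<iota> (k s))) ` J" unfolding image_image using cs by (rule image_cong[OF refl])
  also have "\<dots> = \<iota> ` V" by (simp only: V(5))
  finally have "overlaps \<phi> M S \<iota> ?c \<Sigma> \<Sigma>"
    unfolding overlaps_def using U(1-4) V(1-4) by blast
  then show ?thesis using free c by (simp add: free_segments_def)
qed

text \<open>A segment need not be open, but it contains an open piece beside \<open>x\<close>, to
  which the chart version applies.\<close>

lemma stabilizer_of_segment:
  assumes B: "segment S B" "x \<in> B" "x \<in> line_points S" and a: "a \<in> carrier G" and b: "b \<in> carrier G"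
    and suba: "\<phi> a ` \<iota> ` B \<subseteq> \<iota> ` \<Sigma>" and subb: "\<phi> b ` \<iota> ` B \<subseteq> \<iota> ` \<Sigma>"
  shows "b \<otimes>\<^bsub>G\<^esub> inv\<^bsub>G\<^esub> a \<in> H"
proof -
  have "x \<in> topspace S" by (rule subsetD[OF line_points_subset B(3)])
  then obtain J k s0 e where k: "line_chart S J k" "k s0 = x" "e > 0" "{s0..s0 + e} \<subseteq> J"
    "k ` {s0..s0 + e} \<subseteq> B \<inter> topspace S" "k ` {s0<..s0 + e} \<inter> {} = {}"
    by (rule segment_piece[OF S_Hausdorff B(3,1,2) openin_topspace _ finite.emptyI])
  have sub: "{s0<..<s0 + e} \<subseteq> {s0..s0 + e}" by auto
  have kB: "k s \<in> B" if "s \<in> {s0<..<s0 + e}" for s using that sub k(5) by blast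
  have "line_chart S {s0<..<s0 + e} k"
    by (rule line_chart_restrict[OF k(1)]) (use sub k(4) in \<open>auto simp: is_interval_oo\<close>)
  then show ?thesis
    by (rule stabilizer_of_chart) (use kB suba subb a b k(3) in auto)
qed

text \<open>Replaces normality of \<open>H\<close>. As \<open>a\<close> keeps \<open>T\<close> on
  the curve and \<open>h\<close> fixes the curve pointwise, the conjugate fixes \<open>T\<close>
  pointwise; freeness promotes this to membership in \<open>H\<close>.\<close>

lemma conjugate_stabilizer:
  assumes T: "segment S T" "T \<subseteq> \<Sigma>" and a: "a \<in> carrier G" "\<phi> a ` \<iota> ` T \<subseteq> \<iota> ` topspace S" and h: "h \<in> H"
  shows "inv\<^bsub>G\<^esub> a \<otimes>\<^bsub>G\<^esub> h \<otimes>\<^bsub>G\<^esub> a \<in> H"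
proof -
  obtain x where x: "x \<in> T" using T(1) by (auto simp: segment_def)
  have hc: "h \<in> carrier G" using h H_carrier by blast
  have hfix: "\<phi> (inv\<^bsub>G\<^esub> a \<otimes>\<^bsub>G\<^esub> h \<otimes>\<^bsub>G\<^esub> a) (\<iota> t) = \<iota> t" if "t \<in> T" for t
  proof -
    have p: "\<iota> t \<in> topspace M" using that T(2) \<Sigma>_subset \<iota>_closed by blast
    have "\<phi> a (\<iota> t) \<in> \<iota> ` topspace S" using a(2) that by blast
    then have "\<phi> h (\<phi> a (\<iota> t)) = \<phi> a (\<iota> t)" using H_fixes[OF h] by auto
    then show ?thesis using a(1) hc p \<phi>_closed[OF a(1) p] \<phi>_closed[OF hc]
      by (simp add: composition_rule m_assoc \<phi>_inv)
  qed
  have "(inv\<^bsub>G\<^esub> a \<otimes>\<^bsub>G\<^esub> h \<otimes>\<^bsub>G\<^esub> a) \<otimes>\<^bsub>G\<^esub> inv\<^bsub>G\<^esub> \<one>\<^bsub>G\<^esub> \<in> H"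
  proof (rule stabilizer_of_segment[OF T(1) x])
    show "x \<in> line_points S" using x T(2) line by blast
    show "\<phi> \<one>\<^bsub>G\<^esub> ` \<iota> ` T \<subseteq> \<iota> ` \<Sigma>"
      using T(2) \<Sigma>_subset \<phi>_one[OF \<iota>_closed] by fastforce
    show "\<phi> (inv\<^bsub>G\<^esub> a \<otimes>\<^bsub>G\<^esub> h \<otimes>\<^bsub>G\<^esub> a) ` \<iota> ` T \<subseteq> \<iota> ` \<Sigma>"
      using hfix T(2) by auto
  qed (use a hc in auto)
  then show ?thesis using a hc by simp
qed

text \<open>\<open>g\<close> carries the side \<open>A\<close> of \<open>x\<close> onto the side \<open>A'\<close> of \<open>y\<close>; being injective, it carries the
  other side \<open>B\<close> into \<open>B'\<close> near \<open>x\<close>. The elements \<open>a\<close> and \<open>b\<close> bring \<open>B\<close> and \<open>B'\<close> back to \<open>\<Sigma>\<close>.\<close>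

lemma stabilizer_of_crossing:
  assumes g: "g \<in> carrier G" and x: "x \<in> line_points S" and y: "y \<in> line_points S" and gx: "\<phi> g (\<iota> x) = \<iota> y"
    and A: "segment S A" "x \<in> A" and A': "segment S A'" "y \<in> A'" "embedded_on M S \<iota> A'"
    and gA: "\<phi> g ` \<iota> ` A = \<iota> ` A'"
    and B: "segment S B" "x \<in> B" "finite (A \<inter> B)" and B': "segment S B'" "y \<in> B'" "finite (A' \<inter> B')"
    and a: "a \<in> carrier G" "\<phi> a ` \<iota> ` B \<subseteq> \<iota> ` \<Sigma>" and b: "b \<in> carrier G" "\<phi> b ` \<iota> ` B' \<subseteq> \<iota> ` \<Sigma>"
  shows "b \<otimes>\<^bsub>G\<^esub> g \<otimes>\<^bsub>G\<^esub> inv\<^bsub>G\<^esub> a \<in> H"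
proof -
  have Atop: "A \<subseteq> topspace S" "A' \<subseteq> topspace S" "B' \<subseteq> topspace S"
    using A(1) A'(1) B'(1) segment_subset by auto
  have yint: "y \<in> S interior_of (A' \<union> B')"
    by (rule segments_nbhd[OF S_Hausdorff y A'(1,2) B'(1,2,3)])
  obtain W where W: "openin S W" "x \<in> W" "\<phi> g ` \<iota> ` W \<subseteq> \<iota> ` (S interior_of (A' \<union> B'))"
    by (rule continuation[OF g x y A Atop(2) A'(3,2) eq_refl[OF gA] gx openin_interior_of yint])
  obtain J k s0 e where k: "line_chart S J k" "k s0 = x" "e > 0" "{s0..s0 + e} \<subseteq> J"
    "k ` {s0..s0 + e} \<subseteq> B \<inter> W" "k ` {s0<..s0 + e} \<inter> (A \<inter> B) = {}"
    by (rule segment_piece[OF S_Hausdorff x B(1,2) W(1,2) B(3)])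
  have sub: "{s0<..<s0 + e} \<subseteq> {s0..s0 + e}" "{s0<..<s0 + e} \<subseteq> {s0<..s0 + e}" by auto
  have kB: "k s \<in> B" "k s \<in> W" "k s \<notin> A" if "s \<in> {s0<..<s0 + e}" for s
  proof -
    show "k s \<in> B" "k s \<in> W" using that sub k(5) by blast+
    then show "k s \<notin> A" using that sub(2) k(6) by blast
  qed
  have Wtop: "W \<subseteq> topspace S" by (rule openin_subset[OF W(1)])
  have inB': "\<phi> g (\<iota> (k s)) \<in> \<iota> ` B'" if s: "s \<in> {s0<..<s0 + e}" for s
  proof -
    have "\<phi> g (\<iota> (k s)) \<in> \<iota> ` (S interior_of (A' \<union> B'))" using W(3) kB(2)[OF s] by blast
    then have "\<phi> g (\<iota> (k s)) \<in> \<iota> ` (A' \<union> B')" by (rule subsetD[OF image_mono[OF interior_of_subset]])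
    then obtain u where u: "\<phi> g (\<iota> (k s)) = \<iota> u" "u \<in> A' \<union> B'" by (rule imageE)
    have "u \<notin> A'"
    proof
      assume "u \<in> A'"
      then have "\<phi> g (\<iota> (k s)) \<in> \<phi> g ` \<iota> ` A" unfolding gA u(1) by (rule imageI)
      then obtain t where t: "t \<in> A" "\<phi> g (\<iota> (k s)) = \<phi> g (\<iota> t)" by blast
      have "t \<in> topspace S" "k s \<in> topspace S" using t(1) Atop(1) kB(2)[OF s] Wtop by blast+
      then have "t = k s"
        using t(2) \<phi>_cancel[OF g \<iota>_closed[OF \<open>k s \<in> topspace S\<close>] \<iota>_closed[OF \<open>t \<in> topspace S\<close>]]
          inj_onD[OF \<iota>_inj, of t "k s"] by simp
      then show False using t(1) kB(3)[OF s] by blast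
    qed
    then show ?thesis using u by blast
  qed
  have "line_chart S {s0<..<s0 + e} k"
    by (rule line_chart_restrict[OF k(1)]) (use sub k(4) in \<open>auto simp: is_interval_oo\<close>)
  then show ?thesis
  proof (rule stabilizer_of_chart)
    show "\<phi> a (\<iota> (k s)) \<in> \<iota> ` \<Sigma>" if "s \<in> {s0<..<s0 + e}" for s using a(2) kB(1)[OF that] by blast
    show "\<phi> (b \<otimes>\<^bsub>G\<^esub> g) (\<iota> (k s)) \<in> \<iota> ` \<Sigma>" if s: "s \<in> {s0<..<s0 + e}" for s
    proof -
      have "\<iota> (k s) \<in> topspace M" by (rule \<iota>_closed[OF subsetD[OF Wtop kB(2)[OF s]]])
      then have "\<phi> (b \<otimes>\<^bsub>G\<^esub> g) (\<iota> (k s)) = \<phi> b (\<phi> g (\<iota> (k s)))" by (rule composition_rule[OF _ b(1) g])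
      then show ?thesis using b(2) inB'[OF s] by auto
    qed
  qed (use k(3) a(1) b(1) g in auto)
qed


lemma mult_inv_cancel:
  "x \<in> carrier G \<Longrightarrow> y \<in> carrier G \<Longrightarrow> x \<otimes>\<^bsub>G\<^esub> (inv\<^bsub>G\<^esub> x \<otimes>\<^bsub>G\<^esub> y) = y"
  by (simp add: m_assoc[symmetric])

lemma segment_infinite:
  assumes "segment S B" "x \<in> B" "x \<in> line_points S"
  shows "infinite B"
proof
  assume "finite B"
  \<comment> \<open>Three copies of \<open>B\<close> would then meet at \<open>x\<close> with finite
    pairwise intersections.\<close>
  then have "finite (B \<inter> B)" by simp
  then show False using segments_at_point[OF S_Hausdorff assms(3) assms(1,2) assms(1,2) assms(1,2)] by blast
qed

text \<open>Otherwise the inverse of \<open>g\<close> would force a neighbourhood of \<open>y\<close> into \<open>A'\<close>, leaving no room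
  for \<open>B'\<close>.\<close>

lemma joint_preimage_boundary:
  assumes g: "g \<in> carrier G" and w: "w \<in> \<Sigma>" and y: "y \<in> line_points S" and gw: "\<phi> g (\<iota> w) = \<iota> y"
    and gA: "\<phi> g ` \<iota> ` \<Sigma> = \<iota> ` A'" and A': "segment S A'" "y \<in> A'"
    and B': "segment S B'" "y \<in> B'" "finite (A' \<inter> B')"
  shows "w \<notin> S interior_of \<Sigma>"
proof
  assume wint: "w \<in> S interior_of \<Sigma>"
  have A'top: "A' \<subseteq> topspace S" by (rule segment_subset[OF A'(1)])
  have wtop: "w \<in> topspace S" using w \<Sigma>_subset by blast
  have gi: "inv\<^bsub>G\<^esub> g \<in> carrier G" using g by simp
  have giy: "\<phi> (inv\<^bsub>G\<^esub> g) (\<iota> y) = \<iota> w"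
    using \<phi>_inv[OF g \<iota>_closed[OF wtop]] by (simp add: gw)
  have giA: "\<phi> (inv\<^bsub>G\<^esub> g) ` \<iota> ` A' = \<iota> ` \<Sigma>" by (rule \<phi>_image_inv[OF g \<Sigma>_subset A'top gA])
  obtain W where W: "openin S W" "y \<in> W" "\<phi> (inv\<^bsub>G\<^esub> g) ` \<iota> ` W \<subseteq> \<iota> ` (S interior_of \<Sigma>)"
    by (rule continuation[OF gi y subsetD[OF line w] A' \<Sigma>_subset \<Sigma>_embedded w eq_refl[OF giA] giy openin_interior_of wint])
  have "W \<subseteq> A'"
  proof
    fix u assume u: "u \<in> W"
    then have ut: "u \<in> topspace S" using openin_subset[OF W(1)] by blast
    have "\<phi> (inv\<^bsub>G\<^esub> g) (\<iota> u) \<in> \<iota> ` (S interior_of \<Sigma>)" using W(3) u by blast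
    then have "\<phi> (inv\<^bsub>G\<^esub> g) (\<iota> u) \<in> \<iota> ` \<Sigma>" by (rule subsetD[OF image_mono[OF interior_of_subset]])
    then have "\<phi> (inv\<^bsub>G\<^esub> g) (\<iota> u) \<in> \<phi> (inv\<^bsub>G\<^esub> g) ` \<iota> ` A'" by (simp only: giA)
    then obtain v where v: "v \<in> A'" "\<phi> (inv\<^bsub>G\<^esub> g) (\<iota> u) = \<phi> (inv\<^bsub>G\<^esub> g) (\<iota> v)" by blast
    then have vt: "v \<in> topspace S" using A'top by blast
    have "\<iota> u = \<iota> v" using v(2) \<phi>_cancel[OF gi \<iota>_closed[OF ut] \<iota>_closed[OF vt]] by simp
    then have "u = v" by (rule inj_onD[OF \<iota>_inj _ ut vt])
    then show "u \<in> A'" using v(1) by simp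
  qed
  obtain J k s0 e where k: "line_chart S J k" "k s0 = y" "e > 0" "{s0..s0 + e} \<subseteq> J"
    "k ` {s0..s0 + e} \<subseteq> B' \<inter> W" "k ` {s0<..s0 + e} \<inter> (A' \<inter> B') = {}"
    by (rule segment_piece[OF S_Hausdorff y B'(1,2) W(1,2) B'(3)])
  have "s0 + e \<in> {s0..s0 + e}" "s0 + e \<in> {s0<..s0 + e}" using k(3) by auto
  then have "k (s0 + e) \<in> B' \<inter> W" "k (s0 + e) \<notin> A' \<inter> B'" using k(5,6) by blast+
  then show False using \<open>W \<subseteq> A'\<close> by blast
qed

section \<open>Powers along a chain of adjacent segments\<close>

text \<open>\<open>zm\<close> and \<open>z 0\<close> are the boundary points of \<Sigma>, and
  \<open>z k\<close> is a joint of \<open>T k\<close> and \<open>T (Suc k)\<close>. The induction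
  carries a second claim, that \<open>gs k\<close> sends \<open>zm\<close> to the earlier joint
  \<open>z (k - 1)\<close>; this fixes the orientation. \<open>full\<close> stops short of
  \<open>N\<close> because the last segment of an interval may be the image of a mere part of
  \<Sigma>.\<close>

lemma chain:
  fixes T :: "nat \<Rightarrow> 's set" and gs :: "nat \<Rightarrow> 'g" and z :: "nat \<Rightarrow> 's"
  assumes T0: "T 0 = \<Sigma>" and g: "g \<in> carrier G" "gs 1 = g"
    and gs: "\<And>k. k \<le> N \<Longrightarrow> gs k \<in> carrier G"
    and seg: "\<And>k. k \<le> N \<Longrightarrow> segment S (T k)" and emb: "\<And>k. k \<le> N \<Longrightarrow> embedded_on M S \<iota> (T k)"
    and full: "\<And>k. k < N \<Longrightarrow> \<phi> (gs k) ` \<iota> ` \<Sigma> = \<iota> ` T k"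
    and part: "\<And>k. k \<le> N \<Longrightarrow> \<exists>T'. segment S T' \<and> T' \<subseteq> \<Sigma> \<and> \<phi> (gs k) ` \<iota> ` T' = \<iota> ` T k"
    and z: "\<And>k. k < N \<Longrightarrow> z k \<in> T k" "\<And>k. k < N \<Longrightarrow> z k \<in> T (Suc k)" "\<And>k. k < N \<Longrightarrow> z k \<in> line_points S"
    and fin: "\<And>k. k < N \<Longrightarrow> finite (T k \<inter> T (Suc k))"
    and zz: "\<And>k. Suc k < N \<Longrightarrow> z k \<noteq> z (Suc k)"
    and zm: "zm \<in> \<Sigma>" "\<phi> g (\<iota> zm) = \<iota> (z 0)"
    and bd: "\<Sigma> - S interior_of \<Sigma> \<subseteq> {zm, z 0}"
    and k: "1 \<le> k" "k \<le> N"
  shows "inv\<^bsub>G\<^esub> (gs k) \<otimes>\<^bsub>G\<^esub> g [^]\<^bsub>G\<^esub> k \<in> H"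
proof -
  have z0: "z 0 \<in> \<Sigma>" using z(1)[of 0] k T0 by simp
  have Ttop: "T k \<subseteq> topspace S" if "k \<le> N" for k using segment_subset[OF seg[OF that]] .
  have pull: "\<phi> (inv\<^bsub>G\<^esub> (gs k)) ` \<iota> ` T k \<subseteq> \<iota> ` \<Sigma>" if k: "k \<le> N" for k
  proof -
    obtain T' where T': "T' \<subseteq> \<Sigma>" "\<phi> (gs k) ` \<iota> ` T' = \<iota> ` T k" using part[OF k] by blast
    have "\<phi> (inv\<^bsub>G\<^esub> (gs k)) ` \<iota> ` T k = \<iota> ` T'"
      by (rule \<phi>_image_inv[OF gs[OF k] _ Ttop[OF k] T'(2)]) (use T'(1) \<Sigma>_subset in blast)
    then show ?thesis using T'(1) by blast
  qed
  have conj: "inv\<^bsub>G\<^esub> g \<otimes>\<^bsub>G\<^esub> h \<otimes>\<^bsub>G\<^esub> g \<in> H" if "h \<in> H" for h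
  proof -
    have N: "1 \<le> N" using k by simp
    obtain T' where T': "segment S T'" "T' \<subseteq> \<Sigma>" "\<phi> (gs 1) ` \<iota> ` T' = \<iota> ` T 1" using part[OF N] by blast
    have "\<phi> g ` \<iota> ` T' \<subseteq> \<iota> ` topspace S" unfolding T'(3)[unfolded g(2)] by (rule image_mono[OF Ttop[OF N]])
    then show ?thesis by (rule conjugate_stabilizer[OF T'(1,2) g(1) _ that])
  qed
  \<comment> \<open>The preimage of \<open>z k\<close> is a boundary point of \<Sigma>. It is not
    \<open>zm\<close>, which goes to the different joint \<open>z (k - 1)\<close>; so it is
    \<open>z 0\<close>.\<close>
  have next_joint: "\<phi> (gs k) (\<iota> (z 0)) = \<iota> (z k)"
    if k: "1 \<le> k" "k < N" and prev: "\<phi> (gs k) (\<iota> zm) = \<iota> (z (k - 1))" for k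
  proof -
    have "\<iota> (z k) \<in> \<phi> (gs k) ` \<iota> ` \<Sigma>" unfolding full[OF k(2)] by (rule imageI[OF z(1)[OF k(2)]])
    then obtain w where w: "w \<in> \<Sigma>" "\<phi> (gs k) (\<iota> w) = \<iota> (z k)" by auto
    have kN: "k \<le> N" "Suc k \<le> N" using k by auto
    have "w \<notin> S interior_of \<Sigma>"
      by (rule joint_preimage_boundary[OF gs[OF kN(1)] w(1) z(3)[OF k(2)] w(2) full[OF k(2)]
            seg[OF kN(1)] z(1)[OF k(2)] seg[OF kN(2)] z(2)[OF k(2)] fin[OF k(2)]])
    then have "w = zm \<or> w = z 0" using bd w(1) by blast
    moreover have "w \<noteq> zm"
    proof
      assume "w = zm"
      then have "\<iota> (z k) = \<iota> (z (k - 1))" using w(2) prev by simp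
      moreover have "z k \<in> topspace S" "z (k - 1) \<in> topspace S"
        using subsetD[OF line_points_subset z(3)] k by auto
      ultimately have "z k = z (k - 1)" by (rule inj_onD[OF \<iota>_inj])
      then show False using zz[of "k - 1"] k by simp
    qed
    ultimately show ?thesis using w(2) by simp
  qed
  have main: "inv\<^bsub>G\<^esub> (gs k) \<otimes>\<^bsub>G\<^esub> g [^]\<^bsub>G\<^esub> k \<in> H \<and> \<phi> (gs k) (\<iota> zm) = \<iota> (z (k - 1))"
    if "1 \<le> k" "k \<le> N" for k
    using that
  proof (induction k rule: nat_induct_at_least)
    case base
    then show ?case using g zm H_one by simp
  next
    case (Suc k)
    then have k: "1 \<le> k" "k < N" "k \<le> N" "Suc k \<le> N" by auto
    have IH: "inv\<^bsub>G\<^esub> (gs k) \<otimes>\<^bsub>G\<^esub> g [^]\<^bsub>G\<^esub> k \<in> H" "\<phi> (gs k) (\<iota> zm) = \<iota> (z (k - 1))"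
      using Suc.IH k by auto
    have gz: "\<phi> (gs k) (\<iota> (z 0)) = \<iota> (z k)" by (rule next_joint[OF k(1,2) IH(2)])
    have N: "0 < N" "1 \<le> N" using k by auto
    note gk = gs[OF k(3)] gs[OF k(4)]
    have ginv: "inv\<^bsub>G\<^esub> g \<in> carrier G" "inv\<^bsub>G\<^esub> (gs (Suc k)) \<in> carrier G" using g gk by auto
    have T1: "segment S (T 1)" "z 0 \<in> T 1" "finite (\<Sigma> \<inter> T 1)" "\<phi> (inv\<^bsub>G\<^esub> g) ` \<iota> ` T 1 \<subseteq> \<iota> ` \<Sigma>"
      using seg[OF N(2)] z(2)[OF N(1)] fin[OF N(1)] T0 pull[OF N(2)] g(2) by simp_all
    \<comment> \<open>The crossing from \<Sigma> to \<open>T 1\<close> at \<open>z 0\<close> is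
      matched with the crossing from \<open>T k\<close> to \<open>T (Suc k)\<close> at
      \<open>z k\<close>; the inverses of \<open>g\<close> and \<open>gs (Suc k)\<close> bring the
      far sides back into \<Sigma>.\<close>
    have q: "inv\<^bsub>G\<^esub> (gs (Suc k)) \<otimes>\<^bsub>G\<^esub> gs k \<otimes>\<^bsub>G\<^esub> inv\<^bsub>G\<^esub> (inv\<^bsub>G\<^esub> g) \<in> H"
      by (rule stabilizer_of_crossing[OF gk(1) z(3)[OF N(1)] z(3)[OF k(2)] gz \<Sigma>_segment z0
            seg[OF k(3)] z(1)[OF k(2)] emb[OF k(3)] full[OF k(2)] T1(1-3) seg[OF k(4)] z(2)[OF k(2)]
            fin[OF k(2)] ginv(1) T1(4) ginv(2) pull[OF k(4)]])
    define q where "q = inv\<^bsub>G\<^esub> (gs (Suc k)) \<otimes>\<^bsub>G\<^esub> gs k \<otimes>\<^bsub>G\<^esub> g"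
    have qH: "q \<in> H" using q g by (simp add: q_def)
    have gk': "g [^]\<^bsub>G\<^esub> k \<in> carrier G" using g by simp
    \<comment> \<open>The factor known from the induction hypothesis ends up between the inverse of
      \<open>g\<close> and \<open>g\<close>, where \<open>conj\<close> absorbs it.\<close>
    have "inv\<^bsub>G\<^esub> (gs (Suc k)) \<otimes>\<^bsub>G\<^esub> g [^]\<^bsub>G\<^esub> Suc k =
        q \<otimes>\<^bsub>G\<^esub> (inv\<^bsub>G\<^esub> g \<otimes>\<^bsub>G\<^esub> (inv\<^bsub>G\<^esub> (gs k) \<otimes>\<^bsub>G\<^esub> g [^]\<^bsub>G\<^esub> k) \<otimes>\<^bsub>G\<^esub> g)"
      using g(1) gk gk' ginv unfolding q_def by (simp add: m_assoc mult_inv_cancel)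
    then have 1: "inv\<^bsub>G\<^esub> (gs (Suc k)) \<otimes>\<^bsub>G\<^esub> g [^]\<^bsub>G\<^esub> Suc k \<in> H"
      using H_mult[OF qH conj[OF IH(1)]] by (simp only:)
    have zmt: "zm \<in> topspace S" using zm(1) \<Sigma>_subset by blast
    have p: "\<iota> zm \<in> topspace M" by (rule \<iota>_closed[OF zmt])
    have qc: "q \<in> carrier G" using qH H_carrier by blast
    have "gs (Suc k) \<otimes>\<^bsub>G\<^esub> q = gs k \<otimes>\<^bsub>G\<^esub> g"
      using g(1) gk by (simp add: q_def m_assoc mult_inv_cancel)
    then have "\<phi> (gs (Suc k)) (\<phi> q (\<iota> zm)) = \<phi> (gs k) (\<phi> g (\<iota> zm))"
      using composition_rule[OF p gk(2) qc] composition_rule[OF p gk(1) g(1)] by simp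
    then have "\<phi> (gs (Suc k)) (\<iota> zm) = \<iota> (z k)"
      using H_fixes[OF qH zmt] zm(2) gz by simp
    then show ?case using 1 by simp
  qed
  show ?thesis using main[OF k] by blast
qed

section \<open>Positivity and the transition class\<close>

text \<open>The two segments attached at \<open>z\<close> both occupy the side opposite to \<Sigma>,
  so they share a piece near \<open>z\<close>, which the inverses of \<open>g\<close> and
  \<open>g'\<close> carry into \<Sigma>. This gives the uniqueness behind the definite description
  in \<open>transition_class\<close>.\<close>

lemma transition_unique:
  assumes z: "z \<in> line_points S" and t: "transition_at G \<phi> M S \<iota> \<Sigma> z g" "transition_at G \<phi> M S \<iota> \<Sigma> z g'"
    and g: "g \<in> carrier G" "g' \<in> carrier G"
  shows "inv\<^bsub>G\<^esub> g \<otimes>\<^bsub>G\<^esub> g' \<in> H"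
proof -
  have pre: "\<exists>T. segment S T \<and> \<Sigma> \<inter> T = {z} \<and> \<phi> (inv\<^bsub>G\<^esub> g) ` \<iota> ` T \<subseteq> \<iota> ` \<Sigma>"
    if t: "transition_at G \<phi> M S \<iota> \<Sigma> z g" and g: "g \<in> carrier G" for g
  proof -
    obtain \<Sigma>b T where T: "\<Sigma>b \<subseteq> \<Sigma>" "T \<in> free_segments G \<phi> M S \<iota>" "\<Sigma> \<inter> T = {z}" "\<phi> g ` \<iota> ` \<Sigma>b = \<iota> ` T"
      using t unfolding transition_at_def by blast
    then have segT: "segment S T" by (simp add: free_segments_def)
    have "\<phi> (inv\<^bsub>G\<^esub> g) ` \<iota> ` T = \<iota> ` \<Sigma>b"
      by (rule \<phi>_image_inv[OF g order_trans[OF T(1) \<Sigma>_subset] segment_subset[OF segT] T(4)])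
    then show ?thesis using segT T(1,3) by blast
  qed
  obtain T where T: "segment S T" "\<Sigma> \<inter> T = {z}" "\<phi> (inv\<^bsub>G\<^esub> g) ` \<iota> ` T \<subseteq> \<iota> ` \<Sigma>"
    using pre[OF t(1) g(1)] by blast
  obtain T' where T': "segment S T'" "\<Sigma> \<inter> T' = {z}" "\<phi> (inv\<^bsub>G\<^esub> g') ` \<iota> ` T' \<subseteq> \<iota> ` \<Sigma>"
    using pre[OF t(2) g(2)] by blast
  have zin: "z \<in> \<Sigma>" "z \<in> T" "z \<in> T'" using T(2) T'(2) by auto
  have "finite (\<Sigma> \<inter> T)" "finite (\<Sigma> \<inter> T')" using T(2) T'(2) by auto
  have "z \<in> S interior_of (\<Sigma> \<union> T)"
    by (rule segments_nbhd[OF S_Hausdorff z \<Sigma>_segment zin(1) T(1) zin(2)]) fact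
  then obtain J k s0 e where k: "line_chart S J k" "k s0 = z" "e > 0" "{s0..s0 + e} \<subseteq> J"
    "k ` {s0..s0 + e} \<subseteq> T' \<inter> S interior_of (\<Sigma> \<union> T)" "k ` {s0<..s0 + e} \<inter> (\<Sigma> \<inter> T') = {}"
    by (rule segment_piece[OF S_Hausdorff z T'(1) zin(3) openin_interior_of _ \<open>finite (\<Sigma> \<inter> T')\<close>])
  have kT: "k s \<in> T \<and> k s \<in> T'" if s: "s \<in> {s0<..<s0 + e}" for s
  proof -
    have "s \<in> {s0..s0 + e}" "s \<in> {s0<..s0 + e}" using s by auto
    then have "k s \<in> T'" "k s \<in> S interior_of (\<Sigma> \<union> T)" "k s \<notin> \<Sigma> \<inter> T'" using k(5,6) by blast+
    moreover from this(2) have "k s \<in> \<Sigma> \<union> T" by (rule subsetD[OF interior_of_subset])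
    ultimately show ?thesis by blast
  qed
  have sub: "{s0<..<s0 + e} \<subseteq> {s0..s0 + e}" by auto
  have "line_chart S {s0<..<s0 + e} k"
    by (rule line_chart_restrict[OF k(1)]) (use sub k(4) in \<open>auto simp: is_interval_oo\<close>)
  then have "inv\<^bsub>G\<^esub> g \<otimes>\<^bsub>G\<^esub> inv\<^bsub>G\<^esub> (inv\<^bsub>G\<^esub> g') \<in> H"
  proof (rule stabilizer_of_chart)
    show "\<phi> (inv\<^bsub>G\<^esub> g') (\<iota> (k s)) \<in> \<iota> ` \<Sigma>" if "s \<in> {s0<..<s0 + e}" for s using T'(3) kT[OF that] by blast
    show "\<phi> (inv\<^bsub>G\<^esub> g) (\<iota> (k s)) \<in> \<iota> ` \<Sigma>" if "s \<in> {s0<..<s0 + e}" for s using T(3) kT[OF that] by blast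
  qed (use k(3) g in auto)
  then show ?thesis using g by simp
qed


text \<open>Positivity speaks about the class picked by \<open>transition_class\<close>; the work is
  to show that a given \<open>g\<close> attaching \<open>T1\<close> to \<Sigma> at \<open>z\<close>
  represents it. Allowing a part \<open>T\<close> of \<Sigma> covers a neighbour that is the last
  segment of an interval.\<close>

lemma transition_moves:
  assumes CI: "circle_like S \<or> interval_like S"
    and pos: "positive_segment G \<phi> M S \<iota> \<Sigma>"
    and g: "g \<in> carrier G" and T: "segment S T" "T \<subseteq> \<Sigma>" and T1: "segment S T1" "embedded_on M S \<iota> T1"
    and gT: "\<phi> g ` \<iota> ` T = \<iota> ` T1" and fin: "finite (\<Sigma> \<inter> T1)"
    and z: "z \<in> T1" "z \<in> seg_boundary S \<Sigma>" "z \<in> seg_interior S (topspace S)"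
  obtains b where "b \<in> T" "b \<notin> S interior_of \<Sigma>" "\<phi> g (\<iota> b) = \<iota> z" "b \<noteq> z"
proof -
  have z\<Sigma>: "z \<in> \<Sigma>" using z(2) by (simp add: seg_boundary_def)
  have zl: "z \<in> line_points S" using z\<Sigma> line by blast
  have T1top: "T1 \<subseteq> topspace S" by (rule segment_subset[OF T1(1)])
  have Ttop: "T \<subseteq> topspace S" by (rule segment_subset[OF T(1)])
  have gi: "inv\<^bsub>G\<^esub> g \<in> carrier G" using g by simp
  have giT1: "\<phi> (inv\<^bsub>G\<^esub> g) ` \<iota> ` T1 = \<iota> ` T" by (rule \<phi>_image_inv[OF g Ttop T1top gT])
  have giT1\<Sigma>: "\<phi> (inv\<^bsub>G\<^esub> g) ` \<iota> ` T1 \<subseteq> \<iota> ` \<Sigma>" unfolding giT1 by (rule image_mono[OF T(2)])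
  \<comment> \<open>An element of \<open>H\<close> would leave \<open>T\<close> in place, so
    \<open>T1 = T\<close> would lie in \<Sigma> and the intersection would be infinite.\<close>
  have gH: "g \<notin> H"
  proof
    assume "g \<in> H"
    then have "\<phi> g (\<iota> u) = \<iota> u" if "u \<in> T" for u using H_fixes Ttop that by blast
    then have "\<iota> ` T = \<iota> ` T1" using gT by (auto simp: image_image)
    then have "T1 = T" using inj_on_image_eq_iff[OF \<iota>_inj Ttop T1top] by simp
    then have "\<Sigma> \<inter> T1 = T1" using T(2) by blast
    then show False using fin segment_infinite[OF T1(1) z(1) zl] by simp
  qed
  obtain b where b: "b \<in> T" "\<phi> g (\<iota> b) = \<iota> z"
  proof -
    have "\<iota> z \<in> \<phi> g ` \<iota> ` T" unfolding gT by (rule imageI[OF z(1)])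
    then show thesis using that by auto
  qed
  have bS: "b \<in> \<Sigma>" using b(1) T(2) by blast
  have btop: "b \<in> topspace S" using bS \<Sigma>_subset by blast
  have giz: "\<phi> (inv\<^bsub>G\<^esub> g) (\<iota> z) = \<iota> b" using \<phi>_inv[OF g \<iota>_closed[OF btop]] by (simp add: b(2))
  \<comment> \<open>If \<open>b\<close> were interior, the inverse of \<open>g\<close> would carry a
    whole neighbourhood of \<open>z\<close> into \<Sigma>, in particular a piece of \<Sigma> itself,
    and freeness would put \<open>g\<close> into \<open>H\<close>.\<close>
  have bint: "b \<notin> S interior_of \<Sigma>"
  proof
    assume bi: "b \<in> S interior_of \<Sigma>"
    obtain W where W: "openin S W" "z \<in> W" "\<phi> (inv\<^bsub>G\<^esub> g) ` \<iota> ` W \<subseteq> \<iota> ` (S interior_of \<Sigma>)"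
      by (rule continuation[OF gi zl subsetD[OF line bS] T1(1) z(1) \<Sigma>_subset \<Sigma>_embedded bS giT1\<Sigma> giz openin_interior_of bi])
    obtain J k s0 e where k: "line_chart S J k" "k s0 = z" "e > 0" "{s0..s0 + e} \<subseteq> J"
      "k ` {s0..s0 + e} \<subseteq> \<Sigma> \<inter> W" "k ` {s0<..s0 + e} \<inter> {} = {}"
      by (rule segment_piece[OF S_Hausdorff zl \<Sigma>_segment z\<Sigma> W(1,2) finite.emptyI])
    let ?P = "k ` {s0..s0 + e}"
    have P: "segment S ?P" using line_chart_segment[OF k(1,4)] k(3) by simp
    have zP: "z \<in> ?P" using k(2,3) by (intro image_eqI[of _ _ s0]) auto
    have P\<Sigma>: "?P \<subseteq> \<Sigma>" "?P \<subseteq> W" using k(5) by auto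
    have "inv\<^bsub>G\<^esub> g \<otimes>\<^bsub>G\<^esub> inv\<^bsub>G\<^esub> \<one>\<^bsub>G\<^esub> \<in> H"
    proof (rule stabilizer_of_segment[OF P zP zl one_closed gi])
      show "\<phi> \<one>\<^bsub>G\<^esub> ` \<iota> ` ?P \<subseteq> \<iota> ` \<Sigma>"
      proof clarify
        fix s assume "s \<in> {s0..s0 + e}"
        then have "k s \<in> \<Sigma>" using P\<Sigma>(1) by blast
        then show "\<phi> \<one>\<^bsub>G\<^esub> (\<iota> (k s)) \<in> \<iota> ` \<Sigma>"
          using \<phi>_one[OF \<iota>_closed[OF subsetD[OF \<Sigma>_subset]]] by simp
      qed
      have "\<phi> (inv\<^bsub>G\<^esub> g) ` \<iota> ` ?P \<subseteq> \<phi> (inv\<^bsub>G\<^esub> g) ` \<iota> ` W" using P\<Sigma>(2) by blast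
      then show "\<phi> (inv\<^bsub>G\<^esub> g) ` \<iota> ` ?P \<subseteq> \<iota> ` \<Sigma>"
        using order_trans[OF W(3) image_mono[OF interior_of_subset]] by (rule order_trans)
    qed
    then have "inv\<^bsub>G\<^esub> g \<in> H" using gi by simp
    then have "inv\<^bsub>G\<^esub> (inv\<^bsub>G\<^esub> g) \<in> H" by (rule H_inv)
    then show False using gH g by simp
  qed
  have seg_int: "seg_interior S A = S interior_of A \<inter> seg_interior S (topspace S)" if "A \<subseteq> topspace S" for A
    by (rule seg_interior_eq[OF CI that])
  have bbd: "b \<in> seg_boundary S \<Sigma>"
    using bS bint seg_int[OF \<Sigma>_subset] by (simp add: seg_boundary_def)
  obtain J k s0 e where k: "line_chart S J k" "k s0 = z" "e > 0" "{s0..s0 + e} \<subseteq> J"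
    "k ` {s0..s0 + e} \<subseteq> T1 \<inter> topspace S" "k ` {s0<..s0 + e} \<inter> (\<Sigma> \<inter> T1) = {}"
    by (rule segment_piece[OF S_Hausdorff zl T1(1) z(1) openin_topspace subsetD[OF T1top z(1)] fin])
  \<comment> \<open>\<open>transition_at\<close> asks for a compact free segment meeting \<Sigma> in
    \<open>z\<close> alone. \<open>T1\<close> is not assumed compact, so a short closed piece of it
    at \<open>z\<close> is used; \<open>Tb\<close> below is the preimage of this piece in
    \<open>T\<close>.\<close>
  define Tz where "Tz = k ` {s0..s0 + e}"
  have Tz: "segment S Tz" "compactin S Tz"
    using line_chart_segment[OF k(1,4)] k(3) by (simp_all add: Tz_def)
  have zTz: "z \<in> Tz" unfolding Tz_def using k(2,3) by (intro image_eqI[of _ _ s0]) auto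
  have TzT1: "Tz \<subseteq> T1" using k(5) by (auto simp: Tz_def)
  have int: "\<Sigma> \<inter> Tz = {z}"
  proof -
    have "u = z" if u: "u \<in> \<Sigma>" "u \<in> Tz" for u
    proof -
      obtain s where s: "s \<in> {s0..s0 + e}" "u = k s" using u(2) by (auto simp: Tz_def)
      have "s \<notin> {s0<..s0 + e}"
      proof
        assume "s \<in> {s0<..s0 + e}"
        then have "u \<notin> \<Sigma> \<inter> T1" using k(6) s(2) by blast
        then show False using u TzT1 by blast
      qed
      then have "s = s0" using s(1) by auto
      then show ?thesis using s(2) k(2) by simp
    qed
    then show ?thesis using z\<Sigma> zTz by blast
  qed
  have giTz: "\<phi> (inv\<^bsub>G\<^esub> g) (\<iota> u) \<in> \<iota> ` T" if "u \<in> Tz" for u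
    using giT1 TzT1 that by blast
  let ?w = "\<lambda>u. inv_into \<Sigma> \<iota> (\<phi> (inv\<^bsub>G\<^esub> g) (\<iota> u))"
  define Tb where "Tb = ?w ` Tz"
  have w: "?w u \<in> T" "\<iota> (?w u) = \<phi> (inv\<^bsub>G\<^esub> g) (\<iota> u)" if "u \<in> Tz" for u
  proof -
    obtain t where t: "t \<in> T" "\<phi> (inv\<^bsub>G\<^esub> g) (\<iota> u) = \<iota> t" using giTz[OF \<open>u \<in> Tz\<close>] by auto
    have "?w u = t"
      using inv_into_f_f[OF inj_on_subset[OF \<iota>_inj \<Sigma>_subset] subsetD[OF T(2) t(1)]] by (simp only: t(2))
    then show "?w u \<in> T" "\<iota> (?w u) = \<phi> (inv\<^bsub>G\<^esub> g) (\<iota> u)" using t by simp_all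
  qed
  have gw: "\<phi> g (\<iota> (?w u)) = \<iota> u" if "u \<in> Tz" for u
    unfolding w(2)[OF that] using \<phi>_inv'[OF g \<iota>_closed] TzT1 T1top that by blast
  have gTb: "\<phi> g ` \<iota> ` Tb = \<iota> ` Tz"
    unfolding Tb_def image_image by (rule image_cong[OF refl]) (rule gw)
  have TbT: "Tb \<subseteq> T" using w(1) by (auto simp: Tb_def)
  have "continuous_map (subtopology S Tz) M (\<phi> (inv\<^bsub>G\<^esub> g) \<circ> \<iota>)"
    by (rule continuous_map_compose[OF continuous_map_from_subtopology[OF \<iota>_continuous] \<phi>_continuous[OF gi]])
  then have "continuous_map (subtopology S Tz) M (\<lambda>u. \<phi> (inv\<^bsub>G\<^esub> g) (\<iota> u))" by (simp only: o_def)
  then have wcont: "continuous_map (subtopology S Tz) S ?w"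
  proof (rule embedded_on_inverse_continuous[OF \<Sigma>_embedded \<Sigma>_subset])
    fix u assume "u \<in> topspace (subtopology S Tz)"
    then have "u \<in> Tz" by simp
    then show "\<phi> (inv\<^bsub>G\<^esub> g) (\<iota> u) \<in> \<iota> ` \<Sigma>" by (rule subsetD[OF image_mono[OF T(2)] giTz])
  qed
  have Tb: "segment S Tb" "compactin S Tb"
  proof -
    have cTz: "connectedin (subtopology S Tz) Tz" "compactin (subtopology S Tz) Tz"
      using Tz by (auto simp: connectedin_subtopology compactin_subtopology segment_def)
    have Tb': "connectedin S Tb" "compactin S Tb"
      unfolding Tb_def
      by (rule connectedin_continuous_map_image[OF wcont cTz(1)], rule image_compactin[OF cTz(2) wcont])
    obtain u v where uv: "u \<in> Tz" "v \<in> Tz" "u \<noteq> v"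
      using Tz(1) unfolding segment_def by (elim conjE bexE)
    have "?w u \<noteq> ?w v"
    proof
      assume eq: "?w u = ?w v"
      have "\<iota> u = \<phi> g (\<iota> (?w u))" by (rule gw[OF uv(1), symmetric])
      also have "\<dots> = \<phi> g (\<iota> (?w v))" by (rule arg_cong[OF eq])
      also have "\<dots> = \<iota> v" by (rule gw[OF uv(2)])
      finally have "\<iota> u = \<iota> v" .
      moreover have "u \<in> topspace S" "v \<in> topspace S" using uv TzT1 T1top by auto
      ultimately have "u = v" by (rule inj_onD[OF \<iota>_inj])
      then show False using uv(3) by simp
    qed
    moreover have "?w u \<in> Tb" "?w v \<in> Tb" 
      unfolding Tb_def by (rule imageI[OF uv(1)], rule imageI[OF uv(2)])
    ultimately have "\<exists>x\<in>Tb. \<exists>y\<in>Tb. x \<noteq> y" by (intro bexI)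
    with Tb' show "segment S Tb" "compactin S Tb" unfolding segment_def by simp_all
  qed
  have wz: "?w z = b"
    using inv_into_f_f[OF inj_on_subset[OF \<iota>_inj \<Sigma>_subset] bS] by (simp only: giz)
  have bTb: "b \<in> Tb" unfolding Tb_def using imageI[OF zTz, of ?w] by (simp only: wz)
  have TbS: "Tb \<subseteq> \<Sigma>" using TbT T(2) by blast
  have bbd': "b \<in> seg_boundary S Tb"
  proof -
    have "S interior_of Tb \<subseteq> S interior_of \<Sigma>" by (rule interior_of_mono[OF TbS])
    then have "b \<notin> seg_interior S Tb"
      using bint seg_int[OF order_trans[OF TbS \<Sigma>_subset]] by blast
    then show ?thesis using bTb by (simp add: seg_boundary_def)
  qed
  \<comment> \<open>Were \<open>z\<close> interior to \<open>Tz\<close>, points of \<Sigma> next to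
    \<open>z\<close> would lie in \<open>Tz\<close> as well.\<close>
  have zbd: "z \<in> seg_boundary S Tz"
  proof -
    have "z \<notin> S interior_of Tz"
    proof
      assume zi: "z \<in> S interior_of Tz"
      obtain J' k' r0 d where k': "line_chart S J' k'" "k' r0 = z" "d > 0" "{r0..r0 + d} \<subseteq> J'"
        "k' ` {r0..r0 + d} \<subseteq> \<Sigma> \<inter> S interior_of Tz" "k' ` {r0<..r0 + d} \<inter> {z} = {}"
        by (rule segment_piece[OF S_Hausdorff zl \<Sigma>_segment z\<Sigma> openin_interior_of zi, of "{z}"]) auto
      have "r0 + d \<in> {r0..r0 + d}" "r0 + d \<in> {r0<..r0 + d}" using k'(3) by auto
      then have "k' (r0 + d) \<in> \<Sigma>" "k' (r0 + d) \<in> S interior_of Tz" "k' (r0 + d) \<noteq> z" using k'(5,6) by blast+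
      then show False using int subsetD[OF interior_of_subset, of "k' (r0 + d)" S Tz] by blast
    qed
    then show ?thesis using zTz seg_int[OF segment_subset[OF Tz(1)]] by (simp add: seg_boundary_def)
  qed
  have Tzfree: "Tz \<in> free_segments G \<phi> M S \<iota>"
  proof -
    have "overlaps \<phi> M S \<iota> h Tz Tz \<longleftrightarrow> h \<in> H" if h: "h \<in> carrier G" for h
    proof
      assume hH: "h \<in> H"
      have sub: "{s0<..<s0 + e} \<subseteq> {s0..s0 + e}" by auto
      have U: "segment S (k ` {s0<..<s0 + e})" "openin S (k ` {s0<..<s0 + e})"
        using line_chart_open_segment[OF k(1) order_trans[OF sub k(4)]] k(3) by simp_all
      have UT: "k ` {s0<..<s0 + e} \<subseteq> Tz" unfolding Tz_def by (rule image_mono[OF sub])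
      have "embedded_on M S \<iota> (k ` {s0<..<s0 + e})"
        by (rule embedded_on_subset[OF compact_embedded[OF Tz(2)] UT segment_subset[OF Tz(1)]])
      moreover have "\<phi> h ` \<iota> ` k ` {s0<..<s0 + e} = \<iota> ` k ` {s0<..<s0 + e}"
      proof -
        have "\<phi> h (\<iota> (k s)) = \<iota> (k s)" if "s \<in> {s0<..<s0 + e}" for s
          by (rule H_fixes[OF hH subsetD[OF openin_subset[OF U(2)] imageI[OF that]]])
        then show ?thesis unfolding image_image by (rule image_cong[OF refl])
      qed
      ultimately show "overlaps \<phi> M S \<iota> h Tz Tz"
        unfolding overlaps_def using U UT by blast
    next
      assume "overlaps \<phi> M S \<iota> h Tz Tz"
      then obtain U U' where U: "segment S U" "U \<subseteq> Tz" "U' \<subseteq> Tz" "\<phi> h ` \<iota> ` U = \<iota> ` U'" "openin S U"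
        unfolding overlaps_def by blast
      obtain u where u: "u \<in> U" using U(1) by (auto simp: segment_def)
      have Utop: "U \<subseteq> topspace S" by (rule segment_subset[OF U(1)])
      have "k ` {s0..s0 + e} \<subseteq> k ` J" by (rule image_mono[OF k(4)])
      then have ul: "u \<in> line_points S"
        using u U(2) line_chart_line_points[OF k(1)] unfolding Tz_def by blast
      let ?c = "inv\<^bsub>G\<^esub> g \<otimes>\<^bsub>G\<^esub> h"
      have c: "?c \<in> carrier G" using g h by simp
      have "?c \<otimes>\<^bsub>G\<^esub> inv\<^bsub>G\<^esub> (inv\<^bsub>G\<^esub> g) \<in> H"
      proof (rule stabilizer_of_segment[OF U(1) u ul gi c])
        show "\<phi> (inv\<^bsub>G\<^esub> g) ` \<iota> ` U \<subseteq> \<iota> ` \<Sigma>" using giT1\<Sigma> U(2) TzT1 by blast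
        show "\<phi> ?c ` \<iota> ` U \<subseteq> \<iota> ` \<Sigma>"
        proof clarify
          fix v assume v: "v \<in> U"
          have p: "\<iota> v \<in> topspace M" by (rule \<iota>_closed[OF subsetD[OF Utop v]])
          have "\<phi> h (\<iota> v) \<in> \<iota> ` U'" using U(4) v by blast
          then have "\<phi> h (\<iota> v) \<in> \<iota> ` T1" using U(3) TzT1 by blast
          then show "\<phi> ?c (\<iota> v) \<in> \<iota> ` \<Sigma>"
            unfolding composition_rule[OF p gi h] using giT1\<Sigma> by blast
        qed
      qed
      \<comment> \<open>From the conjugate it is inferred that \<open>h\<close> fixes
        \<open>T1\<close> pointwise. Membership of \<open>h\<close> itself then follows from the
        crossing at \<open>z\<close> from \<open>T1\<close> to \<Sigma>, where freeness is
        available.\<close>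
      then have cH: "inv\<^bsub>G\<^esub> g \<otimes>\<^bsub>G\<^esub> h \<otimes>\<^bsub>G\<^esub> g \<in> H" using g by simp
      have hfix: "\<phi> h (\<iota> v) = \<iota> v" if v: "v \<in> T1" for v
      proof -
        have vt: "v \<in> topspace S" using v T1top by blast
        then have p: "\<iota> v \<in> topspace M" by (rule \<iota>_closed)
        obtain t where t: "t \<in> T" "\<iota> v = \<phi> g (\<iota> t)" using gT v by blast
        have pt: "\<iota> t \<in> topspace M" using t(1) Ttop \<iota>_closed by blast
        have "\<phi> (inv\<^bsub>G\<^esub> g \<otimes>\<^bsub>G\<^esub> h \<otimes>\<^bsub>G\<^esub> g) (\<iota> t) = \<iota> t"
          by (rule H_fixes[OF cH subsetD[OF Ttop t(1)]])
        then have "\<phi> (inv\<^bsub>G\<^esub> g) (\<phi> h (\<iota> v)) = \<iota> t"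
          using composition_rule[OF pt c g] composition_rule[OF p gi h] t(2) by simp
        then have "\<phi> g (\<phi> (inv\<^bsub>G\<^esub> g) (\<phi> h (\<iota> v))) = \<iota> v" using t(2) by simp
        then show ?thesis using \<phi>_inv'[OF g \<phi>_closed[OF h p]] by simp
      qed
      have hT1: "\<phi> h ` \<iota> ` T1 = \<iota> ` T1" unfolding image_image by (rule image_cong[OF refl]) (rule hfix)
      have one\<Sigma>: "\<phi> \<one>\<^bsub>G\<^esub> ` \<iota> ` \<Sigma> \<subseteq> \<iota> ` \<Sigma>"
        using \<phi>_one[OF \<iota>_closed[OF subsetD[OF \<Sigma>_subset]]] by (simp add: image_subset_iff)
      have fin': "finite (T1 \<inter> \<Sigma>)" using fin by (simp add: Int_commute)
      have "\<one>\<^bsub>G\<^esub> \<otimes>\<^bsub>G\<^esub> h \<otimes>\<^bsub>G\<^esub> inv\<^bsub>G\<^esub> \<one>\<^bsub>G\<^esub> \<in> H"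
        by (rule stabilizer_of_crossing[OF h zl zl hfix[OF z(1)] T1(1) z(1) T1(1) z(1) T1(2) hT1
              \<Sigma>_segment z\<Sigma> fin' \<Sigma>_segment z\<Sigma> fin' one_closed one\<Sigma> one_closed one\<Sigma>])
      then show "h \<in> H" using h by simp
    qed
    then show ?thesis using Tz(1) by (simp add: free_segments_def)
  qed
  have trans: "transition_at G \<phi> M S \<iota> \<Sigma> z g"
  proof -
    have "\<Sigma> \<inter> Tz = seg_boundary S \<Sigma> \<inter> seg_boundary S Tz"
      using int z(2) zbd by (auto simp: seg_boundary_def)
    then show ?thesis
      unfolding transition_at_def using Tb TbS bbd bbd' Tzfree Tz(2) int gTb b(2) by blast
  qed
  let ?cl = "coset_class G \<phi> S \<iota>"
  have "transition_class G \<phi> M S \<iota> \<Sigma> z = ?cl g"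
    unfolding transition_class_def
  proof (rule the_equality)
    have "?cl g \<noteq> ?cl \<one>\<^bsub>G\<^esub>"
    proof
      assume "?cl g = ?cl \<one>\<^bsub>G\<^esub>"
      then have "g \<in> ?cl \<one>\<^bsub>G\<^esub>" using coset_class_self[OF g] by simp
      then have "inv\<^bsub>G\<^esub> \<one>\<^bsub>G\<^esub> \<otimes>\<^bsub>G\<^esub> g \<in> H" by (rule coset_classD(2)[OF one_closed])
      then show False using gH g by simp
    qed
    then show "?cl g \<noteq> ?cl \<one>\<^bsub>G\<^esub> \<and> (\<exists>g'\<in>carrier G. ?cl g = ?cl g' \<and> transition_at G \<phi> M S \<iota> \<Sigma> z g')"
      using g trans by blast
    show "C = ?cl g" if C: "C \<noteq> ?cl \<one>\<^bsub>G\<^esub> \<and> (\<exists>g'\<in>carrier G. C = ?cl g' \<and> transition_at G \<phi> M S \<iota> \<Sigma> z g')" for C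
    proof -
      obtain g' where g': "g' \<in> carrier G" "C = ?cl g'" "transition_at G \<phi> M S \<iota> \<Sigma> z g'" using C by blast
      show ?thesis unfolding g'(2)
        by (rule coset_class_eqI[OF g'(1) g transition_unique[OF zl g'(3) trans g'(1) g]])
    qed
  qed
  then have "g \<notin> stabilizer G \<phi> (\<iota> z)"
    using pos z(2,3) coset_class_self[OF g] unfolding positive_segment_def by blast
  then have "\<phi> g (\<iota> z) \<noteq> \<iota> z" using g by (simp add: stabilizer_def)
  then have "b \<noteq> z" using b(2) by auto
  then show thesis using that b(1) bint b(2) by blast
qed


lemma translate_eq:
  assumes a: "a \<in> carrier G" and g: "g \<in> carrier G" "inv\<^bsub>G\<^esub> a \<otimes>\<^bsub>G\<^esub> g \<in> H" and X: "X \<subseteq> topspace S"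
  shows "\<phi> g ` \<iota> ` X = \<phi> a ` \<iota> ` X"
proof -
  have "\<phi> g (\<iota> x) = \<phi> a (\<iota> x)" if "x \<in> X" for x
  proof -
    have p: "\<iota> x \<in> topspace M" using X that \<iota>_closed by blast
    have "\<phi> a (\<phi> (inv\<^bsub>G\<^esub> a \<otimes>\<^bsub>G\<^esub> g) (\<iota> x)) = \<phi> g (\<iota> x)"
      using composition_rule[OF p a, of "inv\<^bsub>G\<^esub> a \<otimes>\<^bsub>G\<^esub> g"] a g(1) by (simp add: mult_inv_cancel)
    then show ?thesis using H_fixes[OF g(2)] X that by auto
  qed
  then show ?thesis by (simp add: image_image)
qed

lemma self_translate_stabilizes:
  assumes a: "a \<in> carrier G" and aS: "\<phi> a ` \<iota> ` \<Sigma> = \<iota> ` \<Sigma>"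
  shows "a \<in> H"
proof -
  obtain x where x: "x \<in> \<Sigma>" using \<Sigma>_segment by (auto simp: segment_def)
  have "\<phi> \<one>\<^bsub>G\<^esub> ` \<iota> ` \<Sigma> \<subseteq> \<iota> ` \<Sigma>"
    using \<phi>_one[OF \<iota>_closed[OF subsetD[OF \<Sigma>_subset]]] by (simp add: image_subset_iff)
  then have "a \<otimes>\<^bsub>G\<^esub> inv\<^bsub>G\<^esub> \<one>\<^bsub>G\<^esub> \<in> H"
    by (rule stabilizer_of_segment[OF \<Sigma>_segment x subsetD[OF line x] one_closed a _ eq_refl[OF aS]])
  then show ?thesis using a by simp
qed

lemma boundary_pair:
  assumes CI: "circle_like S \<or> interval_like S" and proper: "\<Sigma> \<subset> seg_interior S (topspace S)"
    and pq: "p \<in> \<Sigma> - S interior_of \<Sigma>" "q \<in> \<Sigma> - S interior_of \<Sigma>" "p \<noteq> q"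
  shows "\<Sigma> - S interior_of \<Sigma> \<subseteq> {p, q}"
proof -
  obtain J k where k: "line_chart S J k" "\<Sigma> \<subseteq> k ` J" by (rule proper_subset_in_chart[OF CI proper])
  obtain a b where "\<Sigma> - S interior_of \<Sigma> \<subseteq> {k a, k b}"
    by (rule compact_segment_in_chart[OF k(1) \<Sigma>_segment compact k(2)])
  then show ?thesis using pq by blast
qed

lemma seg_boundary_iff:
  assumes CI: "circle_like S \<or> interval_like S" and proper: "\<Sigma> \<subset> seg_interior S (topspace S)"
  shows "seg_boundary S \<Sigma> = \<Sigma> - S interior_of \<Sigma>"
  unfolding seg_boundary_def seg_interior_eq[OF CI \<Sigma>_subset] using proper by blast

section \<open>Decompositions of a circle\<close>

text \<open>Common core of the cases \<open>n = 1\<close> and \<open>n \<ge> 2\<close>, which differ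
  in how the joints are found. For \<open>k < n\<close> the joint \<open>z k\<close> links
  consecutive segments; \<open>z n\<close> closes the circle.\<close>

lemma circle_powers:
  fixes \<Sigma>s :: "nat \<Rightarrow> 's set" and gs :: "nat \<Rightarrow> 'g" and z :: "nat \<Rightarrow> 's"
  assumes C: "circle_like S" and proper: "\<Sigma> \<subset> seg_interior S (topspace S)"
    and pos: "positive_segment G \<phi> M S \<iota> \<Sigma>"
    and n: "1 \<le> n" and \<Sigma>0: "\<Sigma>s 0 = \<Sigma>"
    and seg: "\<And>k. k \<le> n \<Longrightarrow> segment S (\<Sigma>s k)" and comp: "\<And>k. k \<le> n \<Longrightarrow> compactin S (\<Sigma>s k)"
    and gs: "\<And>k. k \<le> n \<Longrightarrow> gs k \<in> carrier G" "\<And>k. k \<le> n \<Longrightarrow> \<phi> (gs k) ` \<iota> ` \<Sigma> = \<iota> ` \<Sigma>s k"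
    and fin: "\<And>p q. p \<le> n \<Longrightarrow> q \<le> n \<Longrightarrow> p \<noteq> q \<Longrightarrow> finite (\<Sigma>s p \<inter> \<Sigma>s q)"
    and z: "\<And>k. k < n \<Longrightarrow> z k \<in> \<Sigma>s k \<inter> \<Sigma>s (Suc k)" "z n \<in> \<Sigma>s n \<inter> \<Sigma>"
    and zz: "\<And>k. k < n \<Longrightarrow> z k \<noteq> z (Suc k)" "z n \<noteq> z 0"
    and zb: "z 0 \<in> seg_boundary S \<Sigma>" "z n \<in> seg_boundary S \<Sigma>"
    and g: "g \<in> coset_class G \<phi> S \<iota> (gs 1)"
  shows "(\<forall>k\<le>n. coset_class G \<phi> S \<iota> (gs k) = coset_class G \<phi> S \<iota> (g [^]\<^bsub>G\<^esub> k)) \<and>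
    coset_class G \<phi> S \<iota> (g [^]\<^bsub>G\<^esub> n) = coset_class G \<phi> S \<iota> (inv\<^bsub>G\<^esub> g)"
proof -
  have CI: "circle_like S \<or> interval_like S" using C by simp
  have I: "seg_interior S (topspace S) = topspace S" using C by (simp add: circle_interior)
  have lp: "topspace S \<subseteq> line_points S" using seg_interior_line_points[OF CI] I by simp
  have gc: "g \<in> carrier G" and gH: "inv\<^bsub>G\<^esub> (gs 1) \<otimes>\<^bsub>G\<^esub> g \<in> H"
    using coset_classD[OF gs(1)[OF n] g] by auto
  have g\<Sigma>: "\<phi> g ` \<iota> ` \<Sigma> = \<iota> ` \<Sigma>s 1"
    using translate_eq[OF gs(1)[OF n] gc gH \<Sigma>_subset] gs(2)[OF n] by simp
  have z01: "z 0 \<in> \<Sigma>s 1" using z(1)[of 0] n by simp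
  have z0top: "z 0 \<in> topspace S" using segment_subset[OF seg[OF n]] z01 by blast
  have fin01: "finite (\<Sigma> \<inter> \<Sigma>s 1)" using fin[of 0 1] n \<Sigma>0 by simp
  note bd = seg_boundary_iff[OF CI proper]
  have bd2: "\<Sigma> - S interior_of \<Sigma> \<subseteq> {z n, z 0}"
    by (rule boundary_pair[OF CI proper]) (use zb zz(2) bd in auto)
  obtain b where b: "b \<in> \<Sigma>" "b \<notin> S interior_of \<Sigma>" "\<phi> g (\<iota> b) = \<iota> (z 0)" "b \<noteq> z 0"
    by (rule transition_moves[OF CI pos gc \<Sigma>_segment order_refl seg[OF n] compact_embedded[OF comp[OF n]]
          g\<Sigma> fin01 z01 zb(1)]) (use z0top I in auto)
  then have "b = z n" using bd2 by blast
  then have gzn: "\<phi> g (\<iota> (z n)) = \<iota> (z 0)" using b(3) by simp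
  \<comment> \<open>The chain is prolonged by one step: segment \<open>Suc n\<close> is \<Sigma>
    again, reached by the unit element. Its last conclusion is that \<open>g\<close> to the power
    \<open>Suc n\<close> lies in \<open>H\<close>.\<close>
  define T where "T = (\<lambda>k. if k \<le> n then \<Sigma>s k else \<Sigma>)"
  define gs' where "gs' = (\<lambda>k. if k = 1 then g else if k \<le> n then gs k else \<one>\<^bsub>G\<^esub>)"
  have one\<Sigma>: "\<phi> \<one>\<^bsub>G\<^esub> ` \<iota> ` \<Sigma> = \<iota> ` \<Sigma>"
    using \<phi>_one[OF \<iota>_closed[OF subsetD[OF \<Sigma>_subset]]] by (simp add: image_image)
  have gs'T: "\<phi> (gs' k) ` \<iota> ` \<Sigma> = \<iota> ` T k" if "k \<le> Suc n" for k
    using that n g\<Sigma> gs(2) one\<Sigma> by (auto simp: gs'_def T_def)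
  have Tseg: "segment S (T k)" "compactin S (T k)" for k
    using seg comp \<Sigma>_segment compact by (auto simp: T_def)
  have powers: "inv\<^bsub>G\<^esub> (gs' k) \<otimes>\<^bsub>G\<^esub> g [^]\<^bsub>G\<^esub> k \<in> H" if "1 \<le> k" "k \<le> Suc n" for k
  proof (rule chain[where T = T and gs = gs' and z = z and N = "Suc n" and zm = "z n"])
    show "T 0 = \<Sigma>" by (simp add: T_def \<Sigma>0)
    show "g \<in> carrier G" "gs' 1 = g" using gc by (auto simp: gs'_def)
    show "gs' k \<in> carrier G" if "k \<le> Suc n" for k using gc gs(1) by (auto simp: gs'_def)
    show "segment S (T k)" "embedded_on M S \<iota> (T k)" for k
      using Tseg compact_embedded by auto
    show "\<phi> (gs' k) ` \<iota> ` \<Sigma> = \<iota> ` T k" if "k < Suc n" for k using gs'T that by simp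
    show "\<exists>T'. segment S T' \<and> T' \<subseteq> \<Sigma> \<and> \<phi> (gs' k) ` \<iota> ` T' = \<iota> ` T k" if "k \<le> Suc n" for k
      using gs'T[OF that] \<Sigma>_segment by blast
    have zT: "z k \<in> T k \<and> z k \<in> T (Suc k)" if "k < Suc n" for k
      using z that by (cases "k = n") (auto simp: T_def)
    show "z k \<in> T k" "z k \<in> T (Suc k)" "z k \<in> line_points S" if "k < Suc n" for k
      using zT[OF that] segment_subset[OF Tseg(1)[of k]] lp by auto
    show "finite (T k \<inter> T (Suc k))" if "k < Suc n" for k
    proof (cases "k = n")
      case True
      then show ?thesis using fin[of n 0] n \<Sigma>0 by (simp add: T_def)
    next
      case False
      then show ?thesis using fin[of k "Suc k"] that by (simp add: T_def)
    qed
    show "z k \<noteq> z (Suc k)" if "Suc k < Suc n" for k using zz(1) that by simp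
    show "z n \<in> \<Sigma>" using z(2) by simp
  qed (use gzn bd2 that in auto)
  have g0: "gs 0 \<in> H" using self_translate_stabilizes[OF gs(1)] gs(2)[of 0] \<Sigma>0 by simp
  have 1: "coset_class G \<phi> S \<iota> (gs k) = coset_class G \<phi> S \<iota> (g [^]\<^bsub>G\<^esub> k)" if k: "k \<le> n" for k
  proof (rule coset_class_eqI[OF gs(1)[OF k]])
    show "g [^]\<^bsub>G\<^esub> k \<in> carrier G" using gc by simp
    \<comment> \<open>The chain starts at index 1, and there \<open>gs' 1\<close> is
      \<open>g\<close> instead of \<open>gs 1\<close>; hence indices 0 and 1 are settled
      separately.\<close>
    consider "k = 0" | "k = 1" | "2 \<le> k" by linarith
    then show "inv\<^bsub>G\<^esub> (gs k) \<otimes>\<^bsub>G\<^esub> g [^]\<^bsub>G\<^esub> k \<in> H"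
    proof cases
      case 1
      then show ?thesis using H_inv[OF g0] gs(1)[of 0] by simp
    next
      case 2
      then show ?thesis using gH gc by simp
    next
      case 3
      then show ?thesis using powers[of k] k by (simp add: gs'_def)
    qed
  qed
  have "inv\<^bsub>G\<^esub> \<one>\<^bsub>G\<^esub> \<otimes>\<^bsub>G\<^esub> g [^]\<^bsub>G\<^esub> Suc n \<in> H" using powers[of "Suc n"] n by (simp add: gs'_def)
  then have "g [^]\<^bsub>G\<^esub> Suc n \<in> H" using gc by simp
  then have "inv\<^bsub>G\<^esub> (g [^]\<^bsub>G\<^esub> Suc n) \<in> H" by (rule H_inv)
  \<comment> \<open>Splitting off a factor \<open>g\<close> on the left of the power gives the order
    of inverses that left cosets require.\<close>
  moreover have "inv\<^bsub>G\<^esub> (g [^]\<^bsub>G\<^esub> Suc n) = inv\<^bsub>G\<^esub> (g [^]\<^bsub>G\<^esub> n) \<otimes>\<^bsub>G\<^esub> inv\<^bsub>G\<^esub> g"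
    using gc nat_pow_Suc2[OF gc, of n] by (simp add: inv_mult_group del: nat_pow_Suc)
  ultimately have "coset_class G \<phi> S \<iota> (g [^]\<^bsub>G\<^esub> n) = coset_class G \<phi> S \<iota> (inv\<^bsub>G\<^esub> g)"
    using gc by (intro coset_class_eqI) auto
  with 1 show ?thesis by blast
qed

lemma circle_case:
  assumes C: "circle_like S" and proper: "\<Sigma> \<subset> seg_interior S (topspace S)"
    and pos: "positive_segment G \<phi> M S \<iota> \<Sigma>"
    and D: "circle_decomposition G \<phi> M S \<iota> \<Sigma> n \<Sigma>s gs"
    and g: "g \<in> coset_class G \<phi> S \<iota> (gs 1)"
  shows "(\<forall>k\<le>n. coset_class G \<phi> S \<iota> (gs k) = coset_class G \<phi> S \<iota> (g [^]\<^bsub>G\<^esub> k)) \<and>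
    coset_class G \<phi> S \<iota> (g [^]\<^bsub>G\<^esub> n) = coset_class G \<phi> S \<iota> (inv\<^bsub>G\<^esub> g)"
proof -
  note D = D[unfolded circle_decomposition_def, THEN conjunct2, THEN conjunct2]
    D[unfolded circle_decomposition_def, THEN conjunct1]
    D[unfolded circle_decomposition_def, THEN conjunct2, THEN conjunct1]
  have n: "1 \<le> n" and \<Sigma>0: "\<Sigma>s 0 = \<Sigma>" using D(2,3) by simp_all
  note D' = D(1)[THEN conjunct2, THEN conjunct1] D(1)[THEN conjunct2, THEN conjunct2, THEN conjunct1]
    D(1)[THEN conjunct2, THEN conjunct2, THEN conjunct2]
  have each: "\<Sigma>s k \<in> maximal_free_segments G \<phi> M S \<iota> \<and> compactin S (\<Sigma>s k) \<and>
        gs k \<in> carrier G \<and> \<phi> (gs k) ` (\<iota> ` \<Sigma>) = \<iota> ` \<Sigma>s k" if "k \<le> n" for k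
    using D'(1) that unfolding \<Sigma>0 by blast
  have seg: "segment S (\<Sigma>s k)" if "k \<le> n" for k
    using each[OF that] by (simp add: maximal_free_segments_def free_segments_def)
  have lp: "topspace S \<subseteq> line_points S"
    using seg_interior_line_points[of S] C by (simp add: circle_interior)
  show ?thesis
  proof (cases "n = 1")
    case True
    have "\<Sigma>s 0 \<inter> \<Sigma>s 1 = seg_boundary S (\<Sigma>s 0) \<inter> seg_boundary S (\<Sigma>s 1)"
      "seg_boundary S (\<Sigma>s 0) = seg_boundary S (\<Sigma>s 1)" and card: "card (seg_boundary S (\<Sigma>s 0)) = 2"
      using D'(2)[rule_format, OF True] by blast+
    then have int: "\<Sigma> \<inter> \<Sigma>s 1 = seg_boundary S \<Sigma>" by (simp add: \<Sigma>0)
    obtain p q where pq: "seg_boundary S \<Sigma> = {p, q}" "p \<noteq> q" using card unfolding \<Sigma>0 card_2_iff by blast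
    \<comment> \<open>Both boundary points of \<Sigma> are joints here; which one counts as the
      first is arbitrary.\<close>
    define z where "z = (\<lambda>k::nat. if k = 0 then p else q)"
    have pqin: "p \<in> \<Sigma> \<inter> \<Sigma>s 1" "q \<in> \<Sigma> \<inter> \<Sigma>s 1" using int pq(1) by auto
    have fin: "finite (\<Sigma> \<inter> \<Sigma>s 1)" using int pq(1) by simp
    show ?thesis
    proof (rule circle_powers[where z = z and \<Sigma>s = \<Sigma>s, OF C proper pos n \<Sigma>0])
      show "finite (\<Sigma>s i \<inter> \<Sigma>s j)" if "i \<le> n" "j \<le> n" "i \<noteq> j" for i j
      proof -
        have "(i = 0 \<and> j = 1) \<or> (i = 1 \<and> j = 0)" using that True by linarith
        then show ?thesis using fin \<Sigma>0 by (auto simp: Int_commute)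
      qed
    qed (use each seg g True pq pqin \<Sigma>0 in \<open>auto simp: z_def\<close>)
  next
    case False
    then have n2: "2 \<le> n" using n by simp
    have adj: "\<Sigma>s p \<inter> \<Sigma>s q = seg_boundary S (\<Sigma>s p) \<inter> seg_boundary S (\<Sigma>s q)" "is_singleton (\<Sigma>s p \<inter> \<Sigma>s q)"
      if "p \<le> n" "q \<le> n" "\<bar>int p - int q\<bar> \<in> {1, int n}" for p q
      using D'(3)[rule_format, OF n2 that(1,2)] that(3) by blast+
    have dis: "\<Sigma>s p \<inter> \<Sigma>s q = {}"
      if "p \<le> n" "q \<le> n" "2 \<le> \<bar>int p - int q\<bar>" "\<bar>int p - int q\<bar> \<le> int n - 1" for p q
      using D'(3)[rule_format, OF n2 that(1,2)] that(3,4) by blast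
    have fin: "finite (\<Sigma>s p \<inter> \<Sigma>s q)" if pq: "p \<le> n" "q \<le> n" "p \<noteq> q" for p q
    proof (cases "\<bar>int p - int q\<bar> \<in> {1, int n}")
      case True
      obtain x where "\<Sigma>s p \<inter> \<Sigma>s q = {x}" using adj(2)[OF pq(1,2) True] by (rule is_singletonE)
      then show ?thesis by simp
    next
      case False
      then have "2 \<le> \<bar>int p - int q\<bar>" "\<bar>int p - int q\<bar> \<le> int n - 1" using pq by auto
      then show ?thesis using dis[OF pq(1,2)] by simp
    qed
    define z where "z = (\<lambda>k. the_elem (\<Sigma>s k \<inter> (if k < n then \<Sigma>s (Suc k) else \<Sigma>s 0)))"
    have z1: "\<Sigma>s k \<inter> \<Sigma>s (Suc k) = {z k}" if "k < n" for k
      using adj(2)[of k "Suc k"] that by (simp add: z_def is_singleton_the_elem)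
    have z2: "\<Sigma>s n \<inter> \<Sigma>s 0 = {z n}"
      using adj(2)[of n 0] by (simp add: z_def is_singleton_the_elem)
    \<comment> \<open>For \<open>n = 2\<close> any two segments are adjacent and the disjointness
      clause is empty. Distinctness of the joints follows instead from a point having only two
      sides.\<close>
    have three: False if x: "x \<in> \<Sigma>s i" "x \<in> \<Sigma>s j" "x \<in> \<Sigma>s k"
      and ijk: "i \<le> n" "j \<le> n" "k \<le> n" "i \<noteq> j" "i \<noteq> k" "j \<noteq> k" for x i j k
    proof -
      have "x \<in> line_points S" using x(1) segment_subset[OF seg[OF ijk(1)]] lp by blast
      then show False
        using segments_at_point[OF S_Hausdorff _ seg[OF ijk(1)] x(1) seg[OF ijk(2)] x(2) seg[OF ijk(3)] x(3)]
          fin ijk by blast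
    qed
    have zin: "z k \<in> \<Sigma>s k" "z k \<in> \<Sigma>s (Suc k)" if "k < n" for k using z1[OF that] by auto
    have znin: "z n \<in> \<Sigma>s n" "z n \<in> \<Sigma>s 0" using z2 by auto
    have zz: "z k \<noteq> z (Suc k)" if k: "k < n" for k
    proof
      assume eq: "z k = z (Suc k)"
      show False
      proof (cases "Suc k < n")
        case True
        have zk: "z k \<in> \<Sigma>s (Suc (Suc k))" using zin(2)[OF True] by (simp only: eq)
        show False by (rule three[OF zin(1)[OF k] zin(2)[OF k] zk]) (use k True in auto)
      next
        case False
        then have kn: "Suc k = n" using k by simp
        have zk: "z k \<in> \<Sigma>s 0" using znin(2) by (simp only: eq kn)
        show False by (rule three[OF zin(1)[OF k] zin(2)[OF k] zk]) (use k kn n2 in auto)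
      qed
    qed
    have zn0: "z n \<noteq> z 0"
    proof
      assume eq: "z n = z 0"
      have "0 < n" using n by simp
      then have zn: "z n \<in> \<Sigma>s (Suc 0)" using zin(2)[of 0] eq by simp
      show False by (rule three[OF znin zn]) (use n2 in auto)
    qed
    have zb: "z 0 \<in> seg_boundary S \<Sigma>" "z n \<in> seg_boundary S \<Sigma>"
      using adj(1)[of 0 1] adj(1)[of n 0] z1[of 0] z2 n2 \<Sigma>0 by auto
    show ?thesis
    proof (rule circle_powers[where z = z and \<Sigma>s = \<Sigma>s, OF C proper pos n \<Sigma>0])
      show "finite (\<Sigma>s i \<inter> \<Sigma>s j)" if "i \<le> n" "j \<le> n" "i \<noteq> j" for i j
        by (rule fin[OF that])
      show "z k \<in> \<Sigma>s k \<inter> \<Sigma>s (Suc k)" if "k < n" for k using zin[OF that] by simp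
      show "z n \<in> \<Sigma>s n \<inter> \<Sigma>" using znin \<Sigma>0 by simp
      show "z k \<noteq> z (Suc k)" if "k < n" for k by (rule zz[OF that])
    qed (use each seg g zn0 zb in auto)
  qed
qed


section \<open>Decompositions of an interval\<close>

text \<open>\<open>\<sigma>\<close> is the direction of travel. For \<open>\<sigma> = -1\<close> the
  lemma is applied to the inverse of the group element with the two joints exchanged, so one
  induction serves both directions.\<close>

lemma interval_chain:
  fixes \<Sigma>s :: "int \<Rightarrow> 's set" and gs :: "int \<Rightarrow> 'g"
  assumes CI: "circle_like S \<or> interval_like S" and proper: "\<Sigma> \<subset> seg_interior S (topspace S)"
    and D: "interval_decomposition G \<phi> M S \<iota> \<Sigma> l u \<Sigma>s gs"
    and \<sigma>: "\<sigma> = 1 \<or> \<sigma> = -1" and k: "1 \<le> k" "\<sigma> * int k \<in> index_set l u"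
    and g: "g \<in> carrier G" "inv\<^bsub>G\<^esub> (gs \<sigma>) \<otimes>\<^bsub>G\<^esub> g \<in> H"
    and z0: "\<Sigma> \<inter> \<Sigma>s \<sigma> = {z0}" and zm: "zm \<in> \<Sigma>" "\<phi> g (\<iota> zm) = \<iota> z0"
    and bd: "\<Sigma> - S interior_of \<Sigma> \<subseteq> {zm, z0}"
  shows "inv\<^bsub>G\<^esub> (gs (\<sigma> * int k)) \<otimes>\<^bsub>G\<^esub> g [^]\<^bsub>G\<^esub> k \<in> H"
proof -
  note D' = D[unfolded interval_decomposition_def]
  note lu = D'[THEN conjunct1] D'[THEN conjunct2, THEN conjunct1]
  note \<Sigma>0 = D'[THEN conjunct2, THEN conjunct2, THEN conjunct1]
  note D2 = D'[THEN conjunct2, THEN conjunct2, THEN conjunct2]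
  note each = D2[THEN conjunct1, rule_format]
  note inter = D2[THEN conjunct2, THEN conjunct1, rule_format]
  note inner = D2[THEN conjunct2, THEN conjunct2, THEN conjunct1, rule_format]
  note outer = D2[THEN conjunct2, THEN conjunct2, THEN conjunct2, rule_format]
  \<comment> \<open>Indices short of \<open>k\<close> lie strictly between the bounds, so their
    segments are translates of all of \<Sigma>; only the last one may be an end segment.\<close>
  have strict: "l < Fin (\<sigma> * int j) \<and> Fin (\<sigma> * int j) < u" if j: "j < k" for j
  proof -
    have lk: "l \<le> Fin (\<sigma> * int k)" "Fin (\<sigma> * int k) \<le> u" using k(2) by (auto simp: index_set_def)
    from \<sigma> show ?thesis
    proof
      assume s: "\<sigma> = 1"
      have "l < Fin (int j)" using lu(1) by (rule less_le_trans) simp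
      moreover have "Fin (int j) < u" by (rule less_le_trans[OF _ lk(2)]) (use j s in simp)
      ultimately show ?thesis using s by simp
    next
      assume s: "\<sigma> = -1"
      have "Fin (- int j) < u" using lu(2) by (rule le_less_trans[rotated]) simp
      moreover have "l < Fin (- int j)" by (rule le_less_trans[OF lk(1)]) (use j s in simp)
      ultimately show ?thesis using s by simp
    qed
  qed
  have idx: "\<sigma> * int j \<in> index_set l u" if "j \<le> k" for j
    using strict[of j] k(2) that by (cases "j = k") (auto simp: index_set_def less_imp_le)
  define T where "T = (\<lambda>j. \<Sigma>s (\<sigma> * int j))"
  \<comment> \<open>\<open>chain\<close> wants its first element to be exactly \<open>g\<close>. The
    representatives \<open>gs \<sigma>\<close> and \<open>g\<close> differ by an element of
    \<open>H\<close>, which changes no translate of a part of the curve.\<close>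
  define gs' where "gs' = (\<lambda>j::nat. if j = 1 then g else gs (\<sigma> * int j))"
  define z where "z = (\<lambda>j. the_elem (T j \<inter> T (Suc j)))"
  have T0: "T 0 = \<Sigma>" by (simp add: T_def \<Sigma>0)
  have T1: "T 1 = \<Sigma>s \<sigma>" by (simp add: T_def)
  have seg: "segment S (T j)" "embedded_on M S \<iota> (T j)" "gs (\<sigma> * int j) \<in> carrier G" if "j \<le> k" for j
    using each[OF idx[OF that]] by (auto simp: T_def)
  have dist: "\<bar>\<sigma> * int i - \<sigma> * int j\<bar> = \<bar>int i - int j\<bar>" for i j using \<sigma> by auto
  have zT: "T j \<inter> T (Suc j) = {z j}" if j: "j < k" for j
  proof -
    have "\<bar>\<sigma> * int j - \<sigma> * int (Suc j)\<bar> = 1" unfolding dist by simp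
    then have "is_singleton (T j \<inter> T (Suc j))"
      unfolding T_def using inter[OF idx[of j] idx[of "Suc j"]] j by auto
    then show ?thesis by (simp add: z_def is_singleton_the_elem)
  qed
  have zin: "z j \<in> T j" "z j \<in> T (Suc j)" if "j < k" for j using zT[OF that] by auto
  have z00: "z 0 = z0" using zT[of 0] k(1) T0 T1 z0 by simp
  have gs'act: "\<phi> (gs' j) ` \<iota> ` X = \<phi> (gs (\<sigma> * int j)) ` \<iota> ` X" if "X \<subseteq> topspace S" "j \<le> k" for X j
  proof (cases "j = 1")
    case True
    then have "gs \<sigma> \<in> carrier G" using seg(3)[of 1] k(1) by simp
    then show ?thesis using translate_eq[OF _ g that(1)] True by (simp add: gs'_def)
  qed (simp add: gs'_def)
  have full: "\<phi> (gs' j) ` \<iota> ` \<Sigma> = \<iota> ` T j" if j: "j < k" for j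
    using gs'act[OF \<Sigma>_subset, of j] inner[OF strict[OF j]] j \<Sigma>0 by (simp add: T_def)
  have part: "\<exists>T'. segment S T' \<and> T' \<subseteq> \<Sigma> \<and> \<phi> (gs' j) ` \<iota> ` T' = \<iota> ` T j" if j: "j \<le> k" for j
  proof (cases "l < Fin (\<sigma> * int j) \<and> Fin (\<sigma> * int j) < u")
    case True
    then have "\<phi> (gs' j) ` \<iota> ` \<Sigma> = \<iota> ` T j"
      using gs'act[OF \<Sigma>_subset j] inner[OF True] \<Sigma>0 by (simp add: T_def)
    then show ?thesis using \<Sigma>_segment by blast
  next
    case False
    then have "l = Fin (\<sigma> * int j) \<or> u = Fin (\<sigma> * int j)"
      using idx[OF j] by (auto simp: index_set_def less_le)
    from outer[OF this] obtain T' where T': "boundary_segment S \<Sigma> T'" "\<phi> (gs (\<sigma> * int j)) ` \<iota> ` T' = \<iota> ` T j"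
      unfolding \<Sigma>0 T_def by blast
    then have "segment S T'" "T' \<subseteq> \<Sigma>" by (auto simp: boundary_segment_def)
    then show ?thesis using gs'act[OF order_trans[OF _ \<Sigma>_subset] j, of T'] T'(2) by auto
  qed
  have "inv\<^bsub>G\<^esub> (gs' k) \<otimes>\<^bsub>G\<^esub> g [^]\<^bsub>G\<^esub> k \<in> H"
  proof (rule chain[where T = T and gs = gs' and z = z and N = k and zm = zm])
    show "T 0 = \<Sigma>" by (rule T0)
    show "g \<in> carrier G" by (rule g(1))
    show "gs' 1 = g" by (simp add: gs'_def)
    show "gs' j \<in> carrier G" if "j \<le> k" for j using g(1) seg(3)[OF that] by (simp add: gs'_def)
    show "segment S (T j)" "embedded_on M S \<iota> (T j)" if "j \<le> k" for j using seg[OF that] by simp_all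
    show "\<phi> (gs' j) ` \<iota> ` \<Sigma> = \<iota> ` T j" if "j < k" for j by (rule full[OF that])
    show "\<exists>T'. segment S T' \<and> T' \<subseteq> \<Sigma> \<and> \<phi> (gs' j) ` \<iota> ` T' = \<iota> ` T j" if "j \<le> k" for j by (rule part[OF that])
    show "z j \<in> T j" "z j \<in> T (Suc j)" if "j < k" for j using zin[OF that] by simp_all
    show "z j \<in> line_points S" if j: "j < k" for j
    proof -
      have "j \<le> k" "Suc j \<le> k" using j by auto
      then have "z j \<in> seg_interior S (topspace S)"
        by (intro joint_interior[OF CI seg(1) seg(1) zT[OF j]])
      then show ?thesis using seg_interior_line_points[OF CI] by blast
    qed
    show "finite (T j \<inter> T (Suc j))" if "j < k" for j using zT[OF that] by simp
    show "z j \<noteq> z (Suc j)" if j: "Suc j < k" for j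
    proof
      assume eq: "z j = z (Suc j)"
      have "z j \<in> T (Suc (Suc j))" using zin(2)[OF j] by (simp only: eq)
      moreover have "z j \<in> T j" using zin(1) j by simp
      moreover have "2 \<le> \<bar>\<sigma> * int j - \<sigma> * int (Suc (Suc j))\<bar>" unfolding dist by simp
      then have "T j \<inter> T (Suc (Suc j)) = {}"
        unfolding T_def using inter[OF idx[of j] idx[of "Suc (Suc j)"]] j by auto
      ultimately show False by blast
    qed
    show "zm \<in> \<Sigma>" by (rule zm(1))
    show "\<phi> g (\<iota> zm) = \<iota> (z 0)" using zm(2) z00 by simp
    show "\<Sigma> - S interior_of \<Sigma> \<subseteq> {zm, z 0}" using bd z00 by simp
    show "1 \<le> k" "k \<le> k" using k by simp_all
  qed
  moreover have "inv\<^bsub>G\<^esub> (gs (\<sigma> * int k)) \<otimes>\<^bsub>G\<^esub> g [^]\<^bsub>G\<^esub> k \<in> H" if "k = 1"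
    using g that by simp
  ultimately show ?thesis by (cases "k = 1") (simp_all add: gs'_def)
qed

lemma interval_case:
  assumes CI: "circle_like S \<or> interval_like S" and proper: "\<Sigma> \<subset> seg_interior S (topspace S)"
    and pos: "positive_segment G \<phi> M S \<iota> \<Sigma>"
    and D: "interval_decomposition G \<phi> M S \<iota> \<Sigma> l u \<Sigma>s gs"
    and g: "g \<in> coset_class G \<phi> S \<iota> (gs 1)" and n: "n \<in> index_set l u"
  shows "coset_class G \<phi> S \<iota> (gs n) = coset_class G \<phi> S \<iota> (g [^]\<^bsub>G\<^esub> n)"
proof -
  note D' = D[unfolded interval_decomposition_def]
  note lu = D'[THEN conjunct1] D'[THEN conjunct2, THEN conjunct1]
  note \<Sigma>0 = D'[THEN conjunct2, THEN conjunct2, THEN conjunct1]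
  note D2 = D'[THEN conjunct2, THEN conjunct2, THEN conjunct2]
  note each = D2[THEN conjunct1, rule_format]
  note inter = D2[THEN conjunct2, THEN conjunct1, rule_format]
  note inner = D2[THEN conjunct2, THEN conjunct2, THEN conjunct1, rule_format]
  note outer = D2[THEN conjunct2, THEN conjunct2, THEN conjunct2, rule_format]
  have idx: "0 \<in> index_set l u" "1 \<in> index_set l u" "-1 \<in> index_set l u"
  proof -
    have "Fin 1 \<le> u" using lu(2) by (cases u) auto
    moreover have "l \<le> Fin (-1)" using lu(1) by (cases l) auto
    ultimately show "0 \<in> index_set l u" "1 \<in> index_set l u" "-1 \<in> index_set l u"
      using lu less_imp_le[OF lu(1)] less_imp_le[OF lu(2)] order_trans[of l "Fin 0" "Fin 1"]
        order_trans[of "Fin (-1)" "Fin 0" u] by (auto simp: index_set_def)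
  qed
  have seg: "segment S (\<Sigma>s 1)" "segment S (\<Sigma>s (-1))" and emb: "embedded_on M S \<iota> (\<Sigma>s 1)"
    and gs: "gs 0 \<in> carrier G" "gs 1 \<in> carrier G" "gs (-1) \<in> carrier G" "gs n \<in> carrier G"
    using each idx n by auto
  have s1: "\<Sigma> \<inter> \<Sigma>s 1 = seg_boundary S \<Sigma> \<inter> seg_boundary S (\<Sigma>s 1)" "is_singleton (\<Sigma> \<inter> \<Sigma>s 1)"
    using inter[OF idx(1,2)] \<Sigma>0 by auto
  have s2: "\<Sigma> \<inter> \<Sigma>s (-1) = seg_boundary S \<Sigma> \<inter> seg_boundary S (\<Sigma>s (-1))" "is_singleton (\<Sigma> \<inter> \<Sigma>s (-1))"
    using inter[OF idx(1,3)] \<Sigma>0 by auto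
  obtain z0 where z0: "\<Sigma> \<inter> \<Sigma>s 1 = {z0}" using s1(2) by (rule is_singletonE)
  obtain zm where zm: "\<Sigma> \<inter> \<Sigma>s (-1) = {zm}" using s2(2) by (rule is_singletonE)
  have "\<Sigma>s 1 \<inter> \<Sigma>s (-1) = {}" using inter[OF idx(2,3)] by auto
  then have neq: "zm \<noteq> z0" using z0 zm by blast
  note bd = seg_boundary_iff[OF CI proper]
  have z0b: "z0 \<in> seg_boundary S \<Sigma>" "z0 \<in> \<Sigma>" "z0 \<in> \<Sigma>s 1" using s1(1) z0 by auto
  have zmb: "zm \<in> seg_boundary S \<Sigma>" "zm \<in> \<Sigma>" "zm \<in> \<Sigma>s (-1)" using s2(1) zm by auto
  have bd2: "\<Sigma> - S interior_of \<Sigma> \<subseteq> {zm, z0}"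
    by (rule boundary_pair[OF CI proper]) (use z0b zmb bd neq in auto)
  have gc: "g \<in> carrier G" and gH: "inv\<^bsub>G\<^esub> (gs 1) \<otimes>\<^bsub>G\<^esub> g \<in> H" using coset_classD[OF gs(2) g] by auto
  have piece: "\<exists>T. segment S T \<and> T \<subseteq> \<Sigma> \<and> \<phi> (gs j) ` \<iota> ` T = \<iota> ` \<Sigma>s j" if j: "j \<in> index_set l u" for j
  proof (cases "l < Fin j \<and> Fin j < u")
    case True
    then show ?thesis using inner[OF True] \<Sigma>0 \<Sigma>_segment by (intro exI[of _ \<Sigma>]) simp
  next
    case False
    then have "l = Fin j \<or> u = Fin j" using j by (auto simp: index_set_def less_le)
    from outer[OF this] obtain T where "boundary_segment S \<Sigma> T" "\<phi> (gs j) ` \<iota> ` T = \<iota> ` \<Sigma>s j"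
      unfolding \<Sigma>0 by blast
    then show ?thesis unfolding boundary_segment_def by blast
  qed
  \<comment> \<open>The segment with index 1 may already be an end segment, so only a part
    \<open>T\<close> of \<Sigma> is known to be mapped onto it.\<close>
  obtain T where T: "segment S T" "T \<subseteq> \<Sigma>" "\<phi> (gs 1) ` \<iota> ` T = \<iota> ` \<Sigma>s 1" using piece[OF idx(2)] by blast
  have gT: "\<phi> g ` \<iota> ` T = \<iota> ` \<Sigma>s 1"
    using translate_eq[OF gs(2) gc gH order_trans[OF T(2) \<Sigma>_subset]] T(3) by simp
  have fin: "finite (\<Sigma> \<inter> \<Sigma>s 1)" "finite (T \<inter> \<Sigma>s (-1))" "finite (\<Sigma>s 1 \<inter> \<Sigma>)"
    using z0 zm T(2) by (auto simp: Int_commute intro: finite_subset[of _ "\<Sigma> \<inter> \<Sigma>s (-1)"])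
  have z0I: "z0 \<in> seg_interior S (topspace S)" using proper z0b(2) by blast
  obtain b where b: "b \<in> T" "b \<notin> S interior_of \<Sigma>" "\<phi> g (\<iota> b) = \<iota> z0" "b \<noteq> z0"
    by (rule transition_moves[OF CI pos gc T(1,2) seg(1) emb gT fin(1) z0b(3,1) z0I])
  \<comment> \<open>Positivity excludes \<open>z0\<close>, leaving the other boundary point. In
    particular \<open>T\<close> contains \<open>zm\<close>, so that it can be crossed there.\<close>
  then have "b = zm" using bd2 T(2) by blast
  then have zmT: "zm \<in> T" and gzm: "\<phi> g (\<iota> zm) = \<iota> z0" using b(1,3) by simp_all
  have z0l: "z0 \<in> line_points S" and zml: "zm \<in> line_points S" using line z0b(2) zmb(2) by auto
  have ginv: "inv\<^bsub>G\<^esub> g \<in> carrier G" using gc by simp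
  \<comment> \<open>The step to index -1. \<open>g\<close> maps \<open>T\<close> at
    \<open>zm\<close> onto the segment with index 1 at \<open>z0\<close>; the opposite sides are the
    segment with index -1 and \<Sigma>, so \<open>g\<close> followed after \<open>gs (-1)\<close>
    brings \<Sigma> back to itself near a joint and lies in \<open>H\<close>.\<close>
  have "inv\<^bsub>G\<^esub> (gs (-1)) \<otimes>\<^bsub>G\<^esub> inv\<^bsub>G\<^esub> g \<in> H"
  proof -
    obtain T' where T': "segment S T'" "T' \<subseteq> \<Sigma>" "\<phi> (gs (-1)) ` \<iota> ` T' = \<iota> ` \<Sigma>s (-1)" using piece[OF idx(3)] by blast
    have "\<phi> (inv\<^bsub>G\<^esub> (gs (-1))) ` \<iota> ` \<Sigma>s (-1) = \<iota> ` T'"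
      by (rule \<phi>_image_inv[OF gs(3) order_trans[OF T'(2) \<Sigma>_subset] segment_subset[OF seg(2)] T'(3)])
    then have a: "\<phi> (inv\<^bsub>G\<^esub> (gs (-1))) ` \<iota> ` \<Sigma>s (-1) \<subseteq> \<iota> ` \<Sigma>" using T'(2) by blast
    have ac: "inv\<^bsub>G\<^esub> (gs (-1)) \<in> carrier G" using gs(3) by simp
    have one: "\<phi> \<one>\<^bsub>G\<^esub> ` \<iota> ` \<Sigma> \<subseteq> \<iota> ` \<Sigma>"
      using \<phi>_one[OF \<iota>_closed[OF subsetD[OF \<Sigma>_subset]]] by (simp add: image_subset_iff)
    have "\<one>\<^bsub>G\<^esub> \<otimes>\<^bsub>G\<^esub> g \<otimes>\<^bsub>G\<^esub> inv\<^bsub>G\<^esub> (inv\<^bsub>G\<^esub> (gs (-1))) \<in> H"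
      by (rule stabilizer_of_crossing[OF gc zml z0l gzm T(1) zmT seg(1) z0b(3) emb gT seg(2) zmb(3) fin(2)
            \<Sigma>_segment z0b(2) fin(3) ac a one_closed one])
    then have "g \<otimes>\<^bsub>G\<^esub> gs (-1) \<in> H" using gc gs(3) by simp
    then have "inv\<^bsub>G\<^esub> (g \<otimes>\<^bsub>G\<^esub> gs (-1)) \<in> H" by (rule H_inv)
    then show ?thesis using gc gs(3) by (simp add: inv_mult_group)
  qed
  note gH' = this
  have gz0: "\<phi> (inv\<^bsub>G\<^esub> g) (\<iota> z0) = \<iota> zm"
    using \<phi>_inv[OF gc \<iota>_closed[OF subsetD[OF \<Sigma>_subset zmb(2)]]] by (simp add: gzm)
  show ?thesis
  proof (rule coset_class_eqI[OF gs(4)])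
    show "g [^]\<^bsub>G\<^esub> n \<in> carrier G" using gc by simp
    consider "n = 0" | k where "1 \<le> k" "n = int k" | k where "1 \<le> k" "n = - int k"
      by (metis One_nat_def Suc_leI gr0I int_cases2 of_nat_0 neg_0_equal_iff_equal)
    then show "inv\<^bsub>G\<^esub> (gs n) \<otimes>\<^bsub>G\<^esub> g [^]\<^bsub>G\<^esub> n \<in> H"
    proof cases
      case 1
      have "\<phi> (gs 0) ` \<iota> ` \<Sigma> = \<iota> ` \<Sigma>" using inner[of 0] lu \<Sigma>0 by simp
      then have "gs 0 \<in> H" by (rule self_translate_stabilizes[OF gs(1)])
      then show ?thesis using 1 H_inv gs(1) by simp
    next
      case (2 k)
      have "inv\<^bsub>G\<^esub> (gs (1 * int k)) \<otimes>\<^bsub>G\<^esub> g [^]\<^bsub>G\<^esub> k \<in> H"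
        by (rule interval_chain[OF CI proper D _ 2(1) _ gc gH z0 zmb(2) gzm bd2]) (use n 2 in auto)
      then show ?thesis using 2(2) by (simp add: int_pow_int)
    next
      case (3 k)
      have bd3: "\<Sigma> - S interior_of \<Sigma> \<subseteq> {z0, zm}" using bd2 by blast
      \<comment> \<open>The same chain in the other direction: the inverse of \<open>g\<close> sends
        \<open>z0\<close> to \<open>zm\<close>, so the two joints exchange roles.\<close>
      have "inv\<^bsub>G\<^esub> (gs ((-1) * int k)) \<otimes>\<^bsub>G\<^esub> (inv\<^bsub>G\<^esub> g) [^]\<^bsub>G\<^esub> k \<in> H"
        by (rule interval_chain[OF CI proper D _ 3(1) _ ginv gH' zm z0b(2) gz0 bd3]) (use n 3 in auto)
      then show ?thesis using 3(2) gc by (simp add: int_pow_neg_int nat_pow_inv)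
    qed
  qed
qed

end

theorem proposition5:
  fixes G :: "('g, 'r) monoid_scheme" and TG :: "'g topology" and AG :: "'g chart set"
    and M :: "'m topology" and AM :: "'m chart set"
    and \<phi> :: "'g \<Rightarrow> 'm \<Rightarrow> 'm"
    and S :: "'s topology" and AS :: "'s chart set" and \<iota> :: "'s \<Rightarrow> 'm"
    and d m :: nat and \<Sigma> :: "'s set"
  assumes "lie_group d G TG AG"
    and "analytic_manifold m M AM"
    and "pointwise_continuous_action G TG \<phi> M"
    and "non_contractive G \<phi> m M AM"
    and "analytic_1_submanifold m M AM S AS \<iota>"
    and "free_submanifold G \<phi> M S \<iota>"
    and "topspace S \<notin> free_segments G \<phi> M S \<iota>"
    and "positive_submanifold G \<phi> M S \<iota>"
    and "\<Sigma> \<in> maximal_free_segments G \<phi> M S \<iota>"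
    and "compactin S \<Sigma>"
    and "\<Sigma> \<subset> seg_interior S (topspace S)"
  shows "(circle_like S \<longrightarrow>
            (\<forall>n \<Sigma>s gs. circle_decomposition G \<phi> M S \<iota> \<Sigma> n \<Sigma>s gs \<longrightarrow>
               (\<forall>g\<in>coset_class G \<phi> S \<iota> (gs 1).
                  (\<forall>k\<le>n. coset_class G \<phi> S \<iota> (gs k) = coset_class G \<phi> S \<iota> (g [^]\<^bsub>G\<^esub> k)) \<and>
                  coset_class G \<phi> S \<iota> (g [^]\<^bsub>G\<^esub> n) = coset_class G \<phi> S \<iota> (inv\<^bsub>G\<^esub> g)))) \<and>
         (interval_like S \<longrightarrow>
            (\<forall>l u \<Sigma>s gs. interval_decomposition G \<phi> M S \<iota> \<Sigma> l u \<Sigma>s gs \<longrightarrow>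
               (\<forall>g\<in>coset_class G \<phi> S \<iota> (gs 1).
                  \<forall>n\<in>index_set l u.
                    coset_class G \<phi> S \<iota> (gs n) = coset_class G \<phi> S \<iota> (g [^]\<^bsub>G\<^esub> n))))"
proof -
  have pos: "positive_segment G \<phi> M S \<iota> \<Sigma>"
    using assms(8-10) by (simp add: positive_submanifold_def)
  have act: "analytic_action G M \<phi> m AM S AS \<iota>"
    unfolding analytic_action_def analytic_action_axioms_def
    using assms(2-5) by (auto simp: pointwise_continuous_action_def non_contractive_def)
  have loc: "free_segment_action G M \<phi> m AM S AS \<iota> \<Sigma>" if CI: "circle_like S \<or> interval_like S"
  proof -
    have "\<Sigma> \<subseteq> line_points S" using seg_interior_line_points[OF CI] assms(11) by blast
    then show ?thesis
      unfolding free_segment_action_def free_segment_action_axioms_def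
      using act assms(9,10) by (auto simp: maximal_free_segments_def)
  qed
  show ?thesis
  proof (intro conjI impI allI ballI, goal_cases)
    case (1 n \<Sigma>s gs g k)
    interpret free_segment_action G M \<phi> m AM S AS \<iota> \<Sigma> by (rule loc) (use 1(1) in blast)
    show ?case using circle_case[OF 1(1) assms(11) pos 1(2,3)] 1(4) by blast
  next
    case (2 n \<Sigma>s gs g)
    interpret free_segment_action G M \<phi> m AM S AS \<iota> \<Sigma> by (rule loc) (use 2(1) in blast)
    show ?case using circle_case[OF 2(1) assms(11) pos 2(2,3)] by blast
  next
    case (3 l u \<Sigma>s gs g n)
    interpret free_segment_action G M \<phi> m AM S AS \<iota> \<Sigma> by (rule loc) (use 3(1) in blast)
    show ?case using interval_case[OF disjI2[OF 3(1)] assms(11) pos 3(2,3,4)] .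
  qed
qed

end
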